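(* Let $\Gamma$ be a connected simplicial graph with $\mathrm{girth}(\Gamma)>20$, let $\mathcal{G}=\{G_v\}_{v\in V(\Gamma)}$ be a collection of non-trivial groups, and let $\Gamma^e$ be the extension graph of the graph product $\Gamma\mathcal{G}$. Let $n\in\mathbb{N}\cup\{0\}$. If $\mathrm{asdim}(\Gamma)\le n$, then $\mathrm{asdim}(\Gamma^e)\le n+1$.
   Context: Graphs are simplicial (no loops, no multiple edges). A connected graph $X$ is regarded as a geodesic metric space with the graph metric $d_X$ (every edge has length 1). A circuit is a closed path $(p_0,\dots,p_n)$ with $n>2$, $p_0=p_n$ and no other repeated vertices; $\mathrm{girth}(X)$ is the minimal length of a circuit in $X$, and $\infty$ if there is none. Graph product: $\Gamma\mathcal{G}$ is the quotient of the free product $\ast_{v\in V(\Gamma)}G_v$ by the normal subgroup generated by all commutators $[g_v,g_w]$ with $(v,w)\in E(\Gamma)$, $g_v\in G_v$, $g_w\in G_w$. Each $G_v$ is identified with a subgroup of $\Gamma\mathcal{G}$. Extension graph $\Gamma^e$: its vertices are the subgroups $gG_vg^{-1}$ of $\Gamma\mathcal{G}$ ($v\in V(\Gamma)$, $g\in\Gamma\mathcal{G}$), and two distinct vertices $gG_vg^{-1}$, $hG_wh^{-1}$ are adjacent iff they commute elementwise. When $\Gamma$ is connected, so is $\Gamma^e$. Asymptotic dimension: a metric space $(X,d)$ satisfies $\mathrm{asdim}(X)\le n$ if for every $r>0$ there is a cover $\mathcal{U}$ of $X$ by subsets with $\sup_{U\in\mathcal{U}}\mathrm{diam}(U)<\infty$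 such that for every $x\in X$ at most $n+1$ elements of $\mathcal{U}$ meet the closed ball of radius $r$ about $x$. *)

theory Defs
  imports
    Complex_Main
    "HOL-Library.Extended_Nat"
    "HOL-Algebra.Coset"
    "HOL-Algebra.Elementary_Groups"
begin

record 'v graph =
  verts :: "'v set"
  edges :: "'v set set"

text \<open>Edges are two-element sets of vertices, so there are no loops and no multiple edges.
  The vertex set is an arbitrary, possibly infinite, set.\<close>

definition simplicial_graph :: "'v graph \<Rightarrow> bool" where
  "simplicial_graph X \<longleftrightarrow> (\<forall>e\<in>edges X. e \<subseteq> verts X \<and> card e = 2)"

text \<open>The path $(p_0,\ldots,p_n)$ is the list of its $n+1$ vertices.\<close>

definition path_from_to :: "'v graph \<Rightarrow> 'v \<Rightarrow> 'v list \<Rightarrow> 'v \<Rightarrow> bool" where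
  "path_from_to X u p w \<longleftrightarrow>
     p \<noteq> [] \<and> set p \<subseteq> verts X \<and> successively (\<lambda>a b. {a, b} \<in> edges X) p \<and>
     hd p = u \<and> last p = w"

definition path_length :: "'v list \<Rightarrow> nat" where
  "path_length p = length p - 1"

definition connected_graph :: "'v graph \<Rightarrow> bool" where
  "connected_graph X \<longleftrightarrow> (\<forall>u\<in>verts X. \<forall>w\<in>verts X. \<exists>p. path_from_to X u p w)"

definition circuit :: "'v graph \<Rightarrow> 'v list \<Rightarrow> bool" where
  "circuit X p \<longleftrightarrow> path_from_to X (hd p) p (hd p) \<and> path_length p > 2 \<and> distinct (tl p)"

text \<open>The infimum over the empty set is \<open>\<infinity>\<close>.\<close>

definition girth :: "'v graph \<Rightarrow> enat" where
  "girth X = (INF p\<in>{p. circuit X p}. enat (path_length p))"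

definition vertex_dist :: "'v graph \<Rightarrow> 'v \<Rightarrow> 'v \<Rightarrow> nat" where
  "vertex_dist X u w = (LEAST k. \<exists>p. path_from_to X u p w \<and> path_length p = k)"

text \<open>A point of the geometric realization is given by its barycentric coordinates: a vertex is
  a unit mass, and the point at distance \<open>t\<close> from \<open>a\<close> on the edge \<open>{a, b}\<close> has coordinates
  \<open>1 - t\<close> at \<open>a\<close> and \<open>t\<close> at \<open>b\<close>.\<close>

definition supp :: "('v \<Rightarrow> real) \<Rightarrow> 'v set" where
  "supp x = {v. x v \<noteq> 0}"

definition realization :: "'v graph \<Rightarrow> ('v \<Rightarrow> real) set" where
  "realization X = {x. (\<forall>v. 0 \<le> x v) \<and> (\<Sum>v\<in>supp x. x v) = 1 \<and>
     ((\<exists>v\<in>verts X. supp x = {v}) \<or> supp x \<in> edges X)}"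

text \<open>For connected graphs this is the length metric on the realization. Two points \<open>x\<close>, \<open>y\<close> of
  an edge \<open>{a, b}\<close> have distance \<open>\<bar>x a - y a\<bar> = \<bar>x b - y b\<bar>\<close>, which is half the sum of the two.
  Two points that do not lie in a common edge are joined by a shortest path that leaves the edge
  of \<open>x\<close> through an end point \<open>u\<close> at distance \<open>1 - x u\<close> and enters that of \<open>y\<close> through an end
  point \<open>w\<close> at distance \<open>1 - y w\<close>.\<close>

definition graph_dist :: "'v graph \<Rightarrow> ('v \<Rightarrow> real) \<Rightarrow> ('v \<Rightarrow> real) \<Rightarrow> real" where
  "graph_dist X x y =
     (if \<exists>e\<in>edges X. supp x \<union> supp y \<subseteq> e
      then (\<Sum>v\<in>supp x \<union> supp y. \<bar>x v - y v\<bar>) / 2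
      else Min ((\<lambda>(u, w). (1 - x u) + real (vertex_dist X u w) + (1 - y w))
                  ` (supp x \<times> supp y)))"

text \<open>The finiteness condition is needed since \<open>card\<close> is \<open>0\<close> on infinite sets; \<open>D\<close> bounds the
  diameters of all members of the cover.\<close>

definition asdim_le :: "'a set \<Rightarrow> ('a \<Rightarrow> 'a \<Rightarrow> real) \<Rightarrow> nat \<Rightarrow> bool" where
  "asdim_le M d n \<longleftrightarrow>
     (\<forall>r>0. \<exists>\<U>. \<Union>\<U> = M \<and>
        (\<exists>D. \<forall>U\<in>\<U>. \<forall>x\<in>U. \<forall>y\<in>U. d x y \<le> D) \<and>
        (\<forall>x\<in>M. finite {U \<in> \<U>. U \<inter> {y \<in> M. d x y \<le> r} \<noteq> {}} \<and>
               card {U \<in> \<U>. U \<inter> {y \<in> M. d x y \<le> r} \<noteq> {}} \<le> n + 1))"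

definition graph_asdim_le :: "'v graph \<Rightarrow> nat \<Rightarrow> bool" where
  "graph_asdim_le X n \<longleftrightarrow> asdim_le (realization X) (graph_dist X) n"

text \<open>The free product is the quotient of the monoid of words in the disjoint union of the groups
  by the congruence that multiplies adjacent letters from the same group and deletes identity
  letters. The values of \<open>G\<close> outside \<open>I\<close> are ignored.\<close>

definition fp_words :: "'v set \<Rightarrow> ('v \<Rightarrow> ('g, 'b) monoid_scheme) \<Rightarrow> ('v \<times> 'g) list set" where
  "fp_words I G = lists (SIGMA i:I. carrier (G i))"

inductive_set fp_rel ::
    "'v set \<Rightarrow> ('v \<Rightarrow> ('g, 'b) monoid_scheme) \<Rightarrow> (('v \<times> 'g) list \<times> ('v \<times> 'g) list) set"
  for I G where
  refl: "a \<in> fp_words I G \<Longrightarrow> (a, a) \<in> fp_rel I G"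
| sym: "(a, b) \<in> fp_rel I G \<Longrightarrow> (b, a) \<in> fp_rel I G"
| trans: "(a, b) \<in> fp_rel I G \<Longrightarrow> (b, c) \<in> fp_rel I G \<Longrightarrow> (a, c) \<in> fp_rel I G"
| mult: "a \<in> fp_words I G \<Longrightarrow> b \<in> fp_words I G \<Longrightarrow> i \<in> I \<Longrightarrow> g \<in> carrier (G i) \<Longrightarrow>
    h \<in> carrier (G i) \<Longrightarrow> (a @ [(i, g), (i, h)] @ b, a @ [(i, g \<otimes>\<^bsub>G i\<^esub> h)] @ b) \<in> fp_rel I G"
| one: "a \<in> fp_words I G \<Longrightarrow> b \<in> fp_words I G \<Longrightarrow> i \<in> I \<Longrightarrow>
    (a @ [(i, \<one>\<^bsub>G i\<^esub>)] @ b, a @ b) \<in> fp_rel I G"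

definition free_product ::
    "'v set \<Rightarrow> ('v \<Rightarrow> ('g, 'b) monoid_scheme) \<Rightarrow> ('v \<times> 'g) list set monoid" where
  "free_product I G =
     \<lparr>carrier = fp_words I G // fp_rel I G,
      monoid.mult = (\<lambda>A B. \<Union>a\<in>A. \<Union>b\<in>B. fp_rel I G `` {a @ b}),
      monoid.one = fp_rel I G `` {[]}\<rparr>"

definition fp_incl ::
    "'v set \<Rightarrow> ('v \<Rightarrow> ('g, 'b) monoid_scheme) \<Rightarrow> 'v \<Rightarrow> 'g \<Rightarrow> ('v \<times> 'g) list set" where
  "fp_incl I G v g = fp_rel I G `` {[(v, g)]}"

definition normal_closure :: "('a, 'b) monoid_scheme \<Rightarrow> 'a set \<Rightarrow> 'a set" where
  "normal_closure F S = \<Inter>{N. N \<lhd> F \<and> S \<subseteq> N}"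

definition edge_commutators ::
    "'v graph \<Rightarrow> ('v \<Rightarrow> ('g, 'b) monoid_scheme) \<Rightarrow> ('v \<times> 'g) list set set" where
  "edge_commutators X G =
     (let F = free_product (verts X) G; \<iota> = fp_incl (verts X) G in
      {\<iota> v g \<otimes>\<^bsub>F\<^esub> \<iota> w h \<otimes>\<^bsub>F\<^esub> inv\<^bsub>F\<^esub> (\<iota> v g) \<otimes>\<^bsub>F\<^esub> inv\<^bsub>F\<^esub> (\<iota> w h) | v w g h.
         {v, w} \<in> edges X \<and> g \<in> carrier (G v) \<and> h \<in> carrier (G w)})"

definition graph_product ::
    "'v graph \<Rightarrow> ('v \<Rightarrow> ('g, 'b) monoid_scheme) \<Rightarrow> ('v \<times> 'g) list set set monoid" where
  "graph_product X G =
     (let F = free_product (verts X) G in F Mod normal_closure F (edge_commutators X G))"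

text \<open>The image of \<open>G v\<close> in the graph product.\<close>

definition vertex_subgroup ::
    "'v graph \<Rightarrow> ('v \<Rightarrow> ('g, 'b) monoid_scheme) \<Rightarrow> 'v \<Rightarrow> ('v \<times> 'g) list set set set" where
  "vertex_subgroup X G v =
     (let F = free_product (verts X) G; N = normal_closure F (edge_commutators X G) in
      (\<lambda>g. N #>\<^bsub>F\<^esub> fp_incl (verts X) G v g) ` carrier (G v))"

definition conj_subgroup :: "('a, 'b) monoid_scheme \<Rightarrow> 'a \<Rightarrow> 'a set \<Rightarrow> 'a set" where
  "conj_subgroup P g H = (\<lambda>x. g \<otimes>\<^bsub>P\<^esub> x \<otimes>\<^bsub>P\<^esub> inv\<^bsub>P\<^esub> g) ` H"

definition extension_graph ::
    "'v graph \<Rightarrow> ('v \<Rightarrow> ('g, 'b) monoid_scheme) \<Rightarrow> ('v \<times> 'g) list set set set graph" where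
  "extension_graph X G =
     (let P = graph_product X G;
          W = {conj_subgroup P g (vertex_subgroup X G v) | g v. g \<in> carrier P \<and> v \<in> verts X}
      in \<lparr>verts = W,
          edges = {{A, B} | A B. A \<in> W \<and> B \<in> W \<and> A \<noteq> B \<and>
                     (\<forall>a\<in>A. \<forall>b\<in>B. a \<otimes>\<^bsub>P\<^esub> b = b \<otimes>\<^bsub>P\<^esub> a)}\<rparr>)"

end

theory Submission
  imports Defs "HOL-Algebra.Bij" "HOL-Algebra.Generated_Groups"
begin

text \<open>Write \<open>\<Gamma>\<^sup>e\<close> for the extension graph. Its vertices are best thought of as hyperplanes of the Cayley graph of
the graph product with respect to the vertex groups: the vertex \<open>g G\<^sub>v g\<^sup>-\<^sup>1\<close> is crossed by the edges from \<open>p\<close>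
to \<open>p s\<close> with \<open>s \<in> G\<^sub>v\<close> and \<open>p G\<^sub>v p\<^sup>-\<^sup>1 = g G\<^sub>v g\<^sup>-\<^sup>1\<close>. The hyperplanes that are crossed by edges at a point \<open>p\<close>
form a copy of \<open>\<Gamma>\<close>, and \<open>\<Gamma>\<^sup>e\<close> is the union of these copies, glued along stars of vertices. The map
\<open>\<rho>\<close> that sends \<open>g G\<^sub>v g\<^sup>-\<^sup>1\<close> to \<open>v\<close> is a simplicial map to \<open>\<Gamma>\<close> whose restriction to each copy is an
isomorphism. The bound is \<open>n\<close> for the direction of \<open>\<Gamma>\<close>, which \<open>\<rho>\<close> sees, plus \<open>1\<close> for the tree-like
arrangement of the copies, which is measured by a height \<open>h\<close>: the distance to the copy at the identity.

All that is needed about graph products is, for each vertex \<open>v\<close>, the function that assigns to a group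
element its leading syllable in \<open>G\<^sub>v\<close>. It accumulates along a word the letters of \<open>G\<^sub>v\<close> that are read at
elements of the subgroup generated by the star of \<open>v\<close>. This gives the same value for all words of the
same element because membership in that subgroup does not change when a letter from a neighbour of \<open>v\<close> is
appended, so that the defining commutations are respected
(\<open>leading_syllable_exists\<close>). Translates of this function assign to each hyperplane and each group
element a side. It follows that two vertices of \<open>\<Gamma>\<^sup>e\<close> which coincide or commute elementwise lie in a
common copy (\<open>incident_if_equal_or_commute\<close>), that a path of \<open>\<Gamma>\<^sup>e\<close> can change sides of a hyperplane
only in the star of that hyperplane (\<open>sep_adj\<close>), and that a vertex outside the copy at \<open>p\<close> is separated
from \<open>p\<close> by a hyperplane of that copy (\<open>hyp_graph_exit\<close>).

Consequently \<open>h y \<ge> h x + d(x, y) - 2\<close> whenever \<open>x\<close> separates \<open>y\<close> from the identity. Now fix \<open>a\<close>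
and walk from the identity towards \<open>y\<close>, crossing only hyperplanes of height at most \<open>a - 2\<close>, until none
of these is left between the current element \<open>g\<close> and \<open>y\<close> (\<open>gate_exists\<close>). Then \<open>y\<close> is at distance at most
\<open>h y - a + 3\<close> from the copy at \<open>g\<close>. The same \<open>g\<close> serves for every vertex that is reached from \<open>y\<close>
inside \<open>{h \<ge> a}\<close>, since a path there avoids the stars of all hyperplanes of height at most \<open>a - 2\<close>
(\<open>gate_path\<close>). So every chain of bounded steps inside a slab \<open>{a \<le> h \<le> a + R}\<close> stays near a single copy of
\<open>\<Gamma>\<close>, on which the distance of \<open>\<Gamma>\<^sup>e\<close> is that of \<open>\<Gamma>\<close> (\<open>slab_near_copy\<close>).

For the dimension count, asymptotic dimension at most \<open>n\<close> means that at every scale the vertices can be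
coloured by \<open>n + 1\<close> colours such that monochromatic chains are bounded. Colour \<open>\<Gamma>\<^sup>e\<close> by the colour of \<open>\<rho>\<close>,
and cut each colour class into slabs by periodic windows of heights, where the windows of different colours are
far apart. The points in the window of their own colour receive one additional colour
(\<open>coarse_dim_le_Suc\<close>). A monochromatic chain then stays in a slab and has a bounded image under \<open>\<rho>\<close>,
hence it is bounded.\<close>

section \<open>Distances in graphs\<close>

definition adj :: "'v graph \<Rightarrow> ('v \<times> 'v) set" where
  "adj X = {(a, b). a \<in> verts X \<and> b \<in> verts X \<and> {a, b} \<in> edges X}"

lemma adj_sym: "(a, b) \<in> adj X \<Longrightarrow> (b, a) \<in> adj X"
  by (auto simp: adj_def insert_commute)

lemma adj_relpow_sym: "(a, b) \<in> adj X ^^ k \<Longrightarrow> (b, a) \<in> adj X ^^ k"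
proof (induction k arbitrary: b)
  case (Suc k)
  then show ?case
    by (meson adj_sym relpow_Suc_E relpow_Suc_I2)
qed simp

lemma relpow_trans: "(a, b) \<in> R ^^ i \<Longrightarrow> (b, c) \<in> R ^^ j \<Longrightarrow> (a, c) \<in> R ^^ (i + j)"
  by (auto simp: relpow_add)

text \<open>Paths are handled as iterates of the adjacency relation, which compose and decompose without list
manipulations.\<close>

lemma path_iff_relpow:
  assumes "u \<in> verts X"
  shows "(\<exists>p. path_from_to X u p w \<and> path_length p = k) \<longleftrightarrow> (u, w) \<in> adj X ^^ k"
  using assms
proof (induction k arbitrary: u)
  case 0
  have "path_from_to X u p w \<and> path_length p = 0 \<longleftrightarrow> p = [u] \<and> u = w" for p
    using 0 by (cases p) (auto simp: path_from_to_def path_length_def)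
  then show ?case by auto
next
  case (Suc k)
  show ?case
  proof
    assume "\<exists>p. path_from_to X u p w \<and> path_length p = Suc k"
    then obtain p where p: "path_from_to X u p w" "path_length p = Suc k" by blast
    then obtain b q where q: "p = u # b # q"
      by (cases p; cases "tl p") (auto simp: path_from_to_def path_length_def)
    have "path_from_to X b (b # q) w" "path_length (b # q) = k" "(u, b) \<in> adj X"
      using p unfolding q by (auto simp: path_from_to_def path_length_def adj_def)
    then show "(u, w) \<in> adj X ^^ Suc k"
      using Suc.IH[of b] by (metis (no_types, lifting) adj_def case_prodD mem_Collect_eq relpow_Suc_I2)
  next
    assume "(u, w) \<in> adj X ^^ Suc k"
    then obtain b where b: "(u, b) \<in> adj X" "(b, w) \<in> adj X ^^ k"
      by (meson relpow_Suc_D2)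
    then obtain q where q: "path_from_to X b q w" "path_length q = k"
      using Suc.IH[of b] by (auto simp: adj_def)
    have "path_from_to X u (u # q) w" "path_length (u # q) = Suc k"
      using q b Suc.prems
      by (auto simp: path_from_to_def path_length_def adj_def successively_Cons)
    then show "\<exists>p. path_from_to X u p w \<and> path_length p = Suc k" by blast
  qed
qed

lemma vertex_dist_eq: "u \<in> verts X \<Longrightarrow> vertex_dist X u w = (LEAST k. (u, w) \<in> adj X ^^ k)"
  by (simp add: vertex_dist_def path_iff_relpow)

lemma connected_graph_iff:
  "connected_graph X \<longleftrightarrow> (\<forall>u\<in>verts X. \<forall>w\<in>verts X. \<exists>k. (u, w) \<in> adj X ^^ k)"
  unfolding connected_graph_def using path_iff_relpow[of _ X] by metis

lemma vertex_dist_le: "u \<in> verts X \<Longrightarrow> (u, w) \<in> adj X ^^ k \<Longrightarrow> vertex_dist X u w \<le> k"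
  by (simp add: vertex_dist_eq Least_le)

lemma vertex_dist_relpow:
  "connected_graph X \<Longrightarrow> u \<in> verts X \<Longrightarrow> w \<in> verts X \<Longrightarrow> (u, w) \<in> adj X ^^ vertex_dist X u w"
  unfolding connected_graph_iff by (metis LeastI vertex_dist_eq)

lemma vertex_dist_self [simp]: "u \<in> verts X \<Longrightarrow> vertex_dist X u u = 0"
  using vertex_dist_le[of u X u 0] by simp

lemma vertex_dist_sym:
  "connected_graph X \<Longrightarrow> u \<in> verts X \<Longrightarrow> w \<in> verts X \<Longrightarrow> vertex_dist X u w = vertex_dist X w u"
  by (meson adj_relpow_sym antisym vertex_dist_le vertex_dist_relpow)

lemma vertex_dist_triangle:
  "connected_graph X \<Longrightarrow> u \<in> verts X \<Longrightarrow> v \<in> verts X \<Longrightarrow> w \<in> verts X \<Longrightarrow>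
   vertex_dist X u w \<le> vertex_dist X u v + vertex_dist X v w"
  by (meson relpow_trans vertex_dist_le vertex_dist_relpow)

lemma vertex_dist_zero:
  "connected_graph X \<Longrightarrow> u \<in> verts X \<Longrightarrow> w \<in> verts X \<Longrightarrow> vertex_dist X u w = 0 \<Longrightarrow> u = w"
  using vertex_dist_relpow[of X u w] by simp

section \<open>Asymptotic dimension of graphs in terms of coloured vertices\<close>

definition chain_rel :: "('a \<Rightarrow> 'a \<Rightarrow> nat) \<Rightarrow> nat \<Rightarrow> 'a set \<Rightarrow> ('a \<times> 'a) set" where
  "chain_rel d r Z = {(x, y). x \<in> Z \<and> y \<in> Z \<and> d x y \<le> r}\<^sup>*"

text \<open>A cover by \<open>n + 1\<close> classes stands for a cover by uniformly bounded sets in \<open>n + 1\<close> colours: the members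
of colour \<open>i\<close> are the chain components of \<open>Z i\<close>, which are automatically at distance more than \<open>r\<close> from
each other.\<close>

definition coarse_dim_le :: "'a set \<Rightarrow> ('a \<Rightarrow> 'a \<Rightarrow> nat) \<Rightarrow> nat \<Rightarrow> bool" where
  "coarse_dim_le V d n \<longleftrightarrow> (\<forall>r. \<exists>Z. V = (\<Union>i\<le>n. Z i) \<and>
     (\<exists>B. \<forall>i\<le>n. \<forall>x\<in>Z i. \<forall>y. (x, y) \<in> chain_rel d r (Z i) \<longrightarrow> d x y \<le> B))"

lemma chain_rel_invariant:
  assumes "(x, y) \<in> chain_rel d r Z" and "x \<in> Z" and "I x"
    and "\<And>a b. a \<in> Z \<Longrightarrow> b \<in> Z \<Longrightarrow> d a b \<le> r \<Longrightarrow> I a \<Longrightarrow> I b"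
  shows "y \<in> Z \<and> I y"
  using assms(1) unfolding chain_rel_def
  by (induction rule: rtrancl_induct) (use assms in auto)

text \<open>An invariant \<open>I\<close> along the chain is carried because the image need not land in \<open>Z'\<close> for points of \<open>Z\<close>
that lie elsewhere.\<close>

lemma chain_rel_map:
  assumes "(x, y) \<in> chain_rel d r Z" and "x \<in> Z" and "I x"
    and "\<And>a b. a \<in> Z \<Longrightarrow> b \<in> Z \<Longrightarrow> d a b \<le> r \<Longrightarrow> I a \<Longrightarrow> I b"
    and "\<And>a. a \<in> Z \<Longrightarrow> I a \<Longrightarrow> f a \<in> Z'"
    and "\<And>a b. a \<in> Z \<Longrightarrow> b \<in> Z \<Longrightarrow> d a b \<le> r \<Longrightarrow> d' (f a) (f b) \<le> r'"
  shows "(f x, f y) \<in> chain_rel d' r' Z'"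
proof -
  have "y \<in> Z \<and> I y \<and> (f x, f y) \<in> chain_rel d' r' Z'"
    using assms(1) unfolding chain_rel_def
  proof (induction rule: rtrancl_induct)
    case (step y z)
    then have "(f y, f z) \<in> {(x, y). x \<in> Z' \<and> y \<in> Z' \<and> d' x y \<le> r'}"
      using assms by auto
    then show ?case using step assms by (auto intro: rtrancl_into_rtrancl)
  qed (use assms in auto)
  then show ?thesis by blast
qed

definition vertex_point :: "'v \<Rightarrow> 'v \<Rightarrow> real" where
  "vertex_point v = (\<lambda>u. if u = v then 1 else 0)"

lemma vertex_point_apply [simp]: "vertex_point v u = (if u = v then 1 else 0)"
  by (simp add: vertex_point_def)

lemma supp_vertex_point [simp]: "supp (vertex_point v) = {v}"
  by (auto simp: supp_def)

lemma vertex_point_in_realization: "v \<in> verts X \<Longrightarrow> vertex_point v \<in> realization X"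
  unfolding realization_def by simp

lemma graph_dist_vertex_point:
  assumes "simplicial_graph X" "connected_graph X" "u \<in> verts X" "w \<in> verts X"
  shows "graph_dist X (vertex_point u) (vertex_point w) = real (vertex_dist X u w)"
proof (cases "\<exists>e\<in>edges X. {u, w} \<subseteq> e")
  case True
  then obtain e where e: "e \<in> edges X" "{u, w} \<subseteq> e" by blast
  show ?thesis
  proof (cases "u = w")
    case True
    then show ?thesis using assms e by (auto simp: graph_dist_def)
  next
    case False
    have "card e = 2" using assms(1) e by (auto simp: simplicial_graph_def)
    then have "{u, w} = e"
      using e(2) False card_subset_eq[of e "{u, w}"] by (metis card_2_iff card.infinite zero_neq_numeral)
    then have "(u, w) \<in> adj X ^^ 1" using e assms by (auto simp: adj_def)
    then have "vertex_dist X u w \<le> 1" using assms vertex_dist_le by metis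
    moreover have "vertex_dist X u w \<noteq> 0" using vertex_dist_zero[of X u w] assms False by blast
    ultimately have "vertex_dist X u w = 1" by simp
    then show ?thesis using e False by (auto simp: graph_dist_def)
  qed
next
  case False
  then show ?thesis by (auto simp: graph_dist_def)
qed

text \<open>Colours arise from multiplicity by a gap argument. Let \<open>N k v\<close> be the set of members of the
cover that come within \<open>k r\<close> of \<open>v\<close>. The cardinalities of \<open>N 0 v \<subseteq> \<dots> \<subseteq> N (n + 1) v\<close> lie between
\<open>1\<close> and \<open>n + 1\<close>, so two consecutive sets coincide. The colour of \<open>v\<close> is the cardinality of such a
stable set. Since a step of length \<open>r\<close> embeds \<open>N k v\<close> into \<open>N (k + 1) v'\<close>, two close points with
stable sets of equal cardinality have the same stable set, so a monochromatic chain stays near a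
fixed member of the cover.\<close>

lemma graph_asdim_imp_coarse_dim:
  assumes X: "simplicial_graph X" "connected_graph X" and "graph_asdim_le X n"
  shows "coarse_dim_le (verts X) (vertex_dist X) n"
  unfolding coarse_dim_le_def
proof
  fix r :: nat
  let ?d = "vertex_dist X"
  let ?V = "verts X"
  have "real ((n + 1) * r) + 1 > 0" by linarith
  then obtain \<U> D where cov: "\<Union>\<U> = realization X"
    and D: "\<And>U x y. U \<in> \<U> \<Longrightarrow> x \<in> U \<Longrightarrow> y \<in> U \<Longrightarrow> graph_dist X x y \<le> D"
    and mult: "\<And>x. x \<in> realization X \<Longrightarrow>
       finite {U \<in> \<U>. U \<inter> {y \<in> realization X. graph_dist X x y \<le> real ((n + 1) * r) + 1} \<noteq> {}} \<and>
       card {U \<in> \<U>. U \<inter> {y \<in> realization X. graph_dist X x y \<le> real ((n + 1) * r) + 1} \<noteq> {}} \<le> n + 1"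
    using assms(3) unfolding graph_asdim_le_def asdim_le_def by meson
  define N where "N k v = {U \<in> \<U>. \<exists>u\<in>?V. vertex_point u \<in> U \<and> ?d v u \<le> k * r}" for k v
  have fin: "finite (N k v) \<and> card (N k v) \<le> n + 1" if "k \<le> n + 1" "v \<in> ?V" for k v
  proof -
    let ?M = "{U \<in> \<U>. U \<inter> {y \<in> realization X. graph_dist X (vertex_point v) y \<le> real ((n + 1) * r) + 1} \<noteq> {}}"
    have "N k v \<subseteq> ?M"
    proof
      fix U assume "U \<in> N k v"
      then obtain u where u: "U \<in> \<U>" "u \<in> ?V" "vertex_point u \<in> U" "?d v u \<le> k * r"
        by (auto simp: N_def)
      have "?d v u \<le> (n + 1) * r" using u(4) that(1) by (meson le_trans mult_le_mono1)
      then have "graph_dist X (vertex_point v) (vertex_point u) \<le> real ((n + 1) * r) + 1"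
        using graph_dist_vertex_point[OF X that(2) u(2)] by linarith
      then show "U \<in> ?M" using u vertex_point_in_realization[OF u(2)] by auto
    qed
    with mult[OF vertex_point_in_realization[OF that(2)]] show ?thesis
      by (meson card_mono finite_subset le_trans)
  qed
  have nonempty: "N k v \<noteq> {}" if "v \<in> ?V" for k v
  proof -
    have vp: "vertex_point v \<in> realization X" using vertex_point_in_realization that by metis
    obtain U where "U \<in> \<U>" "vertex_point v \<in> U"
      using cov vp by blast
    then have "U \<in> N k v" using that by (auto simp: N_def)
    then show ?thesis by blast
  qed
  have mono: "N k v \<subseteq> N k' v" if "k \<le> k'" for k k' v
    unfolding N_def using that by (auto; meson le_trans mult_le_mono1)
  have shift: "N k v \<subseteq> N (Suc k) v'" if "v \<in> ?V" "v' \<in> ?V" "?d v v' \<le> r" for k v v'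
  proof
    fix U assume "U \<in> N k v"
    then obtain u where u: "U \<in> \<U>" "u \<in> ?V" "vertex_point u \<in> U" "?d v u \<le> k * r"
      by (auto simp: N_def)
    have "?d v' u \<le> ?d v' v + ?d v u" using X that u vertex_dist_triangle by metis
    also have "\<dots> \<le> Suc k * r" using u(4) that X vertex_dist_sym by fastforce
    finally show "U \<in> N (Suc k) v'" using u by (auto simp: N_def)
  qed
  have stable: "\<exists>k\<le>n. N k v = N (Suc k) v" if "v \<in> ?V" for v
  proof (rule ccontr)
    assume no: "\<not> (\<exists>k\<le>n. N k v = N (Suc k) v)"
    have "k \<le> n + 1 \<Longrightarrow> card (N k v) \<ge> k + 1" for k
    proof (induction k)
      case 0
      then show ?case using nonempty[OF that, of 0] fin[of 0 v] that
        by (simp add: Suc_le_eq card_gt_0_iff)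
    next
      case (Suc k)
      then have "N k v \<subset> N (Suc k) v" using no mono[of k "Suc k" v] by auto
      then show ?case using Suc fin[of "Suc k" v] that psubset_card_mono[of "N (Suc k) v" "N k v"]
        by simp
    qed
    from this[of "n + 1"] show False using fin[of "n + 1" v] that by simp
  qed
  define Q where "Q S v \<longleftrightarrow> (\<exists>k\<le>n. N k v = S \<and> N (Suc k) v = S)" for S v
  define Z where "Z c = {v \<in> ?V. \<exists>S. Q S v \<and> card S = Suc c}" for c
  have same: "S = S'" if "v \<in> ?V" "v' \<in> ?V" "?d v v' \<le> r" and QS: "Q S v" "Q S' v'" and "card S = card S'" for v v' S S'
  proof -
    obtain k k' where k: "k \<le> n" "N k v = S" "N (Suc k) v = S" "k' \<le> n" "N k' v' = S'" "N (Suc k') v' = S'"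
      using QS by (auto simp: Q_def)
    show ?thesis
    proof (cases "k \<le> k'")
      case True
      then have "S \<subseteq> S'" using shift[OF that(1-3), of k] mono[of "Suc k" "Suc k'" v'] k by auto
      then show ?thesis using that(6) fin[of k' v'] that k card_subset_eq by (metis le_SucI Suc_eq_plus1)
    next
      case False
      have "?d v' v \<le> r" using that X vertex_dist_sym by metis
      then have "S' \<subseteq> S" using shift[of v' v k'] that False mono[of "Suc k'" "Suc k" v] k by auto
      then show ?thesis using that(6) fin[of k v] that k card_subset_eq by (metis le_SucI Suc_eq_plus1)
    qed
  qed
  have "?V = (\<Union>i\<le>n. Z i)"
  proof
    show "?V \<subseteq> (\<Union>i\<le>n. Z i)"
    proof
      fix v assume v: "v \<in> ?V"
      then obtain k where k: "k \<le> n" "N k v = N (Suc k) v" using stable by blast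
      then have "card (N k v) \<le> n + 1" "card (N k v) > 0"
        using fin[of k v] nonempty[OF v, of k] v by (auto simp: card_gt_0_iff)
      then have "card (N k v) - 1 \<le> n" "card (N k v) = Suc (card (N k v) - 1)" by auto
      moreover have "Q (N k v) v" using k by (auto simp: Q_def)
      ultimately show "v \<in> (\<Union>i\<le>n. Z i)" using v by (auto simp: Z_def)
    qed
  qed (auto simp: Z_def)
  moreover have "?d x y \<le> nat \<lceil>D\<rceil> + 2 * ((n + 1) * r)"
    if xi: "x \<in> Z i" "(x, y) \<in> chain_rel ?d r (Z i)" for i x y
  proof -
    obtain S where S: "Q S x" "card S = Suc i" "x \<in> ?V" using xi by (auto simp: Z_def)
    have "y \<in> Z i \<and> Q S y"
    proof (rule chain_rel_invariant[where I = "Q S", OF xi(2,1) S(1)])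
      fix a b assume ab: "a \<in> Z i" "b \<in> Z i" "?d a b \<le> r" "Q S a"
      then obtain S' where "Q S' b" "card S' = Suc i" by (auto simp: Z_def)
      then show "Q S b" using same[of a b S S'] ab S by (auto simp: Z_def)
    qed
    then have y: "Q S y" "y \<in> ?V" by (auto simp: Z_def)
    obtain U where U: "U \<in> S" using S by fastforce
    have close: "\<exists>u\<in>?V. vertex_point u \<in> U \<and> U \<in> \<U> \<and> ?d z u \<le> (n + 1) * r" if Qz: "Q S z" and "z \<in> ?V" for z
    proof -
      obtain k where "k \<le> n" "N k z = S" using Qz by (auto simp: Q_def)
      then have "U \<in> N (n + 1) z" using U mono[of k "n + 1" z] by auto
      then show ?thesis by (auto simp: N_def)
    qed
    obtain u where u: "u \<in> ?V" "vertex_point u \<in> U" "U \<in> \<U>" "?d x u \<le> (n + 1) * r"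
      using close[OF S(1,3)] by blast
    obtain w where w: "w \<in> ?V" "vertex_point w \<in> U" "?d y w \<le> (n + 1) * r"
      using close[OF y] by blast
    have "real (?d u w) \<le> D"
      using D[OF u(3,2) w(2)] graph_dist_vertex_point[OF X u(1) w(1)] by simp
    then have "?d u w \<le> nat \<lceil>D\<rceil>" by linarith
    moreover have "?d x y \<le> ?d x u + ?d u w + ?d w y"
      using vertex_dist_triangle[OF X(2) S(3) u(1) y(2)] vertex_dist_triangle[OF X(2) u(1) w(1) y(2)] by simp
    moreover have "?d w y = ?d y w" using vertex_dist_sym X w y by metis
    ultimately show ?thesis using u w by simp
  qed
  ultimately show "\<exists>Z. ?V = (\<Union>i\<le>n. Z i) \<and>
     (\<exists>B. \<forall>i\<le>n. \<forall>x\<in>Z i. \<forall>y. (x, y) \<in> chain_rel ?d r (Z i) \<longrightarrow> ?d x y \<le> B)"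
    by blast
qed

lemma realization_supp:
  assumes "simplicial_graph X" "x \<in> realization X"
  shows "finite (supp x)" "supp x \<noteq> {}" "supp x \<subseteq> verts X" "0 \<le> x v"
    and "u \<in> supp x \<Longrightarrow> w \<in> supp x \<Longrightarrow> u \<noteq> w \<Longrightarrow> {u, w} \<in> edges X"
proof -
  have *: "(\<exists>v\<in>verts X. supp x = {v}) \<or> supp x \<in> edges X \<and> card (supp x) = 2 \<and> supp x \<subseteq> verts X"
    using assms by (auto simp: realization_def simplicial_graph_def)
  then show "finite (supp x)" "supp x \<noteq> {}" "supp x \<subseteq> verts X"
    by (auto intro: card_ge_0_finite)
  show "0 \<le> x v" using assms by (auto simp: realization_def)
  assume uw: "u \<in> supp x" "w \<in> supp x" "u \<noteq> w"
  then have e: "supp x \<in> edges X" "card (supp x) = 2" using * by auto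
  then have "{u, w} = supp x"
    using uw card_subset_eq[of "supp x" "{u, w}"] \<open>finite (supp x)\<close> by auto
  then show "{u, w} \<in> edges X" using e by simp
qed

text \<open>Each point of the realization is replaced by a vertex of its support, at the cost of a bounded
error in distances. At a scale above twice the radius, a ball meets at most one chain component of each
colour.\<close>

lemma coarse_dim_imp_graph_asdim:
  assumes X: "simplicial_graph X" "connected_graph X"
    and dim: "coarse_dim_le (verts X) (vertex_dist X) n"
  shows "graph_asdim_le X n"
  unfolding graph_asdim_le_def asdim_le_def
proof (intro allI impI)
  fix r :: real
  assume "r > 0"
  let ?d = "vertex_dist X"
  let ?V = "verts X"
  let ?M = "realization X"
  define c where "c x = (SOME v. v \<in> supp x)" for x :: "'a \<Rightarrow> real"
  have c: "c x \<in> supp x" "c x \<in> ?V" if "x \<in> ?M" for x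
    using realization_supp[OF X(1) that] someI_ex[of "\<lambda>v. v \<in> supp x"] unfolding c_def by auto
  have le1: "?d u w \<le> 1" if "x \<in> ?M" "u \<in> supp x" "w \<in> supp x" for x u w
  proof (cases "u = w")
    case True
    then show ?thesis using realization_supp(3)[OF X(1) that(1)] that by auto
  next
    case False
    then have "(u, w) \<in> adj X ^^ 1"
      using realization_supp[OF X(1) that(1)] that by (auto simp: adj_def)
    then show ?thesis using vertex_dist_le[of u X w 1] realization_supp(3)[OF X(1) that(1)] that by auto
  qed
  have sum1: "(\<Sum>v\<in>supp x. x v) = 1" if "x \<in> ?M" for x
    using that by (auto simp: realization_def)
  have lower: "real (?d (c x) (c y)) \<le> graph_dist X x y + 2" if xy: "x \<in> ?M" "y \<in> ?M" for x y
  proof (cases "\<exists>e\<in>edges X. supp x \<union> supp y \<subseteq> e")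
    case True
    then obtain e where e: "e \<in> edges X" "supp x \<union> supp y \<subseteq> e" by blast
    have "?d (c x) (c y) \<le> 1"
    proof (cases "c x = c y")
      case True
      then show ?thesis using c xy by simp
    next
      case False
      have "card e = 2" using e X by (auto simp: simplicial_graph_def)
      then have "{c x, c y} = e"
        using e(2) c[OF xy(1)] c[OF xy(2)] False card_subset_eq[of e "{c x, c y}"]
        by (metis Un_iff card_2_iff card.infinite empty_subsetI insert_subset subset_iff zero_neq_numeral)
      then have "(c x, c y) \<in> adj X ^^ 1" using e c xy by (auto simp: adj_def)
      then show ?thesis using vertex_dist_le c xy by metis
    qed
    moreover have "graph_dist X x y \<ge> 0" using True by (auto simp: graph_dist_def sum_nonneg)
    ultimately show ?thesis by linarith
  next
    case False
    let ?A = "(\<lambda>(u, w). (1 - x u) + real (?d u w) + (1 - y w)) ` (supp x \<times> supp y)"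
    have "finite ?A" "?A \<noteq> {}"
      using realization_supp[OF X(1) xy(1)] realization_supp[OF X(1) xy(2)] by auto
    then have "Min ?A \<in> ?A" by (rule Min_in)
    then obtain u w where uw: "u \<in> supp x" "w \<in> supp y" "Min ?A = (1 - x u) + real (?d u w) + (1 - y w)"
      by auto
    have "x u \<le> 1" "y w \<le> 1"
      using member_le_sum[of u "supp x" x] member_le_sum[of w "supp y" y] uw
        realization_supp[OF X(1) xy(1)] realization_supp[OF X(1) xy(2)] sum1[OF xy(1)] sum1[OF xy(2)] by auto
    moreover have gd: "graph_dist X x y = Min ?A" unfolding graph_dist_def by (rule if_not_P[OF False])
    ultimately have "real (?d u w) \<le> graph_dist X x y"
      using uw(3) gd by linarith
    moreover have "?d (c x) (c y) \<le> ?d (c x) u + ?d u w + ?d w (c y)"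
    proof -
      have v: "u \<in> ?V" "w \<in> ?V"
        using realization_supp(3)[OF X(1) xy(1)] realization_supp(3)[OF X(1) xy(2)] uw by auto
      show ?thesis
        using vertex_dist_triangle[OF X(2) c(2)[OF xy(1)] v(1) c(2)[OF xy(2)]]
          vertex_dist_triangle[OF X(2) v c(2)[OF xy(2)]] by simp
    qed
    moreover have "?d (c x) u \<le> 1" "?d w (c y) \<le> 1" using le1 c xy uw by auto
    ultimately show ?thesis by linarith
  qed
  have upper: "graph_dist X x y \<le> real (?d (c x) (c y)) + 2" if xy: "x \<in> ?M" "y \<in> ?M" for x y
  proof (cases "\<exists>e\<in>edges X. supp x \<union> supp y \<subseteq> e")
    case True
    let ?U = "supp x \<union> supp y"
    have f: "finite (supp x)" "finite (supp y)" using realization_supp X xy by metis+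
    have "(\<Sum>v\<in>?U. \<bar>x v - y v\<bar>) \<le> (\<Sum>v\<in>?U. x v + y v)"
      by (rule sum_mono) (use realization_supp(4)[OF X(1)] xy in \<open>auto simp: abs_le_iff\<close>)
    also have "\<dots> = (\<Sum>v\<in>?U. x v) + (\<Sum>v\<in>?U. y v)" by (rule sum.distrib)
    also have "(\<Sum>v\<in>?U. x v) = (\<Sum>v\<in>supp x. x v)"
      by (rule sum.mono_neutral_right) (use f in \<open>auto simp: supp_def\<close>)
    also have "(\<Sum>v\<in>?U. y v) = (\<Sum>v\<in>supp y. y v)"
      by (rule sum.mono_neutral_right) (use f in \<open>auto simp: supp_def\<close>)
    finally show ?thesis using True sum1 xy unfolding graph_dist_def by simp
  next
    case False
    let ?A = "(\<lambda>(u, w). (1 - x u) + real (?d u w) + (1 - y w)) ` (supp x \<times> supp y)"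
    have "finite ?A"
      using realization_supp[OF X(1) xy(1)] realization_supp[OF X(1) xy(2)] by auto
    moreover have "(1 - x (c x)) + real (?d (c x) (c y)) + (1 - y (c y)) \<in> ?A"
      using c xy by force
    ultimately have "Min ?A \<le> (1 - x (c x)) + real (?d (c x) (c y)) + (1 - y (c y))"
      by (rule Min_le)
    moreover have "0 \<le> x (c x)" "0 \<le> y (c y)" using realization_supp(4)[OF X(1)] xy by auto
    moreover have "graph_dist X x y = Min ?A" unfolding graph_dist_def by (rule if_not_P[OF False])
    ultimately show ?thesis by linarith
  qed
  \<comment> \<open>Two points within \<open>r\<close> of a third one have representing vertices at distance at most \<open>2 (r + 2)\<close>.\<close>
  define r' where "r' = nat \<lceil>2 * r\<rceil> + 4"
  obtain Z B where Z: "?V = (\<Union>i\<le>n. Z i)"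
    and B: "\<And>i x y. i \<le> n \<Longrightarrow> x \<in> Z i \<Longrightarrow> (x, y) \<in> chain_rel ?d r' (Z i) \<Longrightarrow> ?d x y \<le> B"
    using dim unfolding coarse_dim_le_def by meson
  define U where "U i v = {x \<in> ?M. (v, c x) \<in> chain_rel ?d r' (Z i)}" for i v
  define \<U> where "\<U> = {U i v | i v. i \<le> n \<and> v \<in> Z i}"
  have chain_sym: "(b, a) \<in> chain_rel ?d r' (Z i)" if "(a, b) \<in> chain_rel ?d r' (Z i)" "i \<le> n" for a b i
  proof -
    have "sym {(x, y). x \<in> Z i \<and> y \<in> Z i \<and> ?d x y \<le> r'}"
    proof (rule symI, clarsimp)
      fix x y assume "x \<in> Z i" "y \<in> Z i" "?d x y \<le> r'"
      moreover have "x \<in> ?V" "y \<in> ?V" using Z \<open>i \<le> n\<close> \<open>x \<in> Z i\<close> \<open>y \<in> Z i\<close> by auto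
      ultimately show "?d y x \<le> r'" using vertex_dist_sym[OF X(2)] by metis
    qed
    then show ?thesis using that(1) unfolding chain_rel_def by (meson sym_rtrancl symD)
  qed
  have "\<Union>\<U> = ?M"
  proof
    show "?M \<subseteq> \<Union>\<U>"
    proof
      fix x assume x: "x \<in> ?M"
      then obtain i where "i \<le> n" "c x \<in> Z i" using c Z by blast
      then have "x \<in> U i (c x)" "U i (c x) \<in> \<U>"
        using x by (auto simp: U_def \<U>_def chain_rel_def)
      then show "x \<in> \<Union>\<U>" by blast
    qed
  qed (auto simp: \<U>_def U_def)
  moreover have "graph_dist X x y \<le> real (2 * B) + 2" if W: "W \<in> \<U>" "x \<in> W" "y \<in> W" for W x y
  proof -
    obtain i v where i: "i \<le> n" "v \<in> Z i" "W = U i v" using W by (auto simp: \<U>_def)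
    then have cx: "(v, c x) \<in> chain_rel ?d r' (Z i)" "(v, c y) \<in> chain_rel ?d r' (Z i)" "x \<in> ?M" "y \<in> ?M"
      using W by (auto simp: U_def)
    have v: "v \<in> ?V" using i Z by auto
    have "?d v (c x) \<le> B" "?d v (c y) \<le> B" using B i cx by auto
    moreover have "?d (c x) (c y) \<le> ?d (c x) v + ?d v (c y)"
      using vertex_dist_triangle[OF X(2) _ v] c cx by auto
    moreover have "?d (c x) v = ?d v (c x)" using vertex_dist_sym[OF X(2)] v c cx by auto
    ultimately have "real (?d (c x) (c y)) \<le> real (2 * B)" by linarith
    then show ?thesis using upper[OF cx(3,4)] by linarith
  qed
  moreover have "finite {W \<in> \<U>. W \<inter> {y \<in> ?M. graph_dist X x y \<le> r} \<noteq> {}} \<and>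
      card {W \<in> \<U>. W \<inter> {y \<in> ?M. graph_dist X x y \<le> r} \<noteq> {}} \<le> n + 1" if x: "x \<in> ?M" for x
  proof -
    let ?S = "{W \<in> \<U>. W \<inter> {y \<in> ?M. graph_dist X x y \<le> r} \<noteq> {}}"
    let ?hit = "\<lambda>i W. \<exists>v\<in>Z i. W = U i v \<and> W \<inter> {y \<in> ?M. graph_dist X x y \<le> r} \<noteq> {}"
    have uniq: "W = W'" if i: "i \<le> n" and hit: "?hit i W" "?hit i W'" for i W W'
    proof -
      obtain v y where v: "v \<in> Z i" "W = U i v" "(v, c y) \<in> chain_rel ?d r' (Z i)" "y \<in> ?M" "graph_dist X x y \<le> r"
        using hit(1) by (auto simp: U_def)
      obtain v' y' where v': "v' \<in> Z i" "W' = U i v'" "(v', c y') \<in> chain_rel ?d r' (Z i)" "y' \<in> ?M" "graph_dist X x y' \<le> r"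
        using hit(2) by (auto simp: U_def)
      have "c y \<in> Z i" "c y' \<in> Z i"
        using chain_rel_invariant[where I = "\<lambda>_. True", OF v(3,1)]
          chain_rel_invariant[where I = "\<lambda>_. True", OF v'(3,1)] by auto
      moreover have "?d (c y) (c y') \<le> r'"
      proof -
        have "?d (c y) (c y') \<le> ?d (c y) (c x) + ?d (c x) (c y')"
          using vertex_dist_triangle[OF X(2)] c x v v' by auto
        moreover have "?d (c y) (c x) = ?d (c x) (c y)" using vertex_dist_sym[OF X(2)] c x v by auto
        ultimately show ?thesis
          using lower[OF x v(4)] lower[OF x v'(4)] v(5) v'(5) \<open>r > 0\<close> unfolding r'_def by linarith
      qed
      ultimately have "(c y, c y') \<in> chain_rel ?d r' (Z i)"
        unfolding chain_rel_def by auto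
      then have vv': "(v, v') \<in> chain_rel ?d r' (Z i)"
        using v(3) chain_sym[OF v'(3) i] unfolding chain_rel_def by (meson rtrancl_trans)
      have "(v, a) \<in> chain_rel ?d r' (Z i) \<longleftrightarrow> (v', a) \<in> chain_rel ?d r' (Z i)" for a
        using vv' chain_sym[OF vv' i] unfolding chain_rel_def by (meson rtrancl_trans)
      then show ?thesis using v v' by (simp add: U_def)
    qed
    have "?S \<subseteq> (\<lambda>i. SOME W. ?hit i W) ` {..n}"
    proof
      fix W assume "W \<in> ?S"
      then obtain i where i: "i \<le> n" "?hit i W" by (auto simp: \<U>_def)
      have "?hit i (SOME W. ?hit i W)" using i(2) by (rule someI)
      then have "(SOME W. ?hit i W) = W" using uniq[OF i(1) _ i(2)] by simp
      then show "W \<in> (\<lambda>i. SOME W. ?hit i W) ` {..n}"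
        using i(1) by (intro rev_image_eqI[of i]) simp_all
    qed
    then show ?thesis
      using finite_surj[of "{..n}" ?S] surj_card_le[of "{..n}" ?S] by (simp add: card_atMost)
  qed
  ultimately show "\<exists>\<U>. \<Union>\<U> = ?M \<and> (\<exists>D. \<forall>U\<in>\<U>. \<forall>x\<in>U. \<forall>y\<in>U. graph_dist X x y \<le> D) \<and>
     (\<forall>x\<in>?M. finite {U \<in> \<U>. U \<inter> {y \<in> ?M. graph_dist X x y \<le> r} \<noteq> {}} \<and>
             card {U \<in> \<U>. U \<inter> {y \<in> ?M. graph_dist X x y \<le> r} \<noteq> {}} \<le> n + 1)"
    by (intro exI[of _ \<U>] conjI ballI exI[of _ "real (2 * B) + 2"]) simp_all
qed

section \<open>Adding a height function\<close>

text \<open>Two close numbers that both avoid the window \<open>{0..r}\<close> modulo \<open>T\<close> lie in the same period.\<close>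

lemma div_eq_of_close:
  fixes s s' T r :: nat
  assumes "s mod T > r" "s' mod T > r" "s \<le> s' + r" "s' \<le> s + r" "T > 0"
  shows "s div T = s' div T"
proof -
  have *: "\<not> a div T < b div T" if "a mod T > r" "b mod T > r" "b \<le> a + r" for a b
  proof
    assume "a div T < b div T"
    then have "T * (a div T) + T \<le> T * (b div T)"
      by (metis Suc_leI add.commute mult_Suc_right mult_le_mono2)
    moreover have "a mod T < T" using assms by simp
    moreover have "a = T * (a div T) + a mod T" "b = T * (b div T) + b mod T" by simp_all
    ultimately show False using that by linarith
  qed
  show ?thesis using *[of s s'] *[of s' s] assms by (metis linorder_neqE_nat)
qed

lemma div_eq_of_close_small:
  fixes t t' L r :: nat
  assumes "t mod L \<le> r" "t' mod L \<le> r" "t \<le> t' + r" "t' \<le> t + r" "L > 2 * r"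
  shows "t div L = t' div L"
proof -
  have *: "\<not> a div L < b div L" if "a mod L \<le> r" "b \<le> a + r" for a b
  proof
    assume "a div L < b div L"
    then have "L * (a div L) + L \<le> L * (b div L)"
      by (metis Suc_leI add.commute mult_Suc_right mult_le_mono2)
    moreover have "a = L * (a div L) + a mod L" "b = L * (b div L) + b mod L" by simp_all
    ultimately show False using that assms by linarith
  qed
  show ?thesis using *[of t t'] *[of t' t] assms by (metis linorder_neqE_nat)
qed

text \<open>The product estimate behind the theorem: \<open>\<rho>\<close> carries \<open>n + 1\<close> colours, \<open>h\<close> contributes the real line, and
the assumption \<open>slab\<close> says that a chain with bounded \<open>\<rho>\<close>-image and bounded height is bounded. Only one further
colour is needed for the line, because each of the old colours has its own set of cutting heights and these sets
are far apart: in the additional colour, the height determines the old colour.\<close>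

lemma coarse_dim_le_Suc:
  fixes \<rho> :: "'w \<Rightarrow> 'v" and h :: "'w \<Rightarrow> nat"
  assumes base: "coarse_dim_le V dV n"
    and \<rho>: "\<And>x. x \<in> W \<Longrightarrow> \<rho> x \<in> V" "\<And>x y. x \<in> W \<Longrightarrow> y \<in> W \<Longrightarrow> dV (\<rho> x) (\<rho> y) \<le> d x y"
    and h: "\<And>x y. x \<in> W \<Longrightarrow> y \<in> W \<Longrightarrow> h x \<le> h y + d x y"
    and d_sym: "\<And>x y. x \<in> W \<Longrightarrow> y \<in> W \<Longrightarrow> d x y = d y x"
    and slab: "\<And>r R. \<exists>B. \<forall>a. \<forall>x\<in>W. \<forall>y. a \<le> h x \<longrightarrow> h x \<le> a + R \<longrightarrow>
      (x, y) \<in> chain_rel d r {z \<in> W. a \<le> h z \<and> h z \<le> a + R} \<longrightarrow> d x y \<le> dV (\<rho> x) (\<rho> y) + B"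
  shows "coarse_dim_le W d (Suc n)"
  unfolding coarse_dim_le_def
proof
  fix r :: nat
  define L where "L = 2 * r + 1"
  define T where "T = (n + 1) * L"
  have pos: "L > 2 * r" "L > 0" "T > 0" "L \<le> T" by (auto simp: L_def T_def)
  obtain Z B where Z: "V = (\<Union>i\<le>n. Z i)"
    and B: "\<And>i x y. i \<le> n \<Longrightarrow> x \<in> Z i \<Longrightarrow> (x, y) \<in> chain_rel dV r (Z i) \<Longrightarrow> dV x y \<le> B"
    using base unfolding coarse_dim_le_def by meson
  obtain C where C: "\<And>a x y. x \<in> W \<Longrightarrow> a \<le> h x \<Longrightarrow> h x \<le> a + 2 * T \<Longrightarrow>
      (x, y) \<in> chain_rel d r {z \<in> W. a \<le> h z \<and> h z \<le> a + 2 * T} \<Longrightarrow> d x y \<le> dV (\<rho> x) (\<rho> y) + C"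
    using slab[of "2 * T" r] by meson
  \<comment> \<open>The window of colour \<open>i\<close> consists of the heights \<open>i L, \<dots>, i L + r\<close> modulo \<open>T\<close>; adding \<open>(n + 1 - i) L\<close>
      shifts it to the start of a period without leaving the natural numbers.\<close>
  define s where "s i t = t + (n + 1 - i) * L" for i t :: nat
  define near where "near i t \<longleftrightarrow> s i t mod T \<le> r" for i t
  have near_mod: "t mod L \<le> r \<and> (t div L) mod (n + 1) = i" if "near i t" and ile: "i \<le> n" for i t
  proof -
    define k e where "k = s i t div T" and "e = s i t mod T"
    then have ke: "s i t = k * T + e" "e \<le> r"
      using that(1) by (simp_all add: near_def)
    have "(n + 1 - i) * L \<le> k * T + e" using ke(1) by (simp add: s_def)
    moreover have "e < L" using ke pos by linarith
    ultimately have "(n + 1 - i) * L < (k * (n + 1) + 1) * L"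
      by (simp add: T_def algebra_simps)
    then have le: "n + 1 - i \<le> k * (n + 1)" by (metis Suc_eq_plus1 less_Suc_eq_le mult_less_cancel2)
    have "t = k * (n + 1) * L + e - (n + 1 - i) * L"
      using ke(1) unfolding s_def T_def mult.assoc by linarith
    also have "\<dots> = (k * (n + 1) - (n + 1 - i)) * L + e"
      using mult_le_mono1[OF le, of L] unfolding diff_mult_distrib by linarith
    finally have t: "t = (k * (n + 1) - (n + 1 - i)) * L + e" .
    then have "t mod L = e" "t div L = k * (n + 1) - (n + 1 - i)" using \<open>e < L\<close> by simp_all
    moreover have "(k * (n + 1) - (n + 1 - i)) mod (n + 1) = i"
    proof -
      obtain k' where "k = Suc k'" using le ile by (cases k) auto
      then have "k * (n + 1) - (n + 1 - i) = k' * (n + 1) + i" using that(2) by simp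
      moreover have "(i + k' * (n + 1)) mod (n + 1) = i mod (n + 1)" by (rule mod_mult_self1)
      ultimately show ?thesis using ile by (simp only: add.commute) simp
    qed
    ultimately show ?thesis using ke by simp
  qed
  define Y where "Y i = (if i \<le> n then {x \<in> W. \<rho> x \<in> Z i \<and> \<not> near i (h x)}
      else {x \<in> W. \<exists>j\<le>n. \<rho> x \<in> Z j \<and> near j (h x)})" for i
  have "W = (\<Union>i\<le>Suc n. Y i)"
  proof
    show "W \<subseteq> (\<Union>i\<le>Suc n. Y i)"
    proof
      fix x assume x: "x \<in> W"
      then obtain i where i: "i \<le> n" "\<rho> x \<in> Z i" using \<rho> Z by blast
      show "x \<in> (\<Union>i\<le>Suc n. Y i)"
      proof (cases "near i (h x)")
        case True
        then have "x \<in> Y (Suc n)" using x i by (auto simp: Y_def)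
        then show ?thesis by blast
      next
        case False
        then have "x \<in> Y i" using x i by (auto simp: Y_def)
        then show ?thesis using i by auto
      qed
    qed
  qed (auto simp: Y_def split: if_splits)
  moreover have "d x y \<le> B + C"
    if "i \<le> Suc n" and x: "x \<in> Y i" and chain: "(x, y) \<in> chain_rel d r (Y i)" for i x y
  proof -
    have YW: "Y i \<subseteq> W" by (auto simp: Y_def)
    have close: "h a \<le> h b + r \<and> h b \<le> h a + r \<and> dV (\<rho> a) (\<rho> b) \<le> r"
      if "a \<in> Y i" "b \<in> Y i" "d a b \<le> r" for a b
      using h[of a b] h[of b a] \<rho>(2)[of a b] d_sym[of a b] that YW by fastforce
    \<comment> \<open>Both kinds of colours lead to an invariant \<open>I\<close> of the chain that fixes a slab and a colour of the image under \<open>\<rho>\<close>.\<close>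
    have finish: ?thesis
      if "j \<le> n" "I x"
        and I1: "\<And>z. z \<in> Y i \<Longrightarrow> I z \<Longrightarrow> \<rho> z \<in> Z j"
        and I2: "\<And>z. z \<in> Y i \<Longrightarrow> I z \<Longrightarrow> a \<le> h z \<and> h z \<le> a + 2 * T"
        and I3: "\<And>z z'. z \<in> Y i \<Longrightarrow> z' \<in> Y i \<Longrightarrow> d z z' \<le> r \<Longrightarrow> I z \<Longrightarrow> I z'"
      for j a I
    proof -
      have "(\<rho> x, \<rho> y) \<in> chain_rel dV r (Z j)"
        by (rule chain_rel_map[where I = I, OF chain x \<open>I x\<close> I3 I1]) (use close in auto)
      then have "dV (\<rho> x) (\<rho> y) \<le> B" using B[OF \<open>j \<le> n\<close> I1[OF x \<open>I x\<close>]] by simp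
      moreover have "(x, y) \<in> chain_rel d r {z \<in> W. a \<le> h z \<and> h z \<le> a + 2 * T}"
        by (rule chain_rel_map[where I = I and f = "\<lambda>z. z", OF chain x \<open>I x\<close> I3]) (use I2 YW in auto)
      then have "d x y \<le> dV (\<rho> x) (\<rho> y) + C" using C[of x a y] I2[OF x \<open>I x\<close>] x YW by blast
      ultimately show ?thesis by linarith
    qed
    show ?thesis
    proof (cases "i \<le> n")
      case True
      define q where "q = s i (h x) div T"
      have inv: "s i (h z') div T = q" if z: "z \<in> Y i" "z' \<in> Y i" "d z z' \<le> r" "s i (h z) div T = q" for z z'
      proof -
        have "s i (h z) div T = s i (h z') div T"
          using close[OF z(1-3)] z True pos
          by (intro div_eq_of_close[of r]) (auto simp: Y_def near_def, auto simp: s_def)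
        then show ?thesis using z by simp
      qed
      have range: "q * T - (n + 1 - i) * L \<le> h z \<and> h z \<le> (q * T - (n + 1 - i) * L) + 2 * T"
        if "s i (h z) div T = q" for z
      proof -
        have "q * T \<le> s i (h z)" "s i (h z) < q * T + T"
          using that div_times_less_eq_dividend[of "s i (h z)" T] dividend_less_div_times[OF pos(3), of "s i (h z)"]
          by auto
        moreover have "(n + 1 - i) * L \<le> T" unfolding T_def by (rule mult_le_mono1) simp
        ultimately show ?thesis unfolding s_def by linarith
      qed
      show ?thesis
      proof (rule finish[OF True, of "\<lambda>z. s i (h z) div T = q" "q * T - (n + 1 - i) * L"])
        show "s i (h z') div T = q"
          if "z \<in> Y i" "z' \<in> Y i" "d z z' \<le> r" "s i (h z) div T = q" for z z'
          using inv that .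
      qed (use True range in \<open>auto simp: q_def Y_def\<close>)
    next
      case False
      define q where "q = h x div L"
      define j where "j = q mod (n + 1)"
      have j: "\<rho> z \<in> Z j" if "z \<in> Y i" "h z div L = q" for z
        using that False near_mod by (auto simp: Y_def j_def)
      have inv: "h z' div L = q" if z: "z \<in> Y i" "z' \<in> Y i" "d z z' \<le> r" "h z div L = q" for z z'
      proof -
        have "h z mod L \<le> r" "h z' mod L \<le> r" using z False near_mod by (auto simp: Y_def)
        then have "h z div L = h z' div L"
          using close[OF z(1-3)] pos by (intro div_eq_of_close_small[of _ _ r]) auto
        then show ?thesis using z by simp
      qed
      have range: "q * L \<le> h z \<and> h z \<le> q * L + 2 * T" if "h z div L = q" for z
      proof -
        have "q * L \<le> h z" "h z < q * L + L"
          using that div_times_less_eq_dividend[of "h z" L] dividend_less_div_times[OF pos(2), of "h z"]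
          by auto
        then show ?thesis using pos by linarith
      qed
      show ?thesis
      proof (rule finish[of j "\<lambda>z. h z div L = q" "q * L"])
        show "h z' div L = q" if "z \<in> Y i" "z' \<in> Y i" "d z z' \<le> r" "h z div L = q" for z z'
          using inv that .
      qed (use j range in \<open>auto simp: q_def j_def less_Suc_eq_le\<close>)
    qed
  qed
  ultimately show "\<exists>Z. W = (\<Union>i\<le>Suc n. Z i) \<and>
     (\<exists>B. \<forall>i\<le>Suc n. \<forall>x\<in>Z i. \<forall>y. (x, y) \<in> chain_rel d r (Z i) \<longrightarrow> d x y \<le> B)"
    by blast
qed

section \<open>Sector systems\<close>

definition star :: "'v graph \<Rightarrow> 'v \<Rightarrow> 'v set" where
  "star X x = {y. y = x \<or> (x, y) \<in> adj X}"

lemma star_sym: "y \<in> star X x \<longleftrightarrow> x \<in> star X y"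
  by (auto simp: star_def intro: adj_sym)

text \<open>The combinatorial properties of \<open>\<Gamma>\<^sup>e\<close> on which the geometric argument rests. The points are the
elements of the graph product, \<open>copy p\<close> is the set of hyperplanes crossed by edges at \<open>p\<close>, and \<open>side x p\<close> is
the side of the hyperplane \<open>x\<close> on which \<open>p\<close> lies. A vertex \<open>y\<close> outside the star of \<open>x\<close> does not cross
\<open>x\<close>, so it has a well-defined side, that of any point at which it is seen (\<open>side_unique\<close>). The property \<open>nested\<close> says
that, for two hyperplanes that do not cross, a point which \<open>x\<close> separates from \<open>x'\<close> lies on the same
side of \<open>x'\<close> as \<open>x\<close>.\<close>

locale sector_system =
  fixes X :: "'w graph" and Pts :: "'p set" and copy :: "'p \<Rightarrow> 'w set" and side :: "'w \<Rightarrow> 'p \<Rightarrow> 's"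
  assumes copy_subset: "p \<in> Pts \<Longrightarrow> copy p \<subseteq> verts X"
    and vertex_in_copy: "y \<in> verts X \<Longrightarrow> \<exists>p\<in>Pts. y \<in> copy p"
    and edge_in_copy: "(y, y') \<in> adj X \<Longrightarrow> \<exists>p\<in>Pts. y \<in> copy p \<and> y' \<in> copy p"
    and side_unique: "x \<in> verts X \<Longrightarrow> p \<in> Pts \<Longrightarrow> q \<in> Pts \<Longrightarrow> y \<in> copy p \<Longrightarrow> y \<in> copy q \<Longrightarrow>
      y \<notin> star X x \<Longrightarrow> side x p = side x q"
    and cross: "p \<in> Pts \<Longrightarrow> q \<in> Pts \<Longrightarrow> x \<in> copy p \<Longrightarrow>
      \<exists>p'\<in>Pts. side x p' = side x q \<and> (\<forall>x'\<in>verts X. x' \<noteq> x \<longrightarrow> side x' p' = side x' p)"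
    and exit: "p \<in> Pts \<Longrightarrow> y \<in> verts X \<Longrightarrow> y \<notin> copy p \<Longrightarrow>
      \<exists>x\<in>copy p. y \<notin> star X x \<and> (\<exists>q\<in>Pts. y \<in> copy q \<and> side x q \<noteq> side x p)"
    and finite_separators: "p \<in> Pts \<Longrightarrow> q \<in> Pts \<Longrightarrow> finite {x \<in> verts X. side x p \<noteq> side x q}"
    and nested: "x \<in> verts X \<Longrightarrow> x' \<in> verts X \<Longrightarrow> x' \<notin> star X x \<Longrightarrow> p \<in> Pts \<Longrightarrow> q \<in> Pts \<Longrightarrow> q' \<in> Pts \<Longrightarrow>
      x \<in> copy q \<Longrightarrow> x' \<in> copy q' \<Longrightarrow> side x p \<noteq> side x q' \<Longrightarrow> side x' p = side x' q"
begin

text \<open>The hyperplane \<open>x\<close> separates the point \<open>p\<close> from the vertex \<open>y\<close>.\<close>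

definition sep :: "'p \<Rightarrow> 'w \<Rightarrow> 'w \<Rightarrow> bool" where
  "sep p x y \<longleftrightarrow> x \<in> verts X \<and> y \<notin> star X x \<and> (\<exists>q\<in>Pts. y \<in> copy q \<and> side x q \<noteq> side x p)"

lemma sep_iff:
  assumes "q \<in> Pts" "y \<in> copy q"
  shows "sep p x y \<longleftrightarrow> x \<in> verts X \<and> y \<notin> star X x \<and> side x q \<noteq> side x p"
proof
  assume "sep p x y"
  then obtain q' where q': "x \<in> verts X" "y \<notin> star X x" "q' \<in> Pts" "y \<in> copy q'" "side x q' \<noteq> side x p"
    by (auto simp: sep_def)
  then show "x \<in> verts X \<and> y \<notin> star X x \<and> side x q \<noteq> side x p"
    using side_unique[OF q'(1) assms(1) q'(3) assms(2) q'(4,2)] by simp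
qed (use assms in \<open>auto simp: sep_def\<close>)

lemma sep_adj:
  assumes "(y, y') \<in> adj X" "y \<notin> star X x" "y' \<notin> star X x"
  shows "sep p x y \<longleftrightarrow> sep p x y'"
proof -
  obtain q where "q \<in> Pts" "y \<in> copy q" "y' \<in> copy q" using edge_in_copy assms by blast
  then show ?thesis using assms by (simp add: sep_iff)
qed

lemma not_sep_copy: "p \<in> Pts \<Longrightarrow> y \<in> copy p \<Longrightarrow> \<not> sep p x y"
  by (simp add: sep_iff)

text \<open>The only difficulty is that \<open>y\<close> might cross \<open>x'\<close>. Then \<open>x'\<close> and \<open>y\<close> would lie in a common copy and
hence on the same side of \<open>x\<close>, whereas \<open>x'\<close> lies on the side of \<open>p\<close> and \<open>y\<close> does not.\<close>

lemma sep_trans: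
  assumes p: "p \<in> Pts" and x': "x' \<in> copy p" "sep p x' x" and x: "sep p x y" and y: "y \<in> verts X"
  shows "sep p x' y"
proof -
  obtain q where q: "q \<in> Pts" "y \<in> copy q" using vertex_in_copy y by blast
  have xv: "x \<in> verts X" "x' \<in> verts X" using x x' by (auto simp: sep_def)
  then obtain qx where qx: "qx \<in> Pts" "x \<in> copy qx" using vertex_in_copy by blast
  have nx: "x' \<notin> star X x" using x'(2) star_sym[of x' X x] by (simp add: sep_def)
  have side_y: "side x q \<noteq> side x p" "y \<notin> star X x" using x sep_iff[OF q] by auto
  have "y \<notin> star X x'"
  proof
    assume "y \<in> star X x'"
    then consider "y = x'" | "(x', y) \<in> adj X" by (auto simp: star_def)
    then have "\<exists>s\<in>Pts. y \<in> copy s \<and> x' \<in> copy s"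
      using edge_in_copy q by cases blast+
    then obtain s where s: "s \<in> Pts" "y \<in> copy s" "x' \<in> copy s" by blast
    have "side x s = side x p" using side_unique[OF xv(1) s(1) p s(3) x'(1) nx] .
    moreover have "side x s = side x q" using side_unique[OF xv(1) s(1) q(1) s(2) q(2) side_y(2)] .
    ultimately show False using side_y by simp
  qed
  moreover have "side x' q = side x' qx"
    using nested[OF xv nx q(1) qx(1) p qx(2) x'(1) side_y(1)] .
  moreover have "side x' qx \<noteq> side x' p" using x'(2) sep_iff[OF qx] by simp
  ultimately show ?thesis using sep_iff[OF q] xv by simp
qed

text \<open>Adjacent vertices outside the star of \<open>x\<close> are on the same side of \<open>x\<close>.\<close>

lemma path_meets_star:
  assumes "(y, z) \<in> adj X ^^ k" "sep p x y" "\<not> sep p x z"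
  shows "\<exists>i j c. c \<in> star X x \<and> (y, c) \<in> adj X ^^ i \<and> (c, z) \<in> adj X ^^ j \<and> i + j = k"
  using assms
proof (induction k arbitrary: y)
  case 0
  then show ?case by simp
next
  case (Suc k)
  obtain y' where y': "(y, y') \<in> adj X" "(y', z) \<in> adj X ^^ k"
    using Suc.prems(1) by (meson relpow_Suc_D2)
  show ?case
  proof (cases "y' \<in> star X x")
    case True
    have "(y, y') \<in> adj X ^^ 1" "1 + k = Suc k" using y' by auto
    then show ?thesis using True y'(2) by blast
  next
    case False
    then have "sep p x y'" using sep_adj[OF y'(1) _ False] Suc.prems(2) by (metis sep_def)
    from Suc.IH[OF y'(2) this Suc.prems(3)] obtain i j c
      where "c \<in> star X x" "(y', c) \<in> adj X ^^ i" "(c, z) \<in> adj X ^^ j" "i + j = k" by blast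
    moreover from this have "(y, c) \<in> adj X ^^ Suc i" using y'(1) by (meson relpow_Suc_I2)
    moreover have "Suc i + j = Suc k" using \<open>i + j = k\<close> by simp
    ultimately show ?thesis by blast
  qed
qed

lemma finite_sep: "p \<in> Pts \<Longrightarrow> y \<in> verts X \<Longrightarrow> finite {x. sep p x y}"
proof -
  assume p: "p \<in> Pts" and "y \<in> verts X"
  then obtain q where q: "q \<in> Pts" "y \<in> copy q" using vertex_in_copy by blast
  have "{x. sep p x y} \<subseteq> {x \<in> verts X. side x p \<noteq> side x q}" using sep_iff[OF q] by auto
  then show ?thesis using finite_separators p q finite_subset by blast
qed

end

locale based_sector_system = sector_system +
  fixes b0
  assumes base: "b0 \<in> Pts" and base_nonempty: "copy b0 \<noteq> {}"
    and conn: "connected_graph X"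
begin

definition height :: "'a \<Rightarrow> nat" where
  "height y = (LEAST k. \<exists>z\<in>copy b0. (y, z) \<in> adj X ^^ k)"

lemma height_witness:
  assumes "y \<in> verts X"
  shows "\<exists>z\<in>copy b0. (y, z) \<in> adj X ^^ height y"
proof -
  obtain z where "z \<in> copy b0" using base_nonempty by blast
  then have "z \<in> verts X" using copy_subset base by blast
  then obtain k where "(y, z) \<in> adj X ^^ k" using conn assms by (meson connected_graph_iff)
  then have "\<exists>k. \<exists>z\<in>copy b0. (y, z) \<in> adj X ^^ k" using \<open>z \<in> copy b0\<close> by blast
  then show ?thesis unfolding height_def by (rule LeastI_ex)
qed

lemma height_le: "z \<in> copy b0 \<Longrightarrow> (y, z) \<in> adj X ^^ k \<Longrightarrow> height y \<le> k"
  unfolding height_def by (rule Least_le) blast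

lemma height_lipschitz:
  assumes "y' \<in> verts X" "(y, y') \<in> adj X ^^ k"
  shows "height y \<le> k + height y'"
proof -
  obtain z where z: "z \<in> copy b0" "(y', z) \<in> adj X ^^ height y'" using height_witness[OF assms(1)] by blast
  show ?thesis using height_le[OF z(1) relpow_trans[OF assms(2) z(2)]] .
qed

lemma star_relpow: "y \<in> star X x \<Longrightarrow> \<exists>i\<le>1. (x, y) \<in> adj X ^^ i"
  unfolding star_def by (auto intro: exI[of _ 0] exI[of _ 1])

text \<open>A shortest path from \<open>y\<close> to the base copy passes through the star of \<open>x\<close>; both summands on the left
lose at most \<open>1\<close> at that passage.\<close>

lemma height_separator:
  assumes y: "y \<in> verts X" and x: "sep b0 x y"
  shows "height x + vertex_dist X x y \<le> height y + 2"
proof -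
  have xv: "x \<in> verts X" using x by (simp add: sep_def)
  obtain z where z: "z \<in> copy b0" "(y, z) \<in> adj X ^^ height y" using height_witness[OF y] by blast
  obtain i j c where c: "c \<in> star X x" "(y, c) \<in> adj X ^^ i" "(c, z) \<in> adj X ^^ j" "i + j = height y"
    using path_meets_star[OF z(2) x not_sep_copy[OF base z(1)]] by blast
  obtain e where e: "e \<le> 1" "(x, c) \<in> adj X ^^ e" using star_relpow[OF c(1)] by blast
  have "height x \<le> e + j" using height_le[OF z(1)] relpow_trans[OF e(2) c(3)] by blast
  moreover have "vertex_dist X x y \<le> e + i"
    using vertex_dist_le[OF xv] relpow_trans[OF e(2)] adj_relpow_sym[OF c(2)] by blast
  ultimately show ?thesis using e(1) c(4) by linarith
qed

text \<open>The point \<open>g\<close> marks the place where the way from the base point to \<open>y\<close> leaves the heights below \<open>a\<close>: every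
hyperplane between the base point and \<open>g\<close> has height at most \<open>a - 2\<close>, every one between \<open>g\<close> and \<open>y\<close> has
height at least \<open>a - 1\<close>.\<close>

definition gate :: "nat \<Rightarrow> 'b \<Rightarrow> 'a \<Rightarrow> bool" where
  "gate a g y \<longleftrightarrow> g \<in> Pts \<and> (\<forall>x\<in>verts X. side x g \<noteq> side x b0 \<longrightarrow> height x + 2 \<le> a) \<and>
     (\<forall>x. sep g x y \<longrightarrow> a \<le> height x + 1)"

text \<open>Start at the base point and cross a hyperplane of height at most \<open>a - 2\<close> between \<open>g\<close> and \<open>y\<close> as long as
there is one. Such a hyperplane can be chosen in the copy at \<open>g\<close>: otherwise a hyperplane of that copy
separates \<open>g\<close> from it, and is again low because heights grow in the direction away from the base
point. Each crossing decreases the number of hyperplanes between \<open>g\<close> and \<open>y\<close>.\<close>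

lemma gate_exists:
  assumes y: "y \<in> verts X"
  shows "\<exists>g. gate a g y"
proof -
  have "\<exists>g'. gate a g' y"
    if "g \<in> Pts" "\<forall>x\<in>verts X. side x g \<noteq> side x b0 \<longrightarrow> height x + 2 \<le> a" for g
    using that
  proof (induction "card {x. sep g x y}" arbitrary: g rule: less_induct)
    case (less g)
    show ?case
    proof (cases "\<forall>x. sep g x y \<longrightarrow> a \<le> height x + 1")
      case True
      then show ?thesis using less.prems by (auto simp: gate_def)
    next
      case False
      then obtain x0 where x0: "sep g x0 y" "height x0 + 2 \<le> a" by fastforce
      have "\<exists>x\<in>copy g. sep g x y \<and> height x + 2 \<le> a"
      proof (cases "x0 \<in> copy g")
        case True
        then show ?thesis using x0 by blast
      next
        case False
        have x0v: "x0 \<in> verts X" using x0 by (simp add: sep_def)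
        obtain x where x: "x \<in> copy g" "sep g x x0"
          using exit[OF less.prems(1) x0v False] copy_subset[OF less.prems(1)] unfolding sep_def by blast
        have xv: "x \<in> verts X" "x0 \<notin> star X x" using x by (auto simp: sep_def)
        have "height x + 2 \<le> a"
        proof (cases "side x g = side x b0")
          case True
          then have "sep b0 x x0" using x(2) by (simp add: sep_def)
          moreover have "vertex_dist X x x0 \<ge> 2"
          proof (rule ccontr)
            assume "\<not> vertex_dist X x x0 \<ge> 2"
            then have "vertex_dist X x x0 = 0 \<or> vertex_dist X x x0 = 1" by linarith
            then show False using vertex_dist_relpow[OF conn xv(1) x0v] xv(2) by (auto simp: star_def)
          qed
          ultimately show ?thesis using height_separator[OF x0v] x0(2) by fastforce
        next
          case False
          then show ?thesis using less.prems(2) xv by blast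
        qed
        then show ?thesis using sep_trans[OF less.prems(1) x x0(1) y] x(1) by blast
      qed
      then obtain x where x: "x \<in> copy g" "sep g x y" "height x + 2 \<le> a" by blast
      obtain q where q: "q \<in> Pts" "y \<in> copy q" using vertex_in_copy y by blast
      obtain g' where g': "g' \<in> Pts" "side x g' = side x q" "\<forall>x'\<in>verts X. x' \<noteq> x \<longrightarrow> side x' g' = side x' g"
        using cross[OF less.prems(1) q(1) x(1)] by blast
      have "{x. sep g' x y} \<subset> {x. sep g x y}"
      proof
        show "{x. sep g' x y} \<subseteq> {x. sep g x y}"
          using sep_iff[OF q] g' by (metis (mono_tags, lifting) Collect_mono)
        have "\<not> sep g' x y" using sep_iff[OF q] g'(2) by simp
        then show "{x. sep g' x y} \<noteq> {x. sep g x y}" using x(2) by auto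
      qed
      then have "card {x. sep g' x y} < card {x. sep g x y}"
        using finite_sep[OF less.prems(1) y] by (rule psubset_card_mono[rotated])
      moreover have "\<forall>x'\<in>verts X. side x' g' \<noteq> side x' b0 \<longrightarrow> height x' + 2 \<le> a"
        using g' x(3) less.prems(2) by metis
      ultimately show ?thesis using less.hyps g' by blast
    qed
  qed
  from this[of b0] show ?thesis using base by blast
qed

text \<open>A hyperplane that separates \<open>g\<close> from the second end of an edge but not from the first has the first end in
its star, hence a height at least that of this end minus \<open>1\<close>. The first ends of all edges of
the path have height at least \<open>a\<close>.\<close>

lemma gate_path:
  assumes "(y, y') \<in> adj X ^^ k" "gate a g y" "a + k \<le> height y + 1" "y \<in> verts X"
  shows "gate a g y'"
  using assms
proof (induction k arbitrary: y)
  case 0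
  then show ?case by simp
next
  case (Suc k)
  obtain b where b: "(y, b) \<in> adj X" "(b, y') \<in> adj X ^^ k"
    using Suc.prems(1) by (meson relpow_Suc_D2)
  have bv: "b \<in> verts X" using b by (auto simp: adj_def)
  have "(y, b) \<in> adj X ^^ 1" using b by simp
  then have hb: "height y \<le> 1 + height b" using height_lipschitz[OF bv] by blast
  have "a \<le> height x + 1" if x: "sep g x b" for x
  proof (cases "y \<in> star X x")
    case True
    obtain e where "e \<le> 1" "(y, x) \<in> adj X ^^ e"
      using star_relpow True star_sym by metis
    then have "height y \<le> 1 + height x" using height_lipschitz[of x y e] x by (auto simp: sep_def)
    then show ?thesis using Suc.prems(3) by linarith
  next
    case False
    then have "sep g x y" using x sep_adj[OF b(1)] by (auto simp: sep_def)
    then show ?thesis using Suc.prems(2) by (auto simp: gate_def)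
  qed
  then have "gate a g b" using Suc.prems(2) by (auto simp: gate_def)
  then show ?case using Suc.IH[OF b(2)] Suc.prems(3) hb bv by simp
qed

text \<open>The hyperplane of the copy at \<open>g\<close> that separates \<open>g\<close> from \<open>y\<close> is too high to separate \<open>g\<close> from the base point.
So it separates \<open>y\<close> from the base point, and its height bounds its distance to \<open>y\<close>.\<close>

lemma gate_near:
  assumes "gate a g y" "y \<in> verts X" "a \<le> height y + 3"
  shows "\<exists>x\<in>copy g. vertex_dist X x y + a \<le> height y + 3"
proof (cases "y \<in> copy g")
  case True
  then show ?thesis using assms by force
next
  case False
  have g: "g \<in> Pts" using assms by (simp add: gate_def)
  obtain x where x: "x \<in> copy g" "sep g x y"
    using exit[OF g assms(2) False] copy_subset[OF g] unfolding sep_def by blast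
  have h: "a \<le> height x + 1" using assms x by (simp add: gate_def)
  have xv: "x \<in> verts X" using x by (simp add: sep_def)
  have "side x g = side x b0"
    using assms(1) h xv unfolding gate_def by fastforce
  then have "sep b0 x y" using x(2) by (simp add: sep_def)
  then have "height x + vertex_dist X x y \<le> height y + 2" using height_separator assms(2) by blast
  then show ?thesis using h x(1) by force
qed

text \<open>The gate at level \<open>a - r\<close> is common to the whole chain: a step of length at most \<open>r\<close> in the slab is
joined by a path that stays above that level.\<close>

lemma slab_near_copy:
  assumes x: "x \<in> verts X" "a \<le> height x" "height x \<le> a + R"
    and chain: "(x, y) \<in> chain_rel (vertex_dist X) r {z \<in> verts X. a \<le> height z \<and> height z \<le> a + R}"
  shows "y \<in> verts X" "\<exists>g\<in>Pts. \<exists>u\<in>copy g. \<exists>w\<in>copy g.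
    vertex_dist X u x \<le> R + r + 3 \<and> vertex_dist X w y \<le> R + r + 3"
proof -
  let ?Z = "{z \<in> verts X. a \<le> height z \<and> height z \<le> a + R}"
  obtain g where g: "gate (a - r) g x" using gate_exists[OF x(1)] by blast
  have y: "y \<in> ?Z \<and> (gate (a - r) g y)"
  proof (rule chain_rel_invariant[where I = "gate (a - r) g", OF chain _ g])
    fix b c assume bc: "b \<in> ?Z" "c \<in> ?Z" "vertex_dist X b c \<le> r" "gate (a - r) g b"
    show "gate (a - r) g c"
    proof (cases "a \<ge> r")
      case True
      have "(b, c) \<in> adj X ^^ vertex_dist X b c" using vertex_dist_relpow[OF conn] bc by blast
      then show ?thesis by (rule gate_path) (use bc True in auto)
    next
      case False
      then show ?thesis using bc by (auto simp: gate_def)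
    qed
  qed (use x in auto)
  then show "y \<in> verts X" by simp
  have gP: "g \<in> Pts" using g by (simp add: gate_def)
  obtain u where u: "u \<in> copy g" "vertex_dist X u x + (a - r) \<le> height x + 3"
    using gate_near[OF g x(1)] x by force
  obtain w where w: "w \<in> copy g" "vertex_dist X w y + (a - r) \<le> height y + 3"
    using gate_near[of "a - r" g y] y by force
  have "vertex_dist X u x \<le> R + r + 3" "vertex_dist X w y \<le> R + r + 3" using u w x y by auto
  then show "\<exists>g\<in>Pts. \<exists>u\<in>copy g. \<exists>w\<in>copy g.
    vertex_dist X u x \<le> R + r + 3 \<and> vertex_dist X w y \<le> R + r + 3" using gP u w by blast
qed

text \<open>A chain in a slab has both ends near one copy, on which \<open>\<rho>\<close> preserves distances.\<close>

lemma coarse_dim_le_Suc_of_retraction: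
  fixes \<rho> :: "'a \<Rightarrow> 'v" and Y :: "'v graph"
  assumes base_dim: "coarse_dim_le (verts Y) (vertex_dist Y) n" and Y: "connected_graph Y"
    and \<rho>: "\<And>x. x \<in> verts X \<Longrightarrow> \<rho> x \<in> verts Y" "\<And>x y. (x, y) \<in> adj X \<Longrightarrow> (\<rho> x, \<rho> y) \<in> adj Y"
    and copies: "\<And>p u w. p \<in> Pts \<Longrightarrow> u \<in> copy p \<Longrightarrow> w \<in> copy p \<Longrightarrow>
      vertex_dist X u w \<le> vertex_dist Y (\<rho> u) (\<rho> w)"
  shows "coarse_dim_le (verts X) (vertex_dist X) (Suc n)"
proof (rule coarse_dim_le_Suc[where h = height and \<rho> = \<rho>, OF base_dim \<rho>(1)])
  have lift: "(\<rho> x, \<rho> y) \<in> adj Y ^^ k" if "(x, y) \<in> adj X ^^ k" for x y k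
    using that
  proof (induction k arbitrary: y)
    case (Suc k)
    then show ?case by (meson \<rho>(2) relpow_Suc_E relpow_Suc_I)
  qed simp
  show lip: "vertex_dist Y (\<rho> x) (\<rho> y) \<le> vertex_dist X x y" if "x \<in> verts X" "y \<in> verts X" for x y
    using lift[OF vertex_dist_relpow[OF conn that]] vertex_dist_le \<rho>(1) that by metis
  show "height x \<le> height y + vertex_dist X x y" if "x \<in> verts X" "y \<in> verts X" for x y
    using height_lipschitz[OF that(2) vertex_dist_relpow[OF conn that]] by simp
  show "vertex_dist X x y = vertex_dist X y x" if "x \<in> verts X" "y \<in> verts X" for x y
    using vertex_dist_sym[OF conn that] .
  show "\<exists>B. \<forall>a. \<forall>x\<in>verts X. \<forall>y. a \<le> height x \<longrightarrow> height x \<le> a + R \<longrightarrow>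
      (x, y) \<in> chain_rel (vertex_dist X) r {z \<in> verts X. a \<le> height z \<and> height z \<le> a + R} \<longrightarrow>
      vertex_dist X x y \<le> vertex_dist Y (\<rho> x) (\<rho> y) + B" for r R
  proof (intro exI allI ballI impI)
    fix a x y
    assume x: "x \<in> verts X" "a \<le> height x" "height x \<le> a + R"
      and chain: "(x, y) \<in> chain_rel (vertex_dist X) r {z \<in> verts X. a \<le> height z \<and> height z \<le> a + R}"
    obtain g u w where g: "g \<in> Pts" "u \<in> copy g" "w \<in> copy g"
      and uw: "vertex_dist X u x \<le> R + r + 3" "vertex_dist X w y \<le> R + r + 3"
      using slab_near_copy(2)[OF x chain] by blast
    have v: "u \<in> verts X" "w \<in> verts X" "y \<in> verts X"
      using g copy_subset slab_near_copy(1)[OF x chain] by auto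
    have "vertex_dist Y (\<rho> u) (\<rho> w) \<le> vertex_dist Y (\<rho> u) (\<rho> x) + vertex_dist Y (\<rho> x) (\<rho> y) + vertex_dist Y (\<rho> y) (\<rho> w)"
      using vertex_dist_triangle[OF Y, of "\<rho> u" "\<rho> x" "\<rho> w"] vertex_dist_triangle[OF Y, of "\<rho> x" "\<rho> y" "\<rho> w"] \<rho>(1) v x(1)
      by force
    also have "\<dots> \<le> (R + r + 3) + vertex_dist Y (\<rho> x) (\<rho> y) + (R + r + 3)"
      using lip[OF v(1) x(1)] lip[OF v(3,2)] uw vertex_dist_sym[OF conn v(2,3)] by linarith
    finally have "vertex_dist X u w \<le> (R + r + 3) + vertex_dist Y (\<rho> x) (\<rho> y) + (R + r + 3)"
      using copies[OF g] by linarith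
    moreover have "vertex_dist X x y \<le> vertex_dist X x u + vertex_dist X u w + vertex_dist X w y"
      using vertex_dist_triangle[OF conn x(1) v(1) v(3)] vertex_dist_triangle[OF conn v(1) v(2) v(3)] by linarith
    moreover have "vertex_dist X x u = vertex_dist X u x" using vertex_dist_sym[OF conn] v x by metis
    ultimately show "vertex_dist X x y \<le> vertex_dist Y (\<rho> x) (\<rho> y) + 4 * (R + r + 3)"
      using uw by simp
  qed
qed

end

section \<open>Leading syllables and hyperplanes\<close>

lemma conj_subgroup_mult:
  assumes "group P" "p \<in> carrier P" "q \<in> carrier P" "H \<subseteq> carrier P"
  shows "conj_subgroup P (p \<otimes>\<^bsub>P\<^esub> q) H = conj_subgroup P p (conj_subgroup P q H)"
proof -
  interpret group P by fact
  show ?thesis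
    unfolding conj_subgroup_def image_image using assms(2-4)
    by (intro image_cong) (auto simp: m_assoc inv_mult_group subset_iff)
qed

text \<open>In a graph product, the stabilizer of the hyperplane \<open>H v\<close>; its cosets are in bijection with the hyperplanes of type \<open>v\<close>.\<close>

definition star_subgroup ::
    "('p, 'c) monoid_scheme \<Rightarrow> 'v set \<Rightarrow> ('v \<Rightarrow> 'v \<Rightarrow> bool) \<Rightarrow> ('v \<Rightarrow> 'p set) \<Rightarrow> 'v \<Rightarrow> 'p set" where
  "star_subgroup P V nb H v = generate P (\<Union>u\<in>{u \<in> V. u = v \<or> nb v u}. H u)"

text \<open>A group with a family of subgroups that commute along the edges of a graph, together with functions
\<open>\<sigma> v\<close> that behave like the leading \<open>H v\<close>-syllable of a reduced word: right multiplication by a letter changes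
\<open>\<sigma> v\<close> exactly when the corresponding edge of the Cayley graph crosses the hyperplane \<open>H v\<close>. The functions
\<open>\<sigma>\<close> are the only source of non-triviality. They take the place of a normal form.\<close>

locale leading_syllables = group P for P (structure) +
  fixes V :: "'v set" and nb :: "'v \<Rightarrow> 'v \<Rightarrow> bool" and H :: "'v \<Rightarrow> 'a set" and \<sigma> :: "'v \<Rightarrow> 'a \<Rightarrow> 'a"
  assumes nb_sym: "nb u v \<Longrightarrow> nb v u"
    and nb_irrefl: "\<not> nb v v"
    and H_subgroup: "v \<in> V \<Longrightarrow> subgroup (H v) P"
    and H_nontrivial: "v \<in> V \<Longrightarrow> \<exists>s\<in>H v. s \<noteq> \<one>"
    and H_generate: "generate P (\<Union>v\<in>V. H v) = carrier P"
    and H_commute: "u \<in> V \<Longrightarrow> v \<in> V \<Longrightarrow> nb u v \<Longrightarrow> a \<in> H u \<Longrightarrow> b \<in> H v \<Longrightarrow> a \<otimes> b = b \<otimes> a"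
    and \<sigma>_in: "v \<in> V \<Longrightarrow> p \<in> carrier P \<Longrightarrow> \<sigma> v p \<in> H v"
    and \<sigma>_one: "v \<in> V \<Longrightarrow> \<sigma> v \<one> = \<one>"
    and \<sigma>_cross: "v \<in> V \<Longrightarrow> p \<in> star_subgroup P V nb H v \<Longrightarrow> s \<in> H v \<Longrightarrow> \<sigma> v (p \<otimes> s) = \<sigma> v p \<otimes> s"
    and \<sigma>_stay: "v \<in> V \<Longrightarrow> u \<in> V \<Longrightarrow> p \<in> carrier P \<Longrightarrow> s \<in> H u \<Longrightarrow>
      u \<noteq> v \<or> p \<notin> star_subgroup P V nb H v \<Longrightarrow> \<sigma> v (p \<otimes> s) = \<sigma> v p"
begin

abbreviation S where "S v \<equiv> star_subgroup P V nb H v"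

lemma H_carrier: "v \<in> V \<Longrightarrow> s \<in> H v \<Longrightarrow> s \<in> carrier P"
  using H_subgroup subgroup.mem_carrier by metis

lemma H_subset: "v \<in> V \<Longrightarrow> H v \<subseteq> carrier P"
  using H_carrier by blast

lemma H_inv: "v \<in> V \<Longrightarrow> s \<in> H v \<Longrightarrow> inv s \<in> H v"
  using H_subgroup subgroup.m_inv_closed by metis

lemma H_mult: "v \<in> V \<Longrightarrow> s \<in> H v \<Longrightarrow> t \<in> H v \<Longrightarrow> s \<otimes> t \<in> H v"
  using H_subgroup subgroup.m_closed by metis

lemma S_subgroup: "subgroup (S v) P"
  unfolding star_subgroup_def by (rule generate_is_subgroup) (use H_subset in blast)

lemma S_carrier: "m \<in> S v \<Longrightarrow> m \<in> carrier P"
  using S_subgroup subgroup.mem_carrier by metis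

lemma S_one: "\<one> \<in> S v"
  using S_subgroup subgroup.one_closed by metis

lemma S_inv: "m \<in> S v \<Longrightarrow> inv m \<in> S v"
  using S_subgroup subgroup.m_inv_closed by metis

lemma S_mult: "m \<in> S v \<Longrightarrow> m' \<in> S v \<Longrightarrow> m \<otimes> m' \<in> S v"
  using S_subgroup subgroup.m_closed by metis

lemma H_in_S: "u \<in> V \<Longrightarrow> u = v \<or> nb v u \<Longrightarrow> s \<in> H u \<Longrightarrow> s \<in> S v"
  unfolding star_subgroup_def by (rule generate.incl) blast

lemma S_right_iff: "m \<in> S v \<Longrightarrow> q \<in> carrier P \<Longrightarrow> m \<otimes> q \<in> S v \<longleftrightarrow> q \<in> S v"
  using S_mult S_inv S_carrier by (metis inv_closed inv_solve_left m_closed)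

lemma mult_inv_cancel: "p \<in> carrier P \<Longrightarrow> q \<in> carrier P \<Longrightarrow> p \<otimes> (inv p \<otimes> q) = q"
  by (simp add: m_assoc[symmetric])

lemma inv_mult_cancel: "p \<in> carrier P \<Longrightarrow> q \<in> carrier P \<Longrightarrow> inv p \<otimes> (p \<otimes> q) = q"
  by (simp add: m_assoc[symmetric])

lemma S_coset_trans:
  assumes "p \<in> carrier P" "q \<in> carrier P" "r \<in> carrier P" "inv p \<otimes> q \<in> S v" "inv q \<otimes> r \<in> S v"
  shows "inv p \<otimes> r \<in> S v"
proof -
  have "(inv p \<otimes> q) \<otimes> (inv q \<otimes> r) = inv p \<otimes> r"
    using assms by (simp add: m_assoc mult_inv_cancel)
  then show ?thesis using S_mult[OF assms(4,5)] by simp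
qed

lemma S_coset_sym:
  assumes "p \<in> carrier P" "q \<in> carrier P" "inv p \<otimes> q \<in> S v"
  shows "inv q \<otimes> p \<in> S v"
  using S_inv[OF assms(3)] assms by (simp add: inv_mult_group)

definition step :: "('a \<times> 'a) set" where
  "step = {(p, p \<otimes> s) | p s u. p \<in> carrier P \<and> u \<in> V \<and> s \<in> H u}"

lemma stepI: "p \<in> carrier P \<Longrightarrow> u \<in> V \<Longrightarrow> s \<in> H u \<Longrightarrow> (p, p \<otimes> s) \<in> step"
  by (auto simp: step_def)

lemma stepE:
  assumes "(p, q) \<in> step"
  obtains s u where "p \<in> carrier P" "u \<in> V" "s \<in> H u" "q = p \<otimes> s" "q \<in> carrier P"
  using assms H_carrier by (auto simp: step_def)

lemma connected_steps:
  assumes "p \<in> carrier P" "q \<in> carrier P"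
  shows "(p, q) \<in> step\<^sup>*"
proof -
  have "\<forall>p\<in>carrier P. (p, p \<otimes> x) \<in> step\<^sup>*" if "x \<in> generate P (\<Union>v\<in>V. H v)" for x
    using that
  proof (induction rule: generate.induct)
    case one
    then show ?case by simp
  next
    case (incl h)
    then show ?case using stepI by blast
  next
    case (inv h)
    then show ?case using stepI H_inv by blast
  next
    case (eng h1 h2)
    then have c: "h1 \<in> carrier P" "h2 \<in> carrier P" using H_generate by auto
    show ?case
    proof
      fix p assume p: "p \<in> carrier P"
      have "(p, p \<otimes> h1) \<in> step\<^sup>*" "(p \<otimes> h1, (p \<otimes> h1) \<otimes> h2) \<in> step\<^sup>*"
        using eng.IH p c by auto
      then show "(p, p \<otimes> (h1 \<otimes> h2)) \<in> step\<^sup>*"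
        using p c by (simp add: m_assoc)
    qed
  qed
  then have "(p, p \<otimes> (inv p \<otimes> q)) \<in> step\<^sup>*" using assms H_generate by simp
  then show ?thesis using assms by (simp add: mult_inv_cancel)
qed

lemma step_translate:
  assumes "a \<in> carrier P" "(p, q) \<in> step"
  shows "(a \<otimes> p, a \<otimes> q) \<in> step"
proof -
  obtain s u where "p \<in> carrier P" "u \<in> V" "s \<in> H u" "q = p \<otimes> s" using assms(2) by (rule stepE)
  then show ?thesis
    using stepI[of "a \<otimes> p" u s] assms(1) H_carrier[of u s] by (simp add: m_assoc)
qed

lemma step_relpow_translate:
  assumes "a \<in> carrier P" "(p, q) \<in> step ^^ k"
  shows "(a \<otimes> p, a \<otimes> q) \<in> step ^^ k"
  using assms(2)
proof (induction k arbitrary: q)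
  case (Suc k)
  then obtain z where "(p, z) \<in> step ^^ k" "(z, q) \<in> step" by auto
  then show ?case using Suc.IH step_translate[OF assms(1)] by auto
qed simp

text \<open>Reading a word with state \<open>a\<close> from the start instead of \<open>\<one>\<close> multiplies all later states by \<open>a\<close>, since left
multiplication by \<open>a\<close> preserves membership in \<open>S v\<close>.\<close>

lemma \<sigma>_translate:
  assumes v: "v \<in> V" and a: "a \<in> H v" and q: "q \<in> carrier P"
  shows "\<sigma> v (a \<otimes> q) = a \<otimes> \<sigma> v q"
proof -
  have ac: "a \<in> carrier P" "a \<in> S v" using H_carrier[OF v a] H_in_S[OF v _ a] by auto
  have "(\<one>, q) \<in> step\<^sup>*" using connected_steps q by simp
  then show ?thesis
  proof (induction rule: rtrancl_induct)
    case base
    show ?case using \<sigma>_cross[OF v S_one a] \<sigma>_one[OF v] ac by simp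
  next
    case (step q z)
    obtain s u where z: "q \<in> carrier P" "u \<in> V" "s \<in> H u" "z = q \<otimes> s" using step.hyps(2) by (rule stepE)
    have sc: "s \<in> carrier P" using H_carrier z by auto
    have az: "a \<otimes> z = (a \<otimes> q) \<otimes> s" using z ac sc by (simp add: m_assoc)
    show ?case
    proof (cases "u = v \<and> q \<in> S v")
      case True
      then have "\<sigma> v ((a \<otimes> q) \<otimes> s) = \<sigma> v (a \<otimes> q) \<otimes> s" "\<sigma> v z = \<sigma> v q \<otimes> s"
        using \<sigma>_cross[OF v] z S_mult[OF ac(2)] by auto
      then show ?thesis
        using az step.IH ac sc H_carrier[OF v \<sigma>_in[OF v z(1)]] by (simp add: m_assoc)
    next
      case False
      then have "\<sigma> v ((a \<otimes> q) \<otimes> s) = \<sigma> v (a \<otimes> q)" "\<sigma> v z = \<sigma> v q"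
        using \<sigma>_stay[OF v z(2) _ z(3)] S_right_iff[OF ac(2) z(1)] z ac by auto
      then show ?thesis using az step.IH by simp
    qed
  qed
qed

text \<open>The hyperplane of type \<open>v\<close> at \<open>p\<close> is the translate by \<open>p\<close> of the one at the identity.\<close>

definition side :: "'v \<Rightarrow> 'a \<Rightarrow> 'a \<Rightarrow> 'a" where
  "side v p q = \<sigma> v (inv p \<otimes> q)"

lemma side_in: "v \<in> V \<Longrightarrow> p \<in> carrier P \<Longrightarrow> q \<in> carrier P \<Longrightarrow> side v p q \<in> H v"
  unfolding side_def by (simp add: \<sigma>_in)

lemma side_cross:
  assumes "v \<in> V" "p \<in> carrier P" "q \<in> carrier P" "inv p \<otimes> q \<in> S v" "s \<in> H v"
  shows "side v p (q \<otimes> s) = side v p q \<otimes> s"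
  using \<sigma>_cross[OF assms(1,4,5)] assms H_carrier[OF assms(1,5)] unfolding side_def by (simp add: m_assoc)

lemma side_stay:
  assumes "v \<in> V" "u \<in> V" "p \<in> carrier P" "q \<in> carrier P" "s \<in> H u" "u \<noteq> v \<or> inv p \<otimes> q \<notin> S v"
  shows "side v p (q \<otimes> s) = side v p q"
  using \<sigma>_stay[OF assms(1,2) _ assms(5,6)] assms(3,4) H_carrier[OF assms(2,5)]
  unfolding side_def by (simp add: m_assoc)

lemma side_translate:
  assumes "v \<in> V" "p \<in> carrier P" "q \<in> carrier P" "a \<in> H v"
  shows "side v p (p \<otimes> a \<otimes> inv p \<otimes> q) = a \<otimes> side v p q"
proof -
  have "inv p \<otimes> (p \<otimes> a \<otimes> inv p \<otimes> q) = a \<otimes> (inv p \<otimes> q)"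
    using assms H_carrier[OF assms(1,4)] by (simp add: m_assoc inv_mult_cancel)
  then show ?thesis unfolding side_def using \<sigma>_translate[OF assms(1,4)] assms by simp
qed

text \<open>The hyperplanes of type \<open>v\<close> at \<open>p\<close> and of type \<open>w\<close> at \<open>q\<close> are equal or cross. The definition uses cosets
because it has to precede the proof that cosets and conjugate subgroups correspond.\<close>

definition incident :: "'v \<Rightarrow> 'a \<Rightarrow> 'v \<Rightarrow> 'a \<Rightarrow> bool" where
  "incident v p w q \<longleftrightarrow> (v = w \<or> nb v w) \<and> (\<exists>r\<in>carrier P. inv p \<otimes> r \<in> S v \<and> inv q \<otimes> r \<in> S w)"

lemma incident_sym: "incident v p w q \<Longrightarrow> incident w q v p"
  unfolding incident_def using nb_sym by blast

lemma incident_coset: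
  assumes "q \<in> carrier P" "q' \<in> carrier P" "inv q \<otimes> q' \<in> S w" "incident v p w q'"
  shows "incident v p w q"
  using assms S_coset_trans unfolding incident_def by metis

text \<open>A step inside the coset of the second hyperplane crosses only hyperplanes that are incident with it.\<close>

lemma side_coset:
  assumes v: "v \<in> V" and p: "p \<in> carrier P" and m: "m \<in> S w"
  shows "q \<in> carrier P \<Longrightarrow> \<not> incident v p w q \<Longrightarrow> side v p (q \<otimes> m) = side v p q"
  using m unfolding star_subgroup_def
proof (induction m arbitrary: q rule: generate.induct)
  case one
  then show ?case by simp
next
  case (incl h)
  then obtain u where u: "u \<in> V" "u = w \<or> nb w u" "h \<in> H u" by blast
  show ?case
  proof (rule side_stay[OF v u(1) p incl.prems(1) u(3)], rule ccontr)
    assume "\<not> (u \<noteq> v \<or> inv p \<otimes> q \<notin> S v)"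
    then have "incident v p w q"
      unfolding incident_def using u(2) nb_sym incl.prems(1) S_one by (intro conjI bexI[of _ q]) auto
    then show False using incl by simp
  qed
next
  case (inv h)
  then obtain u where u: "u \<in> V" "u = w \<or> nb w u" "inv h \<in> H u" using H_inv by blast
  show ?case
  proof (rule side_stay[OF v u(1) p inv.prems(1) u(3)], rule ccontr)
    assume "\<not> (u \<noteq> v \<or> inv p \<otimes> q \<notin> S v)"
    then have "incident v p w q"
      unfolding incident_def using u(2) nb_sym inv.prems(1) S_one by (intro conjI bexI[of _ q]) auto
    then show False using inv by simp
  qed
next
  case (eng h1 h2)
  then have S: "h1 \<in> S w" "h2 \<in> S w" unfolding star_subgroup_def by auto
  then have c: "h1 \<in> carrier P" "h2 \<in> carrier P" using S_carrier by auto
  have "inv q \<otimes> (q \<otimes> h1) \<in> S w" using S c eng.prems by (simp add: inv_mult_cancel)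
  then have "\<not> incident v p w (q \<otimes> h1)"
    using incident_coset[of q "q \<otimes> h1"] eng.prems c by auto
  then have "side v p ((q \<otimes> h1) \<otimes> h2) = side v p q"
    using eng.IH eng.prems c by simp
  then show ?case using c eng.prems by (simp add: m_assoc)
qed

lemma side_same_coset:
  assumes "v \<in> V" "p \<in> carrier P" "q \<in> carrier P" "q' \<in> carrier P" "inv q \<otimes> q' \<in> S w"
    "\<not> incident v p w q"
  shows "side v p q' = side v p q"
  using side_coset[OF assms(1,2,5,3,6)] assms by (simp add: mult_inv_cancel)

text \<open>Follow a path from \<open>r\<close> to \<open>p\<close>. Unless it reaches the first hyperplane, where the conclusion holds, it can
cross the second one only at a point on the same side as \<open>p'\<close> of the first, which the assumption excludes.\<close>

lemma side_nested:
  assumes v: "v \<in> V" "v' \<in> V" and p: "p \<in> carrier P" "p' \<in> carrier P" and r: "r \<in> carrier P"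
    and ni: "\<not> incident v p v' p'" and ne: "side v p r \<noteq> side v p p'"
  shows "side v' p' r = side v' p' p"
proof -
  have ni': "\<not> incident v' p' v p" using ni incident_sym by blast
  have "(r, p) \<in> step\<^sup>*" using connected_steps r p by simp
  then have "side v p r \<noteq> side v p p' \<longrightarrow> side v' p' r = side v' p' p"
  proof (induction rule: converse_rtrancl_induct)
    case base
    show ?case by simp
  next
    case (step r z)
    obtain s u where z: "r \<in> carrier P" "u \<in> V" "s \<in> H u" "z = r \<otimes> s" using step.hyps(1) by (rule stepE)
    consider "inv p \<otimes> r \<in> S v" | "inv p' \<otimes> r \<in> S v'" | "inv p \<otimes> r \<notin> S v" "inv p' \<otimes> r \<notin> S v'" by blast
    then show ?case
    proof cases
      case 1
      then show ?thesis using side_same_coset[OF v(2) p(2,1) z(1) _ ni'] by simp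
    next
      case 2
      then show ?thesis using side_same_coset[OF v(1) p z(1) _ ni] by simp
    next
      case 3
      then have "side v p z = side v p r" "side v' p' z = side v' p' r"
        using side_stay v p z by auto
      then show ?thesis using step.IH by simp
    qed
  qed
  then show ?thesis using ne by simp
qed

definition hyp :: "'a \<Rightarrow> 'v \<Rightarrow> 'a set" where
  "hyp p v = conj_subgroup P p (H v)"

lemma hyp_mem: "x \<in> hyp p v \<longleftrightarrow> (\<exists>a\<in>H v. x = p \<otimes> a \<otimes> inv p)"
  by (auto simp: hyp_def conj_subgroup_def)

lemma S_normalizes:
  assumes v: "v \<in> V" and m: "m \<in> S v"
  shows "a \<in> H v \<Longrightarrow> m \<otimes> a \<otimes> inv m \<in> H v"
  using m unfolding star_subgroup_def
proof (induction m arbitrary: a rule: generate.induct)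
  case one
  then show ?case using H_carrier[OF v] by simp
next
  case (incl h)
  then obtain u where u: "u \<in> V" "u = v \<or> nb v u" "h \<in> H u" by blast
  have c: "h \<in> carrier P" "a \<in> carrier P" using H_carrier u v incl by auto
  show ?case
  proof (cases "u = v")
    case True
    then show ?thesis using u incl H_mult H_inv v by auto
  next
    case False
    then have "h \<otimes> a = a \<otimes> h" using H_commute[OF v u(1) _ incl.prems u(3)] u(2) by simp
    then show ?thesis using c incl by (simp add: m_assoc)
  qed
next
  case (inv h)
  then obtain u where u: "u \<in> V" "u = v \<or> nb v u" "inv h \<in> H u" "h \<in> H u" using H_inv by blast
  have c: "h \<in> carrier P" "a \<in> carrier P" using H_carrier u v inv by auto
  show ?case
  proof (cases "u = v")
    case True
    then show ?thesis using u inv H_mult v c by auto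
  next
    case False
    then have "inv h \<otimes> a = a \<otimes> inv h" using H_commute[OF v u(1) _ inv.prems u(3)] u(2) by simp
    then show ?thesis using c inv by (simp add: m_assoc)
  qed
next
  case (eng h1 h2)
  then have "h1 \<in> S v" "h2 \<in> S v" unfolding star_subgroup_def by auto
  then have c: "h1 \<in> carrier P" "h2 \<in> carrier P" "a \<in> carrier P" using S_carrier H_carrier[OF v] eng by auto
  have "h1 \<otimes> (h2 \<otimes> a \<otimes> inv h2) \<otimes> inv h1 \<in> H v" using eng by auto
  then show ?case using c by (simp add: m_assoc inv_mult_group)
qed

lemma hyp_coset:
  assumes v: "v \<in> V" and p: "p \<in> carrier P" "q \<in> carrier P" and m: "inv p \<otimes> q \<in> S v"
  shows "hyp q v = hyp p v"
proof -
  have *: "conj_subgroup P m (H v) \<subseteq> H v" if "m \<in> S v" for m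
    using S_normalizes[OF v that] by (auto simp: conj_subgroup_def)
  have **: "hyp (p \<otimes> m) v \<subseteq> hyp p v" if "p \<in> carrier P" "m \<in> S v" for p m
    using *[OF that(2)] conj_subgroup_mult[OF is_group that(1) S_carrier[OF that(2)] H_subset[OF v]]
    unfolding hyp_def by (auto simp: conj_subgroup_def)
  have "hyp (p \<otimes> (inv p \<otimes> q)) v \<subseteq> hyp p v" "hyp (q \<otimes> (inv q \<otimes> p)) v \<subseteq> hyp q v"
    using ** p m S_coset_sym by auto
  then show ?thesis using p by (simp add: mult_inv_cancel)
qed

text \<open>The conjugate of \<open>H v\<close> by \<open>p\<close> permutes the sides of its hyperplane freely.\<close>

lemma side_shift_ne:
  assumes v: "v \<in> V" and p: "p \<in> carrier P" "q \<in> carrier P" and a: "a \<in> H v" "a \<noteq> \<one>"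
  shows "side v p (p \<otimes> a \<otimes> inv p \<otimes> q) \<noteq> side v p q"
proof -
  have "side v p q \<in> carrier P" "a \<in> carrier P" using side_in H_carrier v p a by auto
  then show ?thesis using side_translate[OF v p a(1)] a(2) by simp
qed

text \<open>Suppose the hyperplanes neither coincide nor cross. A non-trivial element \<open>A\<close> of the first subgroup moves \<open>p\<close>
within its coset, so \<open>p\<close> and \<open>A p\<close> are on the same side of the second hyperplane, whereas a non-trivial element of the second
subgroup moves every point to another side of the second hyperplane. So the subgroups differ. If \<open>A\<close> commutes with \<open>B\<close> in the second
subgroup, then \<open>B p\<close> and \<open>B A p = A B p\<close> are both moved across the second hyperplane, and by nesting both lie on the
same side of the first one, although \<open>A\<close> changes every side of the first one.\<close>

lemma incident_if_equal_or_commute: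
  assumes v: "v \<in> V" "w \<in> V" and p: "p \<in> carrier P" "q \<in> carrier P"
    and eq: "hyp p v = hyp q w \<or> (\<forall>a\<in>hyp p v. \<forall>b\<in>hyp q w. a \<otimes> b = b \<otimes> a)"
  shows "incident v p w q"
proof (rule ccontr)
  assume ni: "\<not> incident v p w q"
  then have ni': "\<not> incident w q v p" using incident_sym by blast
  obtain a where a: "a \<in> H v" "a \<noteq> \<one>" using H_nontrivial v by blast
  obtain b where b: "b \<in> H w" "b \<noteq> \<one>" using H_nontrivial v by blast
  have ac: "a \<in> carrier P" "b \<in> carrier P" using a b H_carrier v by auto
  define A where "A = p \<otimes> a \<otimes> inv p"
  define B where "B = q \<otimes> b \<otimes> inv q"
  have c: "A \<in> carrier P" "B \<in> carrier P" using ac p by (auto simp: A_def B_def)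
  have "A \<otimes> p = p \<otimes> a" using ac p by (simp add: A_def m_assoc)
  then have Ap: "side w q (A \<otimes> p) = side w q p"
    using side_coset[OF v(2) p(2) _ p(1) ni', of a] H_in_S[OF v(1) _ a(1)] by simp
  from eq show False
  proof
    assume "hyp p v = hyp q w"
    moreover have "A \<in> hyp p v" unfolding hyp_mem A_def using a by blast
    ultimately have "A \<in> hyp q w" by simp
    then obtain b' where b': "b' \<in> H w" "A = q \<otimes> b' \<otimes> inv q" by (auto simp: hyp_mem)
    have "b' \<noteq> \<one>"
    proof
      assume "b' = \<one>"
      then have "p \<otimes> a \<otimes> inv p = \<one>" using b' p by (simp add: A_def)
      then have "inv p \<otimes> (p \<otimes> a \<otimes> inv p) \<otimes> p = \<one>" using p by simp
      then have "a = \<one>" using p ac by (simp add: m_assoc inv_mult_cancel)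
      then show False using a by simp
    qed
    then show False using side_shift_ne[OF v(2) p(2,1) b'(1)] Ap b' by simp
  next
    assume comm: "\<forall>a\<in>hyp p v. \<forall>b\<in>hyp q w. a \<otimes> b = b \<otimes> a"
    have "A \<in> hyp p v" "B \<in> hyp q w" using a b by (auto simp: hyp_mem A_def B_def)
    then have AB: "A \<otimes> B = B \<otimes> A" using comm by blast
    have "side w q (B \<otimes> p) \<noteq> side w q p"
      unfolding B_def by (rule side_shift_ne[OF v(2) p(2,1) b])
    then have 1: "side v p (B \<otimes> p) = side v p q"
      using side_nested[OF v(2,1) p(2,1) _ ni'] c p by simp
    have "side w q (B \<otimes> (A \<otimes> p)) \<noteq> side w q (A \<otimes> p)"
      unfolding B_def by (rule side_shift_ne[OF v(2) p(2) _ b]) (use c p in simp)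
    then have 2: "side v p (B \<otimes> (A \<otimes> p)) = side v p q"
      using side_nested[OF v(2,1) p(2,1) _ ni'] c p Ap by simp
    have "B \<otimes> (A \<otimes> p) = A \<otimes> (B \<otimes> p)" using AB c p by (simp add: m_assoc[symmetric])
    moreover have "side v p (A \<otimes> (B \<otimes> p)) \<noteq> side v p (B \<otimes> p)"
      unfolding A_def by (rule side_shift_ne[OF v(1) p(1) _ a]) (use c p in simp)
    ultimately show False using 1 2 by simp
  qed
qed

text \<open>A letter of \<open>H v\<close> is its own leading syllable of type \<open>v\<close>, a letter of another type has none.\<close>

lemma hyp_neq_of_nb:
  assumes v: "v \<in> V" "w \<in> V" and "nb v w" and p: "p \<in> carrier P"
  shows "hyp p v \<noteq> hyp p w"
proof
  assume eq: "hyp p v = hyp p w"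
  obtain a where a: "a \<in> H v" "a \<noteq> \<one>" using H_nontrivial v by blast
  have "p \<otimes> a \<otimes> inv p \<in> hyp p v" unfolding hyp_mem using a by blast
  then have "p \<otimes> a \<otimes> inv p \<in> hyp p w" using eq by simp
  then obtain b where b: "b \<in> H w" "p \<otimes> a \<otimes> inv p = p \<otimes> b \<otimes> inv p" by (auto simp: hyp_mem)
  have "a = b" using b p a H_carrier v by (metis Units_eq Units_l_cancel inv_closed m_closed right_cancel)
  then have "\<sigma> v (\<one> \<otimes> a) = \<sigma> v \<one>"
    using \<sigma>_stay[OF v one_closed] b nb_irrefl assms(3) by metis
  moreover have "\<sigma> v (\<one> \<otimes> a) = \<sigma> v \<one> \<otimes> a" by (rule \<sigma>_cross[OF v(1) S_one a(1)])
  ultimately show False using \<sigma>_one[OF v(1)] a H_carrier[OF v(1)] by simp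
qed

lemma hyp_eq_iff:
  assumes v: "v \<in> V" "w \<in> V" and p: "p \<in> carrier P" "q \<in> carrier P"
  shows "hyp p v = hyp q w \<longleftrightarrow> v = w \<and> inv p \<otimes> q \<in> S v"
proof
  assume eq: "hyp p v = hyp q w"
  then have "incident v p w q" using incident_if_equal_or_commute[OF v p] by simp
  then obtain r where r: "r \<in> carrier P" "inv p \<otimes> r \<in> S v" "inv q \<otimes> r \<in> S w" "v = w \<or> nb v w"
    by (auto simp: incident_def)
  have "hyp r v = hyp p v" "hyp r w = hyp q w" using hyp_coset v p r by auto
  then have "v = w" using r hyp_neq_of_nb[OF v _ r(1)] eq by auto
  moreover have "inv p \<otimes> q \<in> S v"
    using S_coset_trans[OF p(1) r(1) p(2) r(2)] S_coset_sym[OF p(2) r(1)] r(3) \<open>v = w\<close> by simp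
  ultimately show "v = w \<and> inv p \<otimes> q \<in> S v" by simp
next
  assume "v = w \<and> inv p \<otimes> q \<in> S v"
  then show "hyp p v = hyp q w" using hyp_coset[OF v(1) p] by metis
qed

lemma incident_iff_common:
  assumes v: "v \<in> V" "w \<in> V" and p: "p \<in> carrier P" "q \<in> carrier P"
  shows "incident v p w q \<longleftrightarrow> (v = w \<or> nb v w) \<and> (\<exists>r\<in>carrier P. hyp p v = hyp r v \<and> hyp q w = hyp r w)"
  unfolding incident_def using hyp_eq_iff v p by auto

lemma commute_iff_common:
  assumes v: "v \<in> V" "w \<in> V" and p: "p \<in> carrier P" "q \<in> carrier P"
  shows "hyp p v \<noteq> hyp q w \<and> (\<forall>a\<in>hyp p v. \<forall>b\<in>hyp q w. a \<otimes> b = b \<otimes> a) \<longleftrightarrow>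
    nb v w \<and> (\<exists>r\<in>carrier P. hyp p v = hyp r v \<and> hyp q w = hyp r w)"
proof
  assume L: "hyp p v \<noteq> hyp q w \<and> (\<forall>a\<in>hyp p v. \<forall>b\<in>hyp q w. a \<otimes> b = b \<otimes> a)"
  then have "incident v p w q" using incident_if_equal_or_commute[OF v p] by blast
  then show "nb v w \<and> (\<exists>r\<in>carrier P. hyp p v = hyp r v \<and> hyp q w = hyp r w)"
    using L incident_iff_common[OF v p] by metis
next
  assume "nb v w \<and> (\<exists>r\<in>carrier P. hyp p v = hyp r v \<and> hyp q w = hyp r w)"
  then obtain r where r: "nb v w" "r \<in> carrier P" "hyp p v = hyp r v" "hyp q w = hyp r w" by blast
  have "a \<otimes> b = b \<otimes> a" if ab: "a \<in> hyp r v" "b \<in> hyp r w" for a b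
  proof -
    obtain s t where st: "s \<in> H v" "a = r \<otimes> s \<otimes> inv r" "t \<in> H w" "b = r \<otimes> t \<otimes> inv r"
      using ab unfolding hyp_mem by blast
    have c: "s \<in> carrier P" "t \<in> carrier P" using st H_carrier v by auto
    have "s \<otimes> t = t \<otimes> s" using H_commute v r st by auto
    then have "s \<otimes> (t \<otimes> inv r) = t \<otimes> (s \<otimes> inv r)" using c r by (simp add: m_assoc[symmetric])
    then show ?thesis using c r st by (simp add: m_assoc inv_mult_cancel)
  qed
  then show "hyp p v \<noteq> hyp q w \<and> (\<forall>a\<in>hyp p v. \<forall>b\<in>hyp q w. a \<otimes> b = b \<otimes> a)"
    using hyp_neq_of_nb[OF v r(1,2)] r by auto
qed

end

section \<open>The graph of hyperplanes\<close>

context leading_syllables begin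

definition hyp_graph :: "'a set graph" where
  "hyp_graph = \<lparr>verts = {hyp p v | p v. p \<in> carrier P \<and> v \<in> V},
     edges = {{A, B} | A B. A \<in> {hyp p v | p v. p \<in> carrier P \<and> v \<in> V} \<and>
       B \<in> {hyp p v | p v. p \<in> carrier P \<and> v \<in> V} \<and> A \<noteq> B \<and> (\<forall>a\<in>A. \<forall>b\<in>B. a \<otimes> b = b \<otimes> a)}\<rparr>"

definition copy :: "'a \<Rightarrow> 'a set set" where
  "copy p = hyp p ` V"

text \<open>A chosen coset representative and type for a hyperplane. The value of \<open>side\<close> depends on the representative, but
equality of the sides of two points does not.\<close>

definition rep :: "'a set \<Rightarrow> 'a \<times> 'v" where
  "rep x = (SOME (p, v). p \<in> carrier P \<and> v \<in> V \<and> hyp p v = x)"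

definition hyp_side :: "'a set \<Rightarrow> 'a \<Rightarrow> 'a" where
  "hyp_side x q = side (snd (rep x)) (fst (rep x)) q"

lemma hyp_in_hyp_graph: "p \<in> carrier P \<Longrightarrow> v \<in> V \<Longrightarrow> hyp p v \<in> verts hyp_graph"
  by (auto simp: hyp_graph_def)

lemma rep:
  assumes "x \<in> verts hyp_graph"
  shows "fst (rep x) \<in> carrier P" "snd (rep x) \<in> V" "hyp (fst (rep x)) (snd (rep x)) = x"
proof -
  have "\<exists>z. case z of (p, v) \<Rightarrow> p \<in> carrier P \<and> v \<in> V \<and> hyp p v = x"
    using assms by (auto simp: hyp_graph_def)
  then have "case rep x of (p, v) \<Rightarrow> p \<in> carrier P \<and> v \<in> V \<and> hyp p v = x"
    unfolding rep_def by (rule someI_ex)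
  then show "fst (rep x) \<in> carrier P" "snd (rep x) \<in> V" "hyp (fst (rep x)) (snd (rep x)) = x"
    by (auto split: prod.splits)
qed

lemma rep_hyp:
  assumes "q \<in> carrier P" "u \<in> V"
  shows "snd (rep (hyp q u)) = u" "inv (fst (rep (hyp q u))) \<otimes> q \<in> S u"
  using hyp_eq_iff[OF rep(2)[OF hyp_in_hyp_graph[OF assms]] assms(2) rep(1)[OF hyp_in_hyp_graph[OF assms]] assms(1)]
    rep(3)[OF hyp_in_hyp_graph[OF assms]] by auto

lemma hyp_side_stay:
  assumes "x \<in> verts hyp_graph" "q \<in> carrier P" "u \<in> V" "s \<in> H u" "x \<noteq> hyp q u"
  shows "hyp_side x (q \<otimes> s) = hyp_side x q"
  unfolding hyp_side_def
proof (rule side_stay[OF rep(2)[OF assms(1)] assms(3) rep(1)[OF assms(1)] assms(2,4)])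
  show "u \<noteq> snd (rep x) \<or> inv (fst (rep x)) \<otimes> q \<notin> S (snd (rep x))"
    using hyp_eq_iff[OF rep(2)[OF assms(1)] assms(3) rep(1)[OF assms(1)] assms(2)] assms(5)
      rep(3)[OF assms(1)] by auto
qed

lemma hyp_side_cross:
  assumes "q \<in> carrier P" "u \<in> V" "s \<in> H u"
  shows "hyp_side (hyp q u) (q \<otimes> s) = hyp_side (hyp q u) q \<otimes> s"
  unfolding hyp_side_def rep_hyp(1)[OF assms(1,2)]
  by (rule side_cross[OF assms(2) rep(1)[OF hyp_in_hyp_graph[OF assms(1,2)]] assms(1) rep_hyp(2)[OF assms(1,2)] assms(3)])

lemma hyp_side_in:
  assumes "q \<in> carrier P" "u \<in> V" "r \<in> carrier P"
  shows "hyp_side (hyp q u) r \<in> H u"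
  using side_in[OF assms(2) rep(1)[OF hyp_in_hyp_graph[OF assms(1,2)]] assms(3)] rep_hyp(1)[OF assms(1,2)]
  by (simp add: hyp_side_def)

lemma adj_hyp_graph: "(x, y) \<in> adj hyp_graph \<longleftrightarrow>
    x \<in> verts hyp_graph \<and> y \<in> verts hyp_graph \<and> x \<noteq> y \<and> (\<forall>a\<in>x. \<forall>b\<in>y. a \<otimes> b = b \<otimes> a)"
  unfolding adj_def hyp_graph_def by (auto simp: doubleton_eq_iff)

lemma adj_hyp_graph_iff:
  "(x, y) \<in> adj hyp_graph \<longleftrightarrow> (\<exists>r\<in>carrier P. \<exists>v\<in>V. \<exists>w\<in>V. nb v w \<and> x = hyp r v \<and> y = hyp r w)"
proof -
  have "x \<in> verts hyp_graph \<and> y \<in> verts hyp_graph \<and> x \<noteq> y \<and> (\<forall>a\<in>x. \<forall>b\<in>y. a \<otimes> b = b \<otimes> a) \<longleftrightarrow>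
    (\<exists>r\<in>carrier P. \<exists>v\<in>V. \<exists>w\<in>V. nb v w \<and> x = hyp r v \<and> y = hyp r w)"
    (is "?L \<longleftrightarrow> ?R")
  proof
    assume L: ?L
    then obtain p v q w where "p \<in> carrier P" "v \<in> V" "x = hyp p v" "q \<in> carrier P" "w \<in> V" "y = hyp q w"
      by (auto simp: hyp_graph_def)
    then show ?R using L commute_iff_common[of v w p q] by blast
  next
    assume ?R
    then obtain r v w where r: "r \<in> carrier P" "v \<in> V" "w \<in> V" "nb v w" "x = hyp r v" "y = hyp r w" by blast
    then show ?L using commute_iff_common[of v w r r] hyp_in_hyp_graph by blast
  qed
  then show ?thesis unfolding adj_hyp_graph .
qed

lemma star_hyp_graph_iff:
  assumes v: "v \<in> V" "w \<in> V" and p: "p \<in> carrier P" "q \<in> carrier P"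
  shows "hyp q w \<in> star hyp_graph (hyp p v) \<longleftrightarrow> incident v p w q"
proof
  assume "hyp q w \<in> star hyp_graph (hyp p v)"
  then consider "hyp q w = hyp p v" | "(hyp p v, hyp q w) \<in> adj hyp_graph" by (auto simp: star_def)
  then show "incident v p w q"
  proof cases
    case 1
    then show ?thesis using incident_if_equal_or_commute[OF v p] by simp
  next
    case 2
    then obtain r v' w' where r: "r \<in> carrier P" "v' \<in> V" "w' \<in> V" "nb v' w'" "hyp p v = hyp r v'" "hyp q w = hyp r w'"
      unfolding adj_hyp_graph_iff by blast
    then have "v' = v" "w' = w" using hyp_eq_iff v p by metis+
    then show ?thesis using r incident_iff_common[OF v p] by blast
  qed
next
  assume "incident v p w q"
  then obtain r where "v = w \<or> nb v w" "r \<in> carrier P" "hyp p v = hyp r v" "hyp q w = hyp r w"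
    using incident_iff_common[OF v p] by blast
  then show "hyp q w \<in> star hyp_graph (hyp p v)" using v unfolding star_def adj_hyp_graph_iff by blast
qed

lemma star_rep_iff:
  assumes "x \<in> verts hyp_graph" "w \<in> V" "q \<in> carrier P"
  shows "hyp q w \<in> star hyp_graph x \<longleftrightarrow> incident (snd (rep x)) (fst (rep x)) w q"
  using star_hyp_graph_iff[OF rep(2)[OF assms(1)] assms(2) rep(1)[OF assms(1)] assms(3)] rep(3)[OF assms(1)] by simp

lemma hyp_side_unique:
  assumes x: "x \<in> verts hyp_graph" and p: "p \<in> carrier P" "q \<in> carrier P" and y: "y \<in> copy p" "y \<in> copy q" "y \<notin> star hyp_graph x"
  shows "hyp_side x p = hyp_side x q"
proof -
  obtain w w' where w: "w \<in> V" "y = hyp p w" "w' \<in> V" "y = hyp q w'" using y by (auto simp: copy_def)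
  then have "w' = w" "inv p \<otimes> q \<in> S w" using hyp_eq_iff[OF w(1,3) p] by auto
  then show ?thesis
    using side_same_coset[OF rep(2,1)[OF x] p, of w] star_rep_iff[OF x w(1) p(1)] y(3) w(2)
    unfolding hyp_side_def by simp
qed

text \<open>An element of one hyperplane moves the points of a crossing hyperplane along the latter.\<close>

lemma translate_fixes_neighbour:
  assumes x: "a \<in> carrier P" and q: "q \<in> carrier P" "w \<in> V" and comm: "\<forall>b\<in>hyp q w. a \<otimes> b = b \<otimes> a"
  shows "hyp (a \<otimes> q) w = hyp q w"
proof -
  have sub: "hyp q w \<subseteq> carrier P" using q H_carrier by (auto simp: hyp_mem)
  have "hyp (a \<otimes> q) w = conj_subgroup P a (hyp q w)"
    unfolding hyp_def by (rule conj_subgroup_mult) (use assms H_subset is_group in auto)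
  also have "\<dots> = (\<lambda>b. b) ` hyp q w"
    unfolding conj_subgroup_def
  proof (rule image_cong[OF HOL.refl])
    fix b assume b: "b \<in> hyp q w"
    then have "a \<otimes> b = b \<otimes> a" "b \<in> carrier P" using comm sub by auto
    then show "a \<otimes> b \<otimes> inv a = b" using x by (simp add: m_assoc)
  qed
  finally show ?thesis by simp
qed

lemma path_crosses:
  assumes "(p, q) \<in> step ^^ k" "x \<in> verts hyp_graph" "hyp_side x q \<noteq> hyp_side x p"
  shows "\<exists>i j r s u. i + 1 + j = k \<and> (p, r) \<in> step ^^ i \<and> r \<in> carrier P \<and> u \<in> V \<and> s \<in> H u \<and>
    x = hyp r u \<and> (r \<otimes> s, q) \<in> step ^^ j"
  using assms
proof (induction k arbitrary: p)
  case 0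
  then show ?case by simp
next
  case (Suc k)
  obtain z where z: "(p, z) \<in> step" "(z, q) \<in> step ^^ k" using Suc.prems(1) by (meson relpow_Suc_D2)
  obtain s u where s: "p \<in> carrier P" "u \<in> V" "s \<in> H u" "z = p \<otimes> s" using z(1) by (rule stepE)
  show ?case
  proof (cases "x = hyp p u")
    case True
    have "(p, p) \<in> step ^^ 0" "0 + 1 + k = Suc k" by auto
    then show ?thesis using True s z(2) by blast
  next
    case False
    then have "hyp_side x q \<noteq> hyp_side x z" using hyp_side_stay[OF Suc.prems(2) s(1-3)] s(4) Suc.prems(3) by simp
    then obtain i j r s' u' where *: "i + 1 + j = k" "(z, r) \<in> step ^^ i" "r \<in> carrier P" "u' \<in> V" "s' \<in> H u'"
      "x = hyp r u'" "(r \<otimes> s', q) \<in> step ^^ j"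
      using Suc.IH[OF z(2) Suc.prems(2)] by blast
    have "(p, r) \<in> step ^^ Suc i" using z(1) *(2) by (meson relpow_Suc_I2)
    moreover have "Suc i + 1 + j = Suc k" using *(1) by simp
    ultimately show ?thesis using * by blast
  qed
qed

text \<open>Take a shortest path from \<open>g\<close> to a point whose copy contains \<open>y\<close>, and let \<open>x\<close> be the hyperplane crossed by its first
edge. Translating the remainder of the path by the element \<open>a\<close> of \<open>x\<close> that undoes the first step yields a path
that starts at \<open>g\<close>. If the original path crossed \<open>x\<close> again, the translate could be closed up at that crossing; if \<open>y\<close> were
adjacent to \<open>x\<close>, it would be fixed by \<open>a\<close>. Either way a shorter path would exist.\<close>

lemma hyp_graph_exit:
  assumes g: "g \<in> carrier P" and y: "y \<in> verts hyp_graph" "y \<notin> copy g"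
  shows "\<exists>x\<in>copy g. y \<notin> star hyp_graph x \<and> (\<exists>q\<in>carrier P. y \<in> copy q \<and> hyp_side x q \<noteq> hyp_side x g)"
proof -
  let ?len = "\<lambda>k. \<exists>q\<in>carrier P. (g, q) \<in> step ^^ k \<and> y \<in> copy q"
  obtain q0 where "q0 \<in> carrier P" "y \<in> copy q0" using y(1) by (auto simp: hyp_graph_def copy_def)
  moreover then obtain k0 where "(g, q0) \<in> step ^^ k0"
    using connected_steps[OF g] by (meson rtrancl_imp_relpow)
  ultimately have ex: "\<exists>k. ?len k" by blast
  define k where "k = (LEAST k. ?len k)"
  have "?len k" unfolding k_def using ex by (rule LeastI_ex)
  then obtain q where q: "q \<in> carrier P" "(g, q) \<in> step ^^ k" "y \<in> copy q" by blast
  have least: "k \<le> m" if "?len m" for m unfolding k_def using that by (rule Least_le)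
  have "k \<noteq> 0" using q y(2) by (cases k) auto
  then obtain m where m: "k = Suc m" by (cases k) auto
  obtain z where z: "(g, z) \<in> step" "(z, q) \<in> step ^^ m" using q(2) m by (meson relpow_Suc_D2)
  obtain s u where s: "u \<in> V" "s \<in> H u" "z = g \<otimes> s" using z(1) by (rule stepE)
  have sc: "s \<in> carrier P" using H_carrier s by auto
  have zc: "z \<in> carrier P" using s sc g by simp
  define x where "x = hyp g u"
  have x: "x \<in> verts hyp_graph" "x \<in> copy g" using hyp_in_hyp_graph[OF g s(1)] s(1) by (auto simp: x_def copy_def)
  \<comment> \<open>The element of \<open>x\<close> that moves \<open>z = g s\<close> back to \<open>g\<close>.\<close>
  define a where "a = g \<otimes> inv s \<otimes> inv g"
  have a: "a \<in> carrier P" "a \<in> x" using g sc s H_inv[OF s(1,2)] by (auto simp: a_def x_def hyp_mem)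
  have az: "a \<otimes> z = g" using g sc s(3) by (simp add: a_def m_assoc inv_mult_cancel)
  have pull: "(g, a \<otimes> r) \<in> step ^^ i" if "(z, r) \<in> step ^^ i" for r i
    using step_relpow_translate[OF a(1) that] az by simp
  have same: "hyp_side x q = hyp_side x z"
  proof (rule ccontr)
    assume "hyp_side x q \<noteq> hyp_side x z"
    then obtain i j r s' u' where r: "i + 1 + j = m" "(z, r) \<in> step ^^ i" "r \<in> carrier P" "u' \<in> V" "s' \<in> H u'"
      "x = hyp r u'" "(r \<otimes> s', q) \<in> step ^^ j"
      using path_crosses[OF z(2) x(1)] by blast
    obtain c where c: "c \<in> H u'" "a = r \<otimes> c \<otimes> inv r" using a(2) r(6) by (auto simp: hyp_mem)
    have cc: "c \<in> carrier P" "s' \<in> carrier P" using H_carrier r c by auto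
    have "(a \<otimes> r) \<otimes> (inv c \<otimes> s') = r \<otimes> s'"
      using c(2) cc r(3) by (simp add: m_assoc inv_mult_cancel mult_inv_cancel)
    then have "(a \<otimes> r, r \<otimes> s') \<in> step"
      using stepI[of "a \<otimes> r" u' "inv c \<otimes> s'"] a(1) r H_mult H_inv c by auto
    then have gr: "(g, r \<otimes> s') \<in> step ^^ Suc i" using pull[OF r(2)] by auto
    have "Suc i + j = m" using r(1) by simp
    with relpow_trans[OF gr r(7)] have "(g, q) \<in> step ^^ m" by (simp only:)
    then show False using least[of m] q m by auto
  qed
  have ns: "y \<notin> star hyp_graph x"
  proof
    assume "y \<in> star hyp_graph x"
    then consider "y = x" | "(x, y) \<in> adj hyp_graph" by (auto simp: star_def)
    then show False
    proof cases
      case 1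
      then show False using x(2) y(2) by simp
    next
      case 2
      have "\<forall>b\<in>y. a \<otimes> b = b \<otimes> a"
        using 2 a(2) unfolding adj_hyp_graph by blast
      moreover obtain w where w: "w \<in> V" "y = hyp q w" using q(3) by (auto simp: copy_def)
      ultimately have "hyp (a \<otimes> q) w = y" using translate_fixes_neighbour[OF a(1) q(1) w(1)] by simp
      then have "y \<in> copy (a \<otimes> q)" using w(1) by (auto simp: copy_def)
      then have "?len m" using pull[OF z(2)] a(1) q(1) by blast
      then show False using least[of m] m by simp
    qed
  qed
  have "s \<noteq> \<one>"
  proof
    assume "s = \<one>"
    then have "(g, q) \<in> step ^^ m" using z(2) s(3) g by simp
    then show False using least[of m] q m by auto
  qed
  then have "hyp_side x z \<noteq> hyp_side x g"
    using hyp_side_cross[OF g s(1,2)] s(3) H_carrier[OF s(1) hyp_side_in[OF g s(1) g]] sc by (simp add: x_def)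
  then have "hyp_side x q \<noteq> hyp_side x g" using same by simp
  then show ?thesis using x(2) ns q(1,3) by blast
qed

lemma hyp_graph_cross:
  assumes p: "p \<in> carrier P" "q \<in> carrier P" and x: "x \<in> copy p"
  shows "\<exists>p'\<in>carrier P. hyp_side x p' = hyp_side x q \<and> (\<forall>x'\<in>verts hyp_graph. x' \<noteq> x \<longrightarrow> hyp_side x' p' = hyp_side x' p)"
proof -
  obtain u where u: "u \<in> V" "x = hyp p u" using x by (auto simp: copy_def)
  define s where "s = inv (hyp_side x p) \<otimes> hyp_side x q"
  have h: "hyp_side x p \<in> H u" "hyp_side x q \<in> H u" using hyp_side_in u p by auto
  then have s: "s \<in> H u" using H_mult H_inv u by (auto simp: s_def)
  have "hyp_side x (p \<otimes> s) = hyp_side x q"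
    using hyp_side_cross[OF p(1) u(1) s] u(2) h H_carrier[OF u(1)] by (simp add: s_def mult_inv_cancel)
  moreover have "hyp_side x' (p \<otimes> s) = hyp_side x' p" if "x' \<in> verts hyp_graph" "x' \<noteq> x" for x'
    using hyp_side_stay[OF that(1) p(1) u(1) s] that u by simp
  ultimately show ?thesis using p s H_carrier[OF u(1)] by (intro bexI[of _ "p \<otimes> s"]) auto
qed

lemma hyp_graph_finite_separators:
  assumes p: "p \<in> carrier P" "q \<in> carrier P"
  shows "finite {x \<in> verts hyp_graph. hyp_side x p \<noteq> hyp_side x q}"
  using connected_steps[OF p]
proof (induction rule: rtrancl_induct)
  case base
  then show ?case by simp
next
  case (step q z)
  obtain s u where s: "q \<in> carrier P" "u \<in> V" "s \<in> H u" "z = q \<otimes> s" using step.hyps(2) by (rule stepE)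
  have "{x \<in> verts hyp_graph. hyp_side x p \<noteq> hyp_side x z} \<subseteq> insert (hyp q u) {x \<in> verts hyp_graph. hyp_side x p \<noteq> hyp_side x q}"
  proof
    fix x assume x: "x \<in> {x \<in> verts hyp_graph. hyp_side x p \<noteq> hyp_side x z}"
    show "x \<in> insert (hyp q u) {x \<in> verts hyp_graph. hyp_side x p \<noteq> hyp_side x q}"
    proof (cases "x = hyp q u")
      case False
      then show ?thesis using x hyp_side_stay[OF _ s(1-3) False] s(4) by simp
    qed simp
  qed
  then show ?case using step.IH by (meson finite_insert finite_subset)
qed

lemma hyp_graph_nested:
  assumes x: "x \<in> verts hyp_graph" "x' \<in> verts hyp_graph" "x' \<notin> star hyp_graph x"
    and p: "p \<in> carrier P" "q \<in> carrier P" "q' \<in> carrier P"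
    and xq: "x \<in> copy q" "x' \<in> copy q'" and ne: "hyp_side x p \<noteq> hyp_side x q'"
  shows "hyp_side x' p = hyp_side x' q"
proof -
  let ?p = "fst (rep x)" and ?v = "snd (rep x)" and ?p' = "fst (rep x')" and ?v' = "snd (rep x')"
  note r = rep[OF x(1)] and r' = rep[OF x(2)]
  have ni: "\<not> incident ?v ?p ?v' ?p'" using star_rep_iff[OF x(1) r'(2,1)] r'(3) x(3) by simp
  then have ni': "\<not> incident ?v' ?p' ?v ?p" using incident_sym by blast
  obtain v v' where v: "v \<in> V" "x = hyp q v" "v' \<in> V" "x' = hyp q' v'" using xq by (auto simp: copy_def)
  have q: "inv ?p \<otimes> q \<in> S ?v" "inv ?p' \<otimes> q' \<in> S ?v'"
    using hyp_eq_iff[OF r(2) v(1) r(1) p(2)] hyp_eq_iff[OF r'(2) v(3) r'(1) p(3)] r(3) r'(3) v by auto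
  have "side ?v ?p q' = side ?v ?p ?p'"
    using side_same_coset[OF r(2,1) r'(1) p(3) q(2) ni] .
  then have "side ?v' ?p' p = side ?v' ?p' ?p"
    using side_nested[OF r(2) r'(2) r(1) r'(1) p(1) ni] ne by (simp add: hyp_side_def)
  also have "\<dots> = side ?v' ?p' q" using side_same_coset[OF r'(2,1) r(1) p(2) q(1) ni'] by simp
  finally show ?thesis by (simp add: hyp_side_def)
qed

lemma sector_system_hyp_graph: "sector_system hyp_graph (carrier P) copy hyp_side"
proof
  show "copy p \<subseteq> verts hyp_graph" if "p \<in> carrier P" for p
    using that hyp_in_hyp_graph by (auto simp: copy_def)
  show "\<exists>p\<in>carrier P. y \<in> copy p" if "y \<in> verts hyp_graph" for y
    using that by (auto simp: hyp_graph_def copy_def)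
  show "\<exists>p\<in>carrier P. y \<in> copy p \<and> y' \<in> copy p" if "(y, y') \<in> adj hyp_graph" for y y'
    using that unfolding adj_hyp_graph_iff copy_def by blast
qed (fact hyp_side_unique hyp_graph_cross hyp_graph_exit hyp_graph_finite_separators hyp_graph_nested)+

text \<open>The element \<open>\<one>\<close> serves as the base point; the retraction sends a hyperplane to its type.\<close>

lemma hyp_graph_coarse_dim:
  assumes Y: "connected_graph Y" "V = verts Y" "\<And>u w. nb u w \<longleftrightarrow> (u, w) \<in> adj Y"
    and dim: "coarse_dim_le (verts Y) (vertex_dist Y) n"
  shows "connected_graph hyp_graph" "coarse_dim_le (verts hyp_graph) (vertex_dist hyp_graph) (Suc n)"
proof -
  have lift: "(hyp p u, hyp p w) \<in> adj hyp_graph ^^ k" if "p \<in> carrier P" "(u, w) \<in> adj Y ^^ k" for p u w k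
    using that(2)
  proof (induction k arbitrary: w)
    case (Suc k)
    then obtain z where z: "(u, z) \<in> adj Y ^^ k" "(z, w) \<in> adj Y" by auto
    then have "(hyp p z, hyp p w) \<in> adj hyp_graph"
      using that(1) Y(2,3) unfolding adj_hyp_graph_iff by (auto simp: adj_def)
    then show ?case using Suc.IH[OF z(1)] by auto
  qed simp
  have in_copy: "\<exists>k. (hyp p u, hyp p w) \<in> adj hyp_graph ^^ k" if "p \<in> carrier P" "u \<in> V" "w \<in> V" for p u w
    using lift[OF that(1)] Y that unfolding connected_graph_iff by metis
  have "\<exists>k. (hyp p v, hyp q w) \<in> adj hyp_graph ^^ k" if p: "p \<in> carrier P" "q \<in> carrier P" and v: "v \<in> V" "w \<in> V" for p q v w
    using connected_steps[OF p] v(2)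
  proof (induction arbitrary: w rule: rtrancl_induct)
    case base
    then show ?case using in_copy p v by blast
  next
    case (step q z)
    obtain s u where s: "q \<in> carrier P" "u \<in> V" "s \<in> H u" "z = q \<otimes> s" "z \<in> carrier P" using step.hyps(2) by (rule stepE)
    have "inv q \<otimes> z \<in> S u" using s H_in_S[of u u s] H_carrier[of u s] by (simp add: inv_mult_cancel)
    then have "hyp z u = hyp q u" using hyp_coset s by blast
    moreover obtain i where "(hyp p v, hyp q u) \<in> adj hyp_graph ^^ i" using step.IH s by blast
    moreover obtain j where "(hyp z u, hyp z w) \<in> adj hyp_graph ^^ j" using in_copy[OF s(5,2) step.prems] by blast
    ultimately show ?case by (metis relpow_trans)
  qed
  then show conn: "connected_graph hyp_graph" unfolding connected_graph_iff by (auto simp: hyp_graph_def)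
  show "coarse_dim_le (verts hyp_graph) (vertex_dist hyp_graph) (Suc n)"
  proof (cases "V = {}")
    case True
    then have "verts hyp_graph = {}" unfolding hyp_graph_def by simp
    then show ?thesis unfolding coarse_dim_le_def by (auto intro!: exI[of _ "\<lambda>_. {}"])
  next
    case False
    interpret sector_system hyp_graph "carrier P" copy hyp_side by (rule sector_system_hyp_graph)
    interpret based_sector_system hyp_graph "carrier P" copy hyp_side \<one>
      by unfold_locales (use False conn in \<open>auto simp: copy_def\<close>)
    define \<rho> where "\<rho> x = snd (rep x)" for x
    have \<rho>: "\<rho> (hyp p v) = v" if "p \<in> carrier P" "v \<in> V" for p v
      using rep_hyp(1)[OF that] by (simp add: \<rho>_def)
    show ?thesis
    proof (rule coarse_dim_le_Suc_of_retraction[where \<rho> = \<rho>, OF dim Y(1)])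
      show "\<rho> x \<in> verts Y" if "x \<in> verts hyp_graph" for x using rep(2)[OF that] Y(2) by (simp add: \<rho>_def)
      show "(\<rho> x, \<rho> y) \<in> adj Y" if "(x, y) \<in> adj hyp_graph" for x y
        using that \<rho> Y(3) unfolding adj_hyp_graph_iff by auto
      show "vertex_dist hyp_graph u w \<le> vertex_dist Y (\<rho> u) (\<rho> w)"
        if pu: "p \<in> carrier P" "u \<in> copy p" "w \<in> copy p" for p u w
      proof -
        obtain v v' where v: "v \<in> V" "u = hyp p v" "v' \<in> V" "w = hyp p v'" using pu by (auto simp: copy_def)
        have "(u, w) \<in> adj hyp_graph ^^ vertex_dist Y v v'"
          using lift[OF pu(1) vertex_dist_relpow[OF Y(1)]] v Y(2) by simp
        then show ?thesis using vertex_dist_le[OF hyp_in_hyp_graph[OF pu(1) v(1)]] v \<rho> pu(1) by simp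
      qed
    qed
  qed
qed

end

section \<open>Free products and graph products\<close>

locale group_family =
  fixes I :: "'v set" and G :: "'v \<Rightarrow> ('g, 'b) monoid_scheme"
  assumes group_G: "i \<in> I \<Longrightarrow> group (G i)"
begin

abbreviation W where "W \<equiv> fp_words I G"
abbreviation R where "R \<equiv> fp_rel I G"
abbreviation F where "F \<equiv> free_product I G"

definition word_class :: "('v \<times> 'g) list \<Rightarrow> ('v \<times> 'g) list set" where
  "word_class w = R `` {w}"

lemma words_append [simp]: "a @ b \<in> W \<longleftrightarrow> a \<in> W \<and> b \<in> W"
  by (auto simp: fp_words_def)

lemma words_Nil [simp]: "[] \<in> W"
  by (simp add: fp_words_def)

lemma words_Cons [simp]: "x # b \<in> W \<longleftrightarrow> fst x \<in> I \<and> snd x \<in> carrier (G (fst x)) \<and> b \<in> W"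
  by (cases x) (auto simp: fp_words_def)

lemma rel_words: "(a, b) \<in> R \<Longrightarrow> a \<in> W \<and> b \<in> W"
proof (induction rule: fp_rel.induct)
  case (mult a b i g h)
  then show ?case using group_G[of i] by (auto intro: monoid.m_closed group.is_monoid)
next
  case (one a b i)
  then show ?case using group_G[of i] by (auto intro: monoid.one_closed group.is_monoid)
qed auto

lemma rel_context: "(a, b) \<in> R \<Longrightarrow> c \<in> W \<Longrightarrow> e \<in> W \<Longrightarrow> (c @ a @ e, c @ b @ e) \<in> R"
proof (induction rule: fp_rel.induct)
  case (refl a)
  then show ?case by (intro fp_rel.refl) simp
next
  case (sym a b)
  then show ?case by (blast intro: fp_rel.sym)
next
  case (trans a b c)
  then show ?case by (blast intro: fp_rel.trans)
next
  case (mult a b i g h)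
  then show ?case using fp_rel.mult[of "c @ a" I G "b @ e" i g h] by simp
next
  case (one a b i)
  then show ?case using fp_rel.one[of "c @ a" I G "b @ e" i] by simp
qed

lemma rel_append: "(a, a') \<in> R \<Longrightarrow> (b, b') \<in> R \<Longrightarrow> (a @ b, a' @ b') \<in> R"
  using rel_context[of a a' "[]" b] rel_context[of b b' a' "[]"] rel_words fp_rel.trans
  by (metis append_Nil append_Nil2 words_Nil)

lemma equiv_rel: "equiv W R"
proof (rule equivI)
  show "R \<subseteq> W \<times> W" using rel_words by auto
  show "refl_on W R" by (rule refl_onI) (auto intro: fp_rel.refl)
  show "sym R" by (rule symI) (rule fp_rel.sym)
  show "trans R" by (rule transI) (rule fp_rel.trans)
qed

lemma word_class_eq_iff: "a \<in> W \<Longrightarrow> b \<in> W \<Longrightarrow> word_class a = word_class b \<longleftrightarrow> (a, b) \<in> R"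
  unfolding word_class_def by (rule eq_equiv_class_iff[OF equiv_rel])

lemma word_class_eqI: "(a, b) \<in> R \<Longrightarrow> word_class a = word_class b"
  using word_class_eq_iff rel_words by blast

lemma carrier_F: "carrier F = word_class ` W"
  by (auto simp: free_product_def quotient_def word_class_def)

lemma word_class_in [simp]: "w \<in> W \<Longrightarrow> word_class w \<in> carrier F"
  by (simp add: carrier_F)

lemma one_F: "\<one>\<^bsub>F\<^esub> = word_class []"
  by (simp add: free_product_def word_class_def)

lemma mult_F:
  assumes "a \<in> W" "b \<in> W"
  shows "word_class a \<otimes>\<^bsub>F\<^esub> word_class b = word_class (a @ b)"
proof -
  have "(\<Union>x\<in>word_class a. \<Union>y\<in>word_class b. R `` {x @ y}) = word_class (a @ b)"
  proof -
    have "R `` {x @ y} = word_class (a @ b)" if "x \<in> word_class a" "y \<in> word_class b" for x y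
    proof -
      have "(a @ b, x @ y) \<in> R" using that rel_append unfolding word_class_def by blast
      then show ?thesis using word_class_eq_iff[of "a @ b" "x @ y"] rel_words unfolding word_class_def by blast
    qed
    moreover have "a \<in> word_class a" "b \<in> word_class b" using assms unfolding word_class_def by (auto intro: fp_rel.refl)
    ultimately show ?thesis by blast
  qed
  then show ?thesis by (simp add: free_product_def)
qed

definition inv_word :: "('v \<times> 'g) list \<Rightarrow> ('v \<times> 'g) list" where
  "inv_word w = rev (map (\<lambda>(i, g). (i, inv\<^bsub>G i\<^esub> g)) w)"

lemma inv_word_words: "w \<in> W \<Longrightarrow> inv_word w \<in> W"
proof (induction w)
  case (Cons x w)
  then show ?case using group_G[of "fst x"] by (auto simp: inv_word_def split: prod.splits)
qed (simp add: inv_word_def)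

lemma inv_word_rel: "w \<in> W \<Longrightarrow> (inv_word w @ w, []) \<in> R"
proof (induction w)
  case Nil
  then show ?case by (auto simp: inv_word_def intro: fp_rel.refl)
next
  case (Cons x w)
  obtain i g where x: "x = (i, g)" by (cases x)
  have i: "i \<in> I" "g \<in> carrier (G i)" "w \<in> W" using Cons.prems x by auto
  interpret Gi: group "G i" by (rule group_G[OF i(1)])
  have v: "inv_word w \<in> W" by (rule inv_word_words[OF i(3)])
  have "(inv_word w @ [(i, inv\<^bsub>G i\<^esub> g), (i, g)] @ w, inv_word w @ [(i, inv\<^bsub>G i\<^esub> g \<otimes>\<^bsub>G i\<^esub> g)] @ w) \<in> R"
    by (rule fp_rel.mult) (use v i in auto)
  moreover have "(inv_word w @ [(i, \<one>\<^bsub>G i\<^esub>)] @ w, inv_word w @ w) \<in> R"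
    by (rule fp_rel.one) (use v i in auto)
  ultimately have "(inv_word w @ [(i, inv\<^bsub>G i\<^esub> g), (i, g)] @ w, inv_word w @ w) \<in> R"
    using i by (auto intro: fp_rel.trans)
  moreover have "inv_word (x # w) @ (x # w) = inv_word w @ [(i, inv\<^bsub>G i\<^esub> g), (i, g)] @ w"
    by (simp add: inv_word_def x)
  ultimately show ?case using Cons.IH[OF i(3)] by (auto intro: fp_rel.trans)
qed

lemma group_F: "group F"
proof (rule groupI)
  show "x \<otimes>\<^bsub>F\<^esub> y \<in> carrier F" if "x \<in> carrier F" "y \<in> carrier F" for x y
    using that by (auto simp: carrier_F mult_F)
  show "\<one>\<^bsub>F\<^esub> \<in> carrier F" by (simp add: one_F)
  show "x \<otimes>\<^bsub>F\<^esub> y \<otimes>\<^bsub>F\<^esub> z = x \<otimes>\<^bsub>F\<^esub> (y \<otimes>\<^bsub>F\<^esub> z)"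
    if "x \<in> carrier F" "y \<in> carrier F" "z \<in> carrier F" for x y z
    using that by (auto simp: carrier_F mult_F)
  show "\<one>\<^bsub>F\<^esub> \<otimes>\<^bsub>F\<^esub> x = x" if "x \<in> carrier F" for x
    using that by (auto simp: carrier_F mult_F one_F)
  show "\<exists>y\<in>carrier F. y \<otimes>\<^bsub>F\<^esub> x = \<one>\<^bsub>F\<^esub>" if x: "x \<in> carrier F" for x
  proof -
    obtain w where w: "w \<in> W" "x = word_class w" using x by (auto simp: carrier_F)
    have "word_class (inv_word w @ w) = word_class []"
      by (rule word_class_eqI[OF inv_word_rel[OF w(1)]])
    then have "word_class (inv_word w) \<otimes>\<^bsub>F\<^esub> x = \<one>\<^bsub>F\<^esub>"
      using mult_F[OF inv_word_words[OF w(1)] w(1)] w(2) by (simp add: one_F)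
    then show ?thesis using inv_word_words[OF w(1)] by (intro bexI[of _ "word_class (inv_word w)"]) auto
  qed
qed

lemma fp_incl_eq: "fp_incl I G i g = word_class [(i, g)]"
  by (simp add: fp_incl_def word_class_def)

lemma fp_incl_hom: "i \<in> I \<Longrightarrow> fp_incl I G i \<in> hom (G i) F"
proof (rule homI)
  fix g h assume i: "i \<in> I" and g: "g \<in> carrier (G i)"
  then show "fp_incl I G i g \<in> carrier F" by (simp add: fp_incl_eq)
  assume h: "h \<in> carrier (G i)"
  have "([] @ [(i, g), (i, h)] @ [], [] @ [(i, g \<otimes>\<^bsub>G i\<^esub> h)] @ []) \<in> R"
    by (rule fp_rel.mult) (use i g h in auto)
  then have "word_class [(i, g), (i, h)] = word_class [(i, g \<otimes>\<^bsub>G i\<^esub> h)]"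
    using word_class_eqI by simp
  then show "fp_incl I G i (g \<otimes>\<^bsub>G i\<^esub> h) = fp_incl I G i g \<otimes>\<^bsub>F\<^esub> fp_incl I G i h"
    using i g h by (simp add: fp_incl_eq mult_F)
qed

lemma fp_incl_in: "i \<in> I \<Longrightarrow> g \<in> carrier (G i) \<Longrightarrow> fp_incl I G i g \<in> carrier F"
  using fp_incl_hom by (auto simp: hom_def)

text \<open>The product in \<open>K\<close> of the images of the letters is compatible with both kinds of elementary relations.\<close>

lemma free_product_universal:
  assumes K: "group K" and \<phi>: "\<And>i. i \<in> I \<Longrightarrow> \<phi> i \<in> hom (G i) K"
  shows "\<exists>\<Phi>\<in>hom F K. \<forall>i\<in>I. \<forall>g\<in>carrier (G i). \<Phi> (fp_incl I G i g) = \<phi> i g"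
proof -
  interpret K: group K by fact
  define ev where "ev w = foldr (\<lambda>(i, g) z. \<phi> i g \<otimes>\<^bsub>K\<^esub> z) w \<one>\<^bsub>K\<^esub>" for w
  have ev_simps [simp]: "ev [] = \<one>\<^bsub>K\<^esub>" "ev (x # w) = \<phi> (fst x) (snd x) \<otimes>\<^bsub>K\<^esub> ev w" for x w
    by (simp_all add: ev_def split: prod.splits)
  have \<phi>_in: "\<phi> i g \<in> carrier K" if "i \<in> I" "g \<in> carrier (G i)" for i g
    using \<phi>[OF that(1)] that(2) by (auto simp: hom_def)
  have ev_in: "w \<in> W \<Longrightarrow> ev w \<in> carrier K" for w
    by (induction w) (auto simp: \<phi>_in)
  have ev_append: "a \<in> W \<Longrightarrow> b \<in> W \<Longrightarrow> ev (a @ b) = ev a \<otimes>\<^bsub>K\<^esub> ev b" for a b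
    by (induction a) (auto simp: \<phi>_in ev_in K.m_assoc)
  have ev_rel: "ev a = ev b" if "(a, b) \<in> R" for a b
    using that
  proof (induction rule: fp_rel.induct)
    case (mult a b i g h)
    interpret Gi: group "G i" by (rule group_G) fact
    have "ev [(i, g), (i, h)] = ev [(i, g \<otimes>\<^bsub>G i\<^esub> h)]"
      using mult \<phi>_in hom_mult[OF \<phi>[of i], of g h] by simp
    moreover have "[(i, g), (i, h)] \<in> W" "[(i, g \<otimes>\<^bsub>G i\<^esub> h)] \<in> W" using mult by auto
    ultimately show ?case using mult.hyps by (simp only: ev_append words_append simp_thms)
  next
    case (one a b i)
    interpret Gi: group "G i" by (rule group_G) fact
    have "\<phi> i \<one>\<^bsub>G i\<^esub> = \<one>\<^bsub>K\<^esub>" using hom_one[OF \<phi>[OF one(3)] Gi.is_group K] .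
    then have "ev [(i, \<one>\<^bsub>G i\<^esub>)] = \<one>\<^bsub>K\<^esub>" by simp
    moreover have "[(i, \<one>\<^bsub>G i\<^esub>)] \<in> W" using one by auto
    ultimately show ?case using one.hyps ev_in by (simp only: ev_append words_append simp_thms K.l_one)
  qed auto
  define \<Phi> where "\<Phi> A = ev (SOME w. w \<in> A)" for A
  have \<Phi>_word_class: "\<Phi> (word_class w) = ev w" if "w \<in> W" for w
  proof -
    have "w \<in> word_class w" using that by (auto simp: word_class_def intro: fp_rel.refl)
    then have "(SOME w'. w' \<in> word_class w) \<in> word_class w" by (rule someI)
    then have "(w, SOME w'. w' \<in> word_class w) \<in> R" by (simp add: word_class_def)
    then show ?thesis using ev_rel unfolding \<Phi>_def by metis
  qed
  have "\<Phi> \<in> hom F K"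
    by (rule homI) (auto simp: carrier_F \<Phi>_word_class ev_in mult_F ev_append)
  moreover have "\<Phi> (fp_incl I G i g) = \<phi> i g" if "i \<in> I" "g \<in> carrier (G i)" for i g
    using that \<phi>_in by (simp add: fp_incl_eq \<Phi>_word_class)
  ultimately show ?thesis by blast
qed

lemma F_generated: "generate F (\<Union>i\<in>I. fp_incl I G i ` carrier (G i)) = carrier F"
proof
  interpret F: group F by (rule group_F)
  show "generate F (\<Union>i\<in>I. fp_incl I G i ` carrier (G i)) \<subseteq> carrier F"
    by (rule F.generate_incl) (auto simp: fp_incl_in)
  have "w \<in> W \<Longrightarrow> word_class w \<in> generate F (\<Union>i\<in>I. fp_incl I G i ` carrier (G i))" for w
  proof (induction w)
    case Nil
    then show ?case using generate.one[of F] by (simp add: one_F)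
  next
    case (Cons x w)
    then have "word_class [x] \<in> generate F (\<Union>i\<in>I. fp_incl I G i ` carrier (G i))"
      by (intro generate.incl) (auto simp: fp_incl_eq intro!: bexI[of _ "fst x"] image_eqI[of _ _ "snd x"])
    then have "word_class [x] \<otimes>\<^bsub>F\<^esub> word_class w \<in> generate F (\<Union>i\<in>I. fp_incl I G i ` carrier (G i))"
      using Cons by (intro generate.eng) auto
    then show ?case using Cons.prems mult_F[of "[x]" w] by simp
  qed
  then show "carrier F \<subseteq> generate F (\<Union>i\<in>I. fp_incl I G i ` carrier (G i))"
    by (auto simp: carrier_F)
qed

end

lemma normal_closure_normal:
  assumes "group F" "S \<subseteq> carrier F"
  shows "normal_closure F S \<lhd> F" "S \<subseteq> normal_closure F S"
proof -
  interpret group F by fact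
  have "carrier F \<lhd> F" by (rule normal_invI[OF subgroup_self]) simp
  then have ne: "{N. N \<lhd> F \<and> S \<subseteq> N} \<noteq> {}" using assms(2) by blast
  show "normal_closure F S \<lhd> F"
    unfolding normal_closure_def
  proof (rule normal_invI)
    show "subgroup (\<Inter>{N. N \<lhd> F \<and> S \<subseteq> N}) F"
      by (rule subgroups_Inter[OF _ ne]) (auto dest: normal_imp_subgroup)
    show "x \<otimes>\<^bsub>F\<^esub> h \<otimes>\<^bsub>F\<^esub> inv\<^bsub>F\<^esub> x \<in> \<Inter>{N. N \<lhd> F \<and> S \<subseteq> N}"
      if "x \<in> carrier F" "h \<in> \<Inter>{N. N \<lhd> F \<and> S \<subseteq> N}" for x h
      using that by (auto simp: normal_inv_iff)
  qed
  show "S \<subseteq> normal_closure F S" by (auto simp: normal_closure_def)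
qed

lemma normal_closure_least: "N \<lhd> F \<Longrightarrow> S \<subseteq> N \<Longrightarrow> normal_closure F S \<subseteq> N"
  by (auto simp: normal_closure_def)

locale graph_family = group_family "verts \<Gamma>" G
  for \<Gamma> :: "'v graph" and G :: "'v \<Rightarrow> ('g, 'b) monoid_scheme" +
  assumes simplicial: "simplicial_graph \<Gamma>"
    and nontrivial: "v \<in> verts \<Gamma> \<Longrightarrow> \<not> trivial_group (G v)"
begin

lemma edge_verts: "{u, v} \<in> edges \<Gamma> \<Longrightarrow> u \<in> verts \<Gamma> \<and> v \<in> verts \<Gamma> \<and> u \<noteq> v"
  using simplicial unfolding simplicial_graph_def by fastforce

abbreviation N where "N \<equiv> normal_closure F (edge_commutators \<Gamma> G)"
abbreviation P where "P \<equiv> graph_product \<Gamma> G"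

definition proj :: "('v \<times> 'g) list set \<Rightarrow> ('v \<times> 'g) list set set" where
  "proj x = N #>\<^bsub>F\<^esub> x"

definition \<iota> :: "'v \<Rightarrow> 'g \<Rightarrow> ('v \<times> 'g) list set set" where
  "\<iota> v g = proj (fp_incl (verts \<Gamma>) G v g)"

lemma P_eq: "P = F Mod N"
  by (simp add: graph_product_def Let_def)

lemma vertex_subgroup_eq: "vertex_subgroup \<Gamma> G v = \<iota> v ` carrier (G v)"
  by (simp add: vertex_subgroup_def Let_def \<iota>_def proj_def)

lemma edge_commutators_carrier: "edge_commutators \<Gamma> G \<subseteq> carrier F"
proof -
  interpret F: group F by (rule group_F)
  show ?thesis
    unfolding edge_commutators_def Let_def using edge_verts fp_incl_in by blast
qed

lemma N_normal: "N \<lhd> F"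
  by (rule normal_closure_normal[OF group_F edge_commutators_carrier])

lemma group_P: "group P"
  unfolding P_eq by (rule normal.factorgroup_is_group[OF N_normal])

lemma proj_hom: "proj \<in> hom F P"
  unfolding P_eq proj_def[abs_def] by (rule normal.r_coset_hom_Mod[OF N_normal])

lemma group_hom_proj: "group_hom F P proj"
  using proj_hom group_F group_P by (simp add: group_hom_def group_hom_axioms_def)

lemma \<iota>_hom: "v \<in> verts \<Gamma> \<Longrightarrow> \<iota> v \<in> hom (G v) P"
  using hom_compose[OF fp_incl_hom proj_hom, of v] unfolding \<iota>_def[abs_def] by (simp add: o_def)

lemma \<iota>_in: "v \<in> verts \<Gamma> \<Longrightarrow> g \<in> carrier (G v) \<Longrightarrow> \<iota> v g \<in> carrier P"
  using \<iota>_hom by (auto simp: hom_def)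

lemma \<iota>_mult: "v \<in> verts \<Gamma> \<Longrightarrow> g \<in> carrier (G v) \<Longrightarrow> h \<in> carrier (G v) \<Longrightarrow>
    \<iota> v (g \<otimes>\<^bsub>G v\<^esub> h) = \<iota> v g \<otimes>\<^bsub>P\<^esub> \<iota> v h"
  using \<iota>_hom by (auto simp: hom_def)

lemma \<iota>_group_hom: "v \<in> verts \<Gamma> \<Longrightarrow> group_hom (G v) P (\<iota> v)"
  using \<iota>_hom group_G group_P by (simp add: group_hom_def group_hom_axioms_def)

lemma \<iota>_one: "v \<in> verts \<Gamma> \<Longrightarrow> \<iota> v \<one>\<^bsub>G v\<^esub> = \<one>\<^bsub>P\<^esub>"
  using group_hom.hom_one[OF \<iota>_group_hom] .

lemma \<iota>_inv: "v \<in> verts \<Gamma> \<Longrightarrow> g \<in> carrier (G v) \<Longrightarrow> \<iota> v (inv\<^bsub>G v\<^esub> g) = inv\<^bsub>P\<^esub> (\<iota> v g)"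
  using group_hom.hom_inv[OF \<iota>_group_hom] by simp

lemma vertex_subgroup_subgroup: "v \<in> verts \<Gamma> \<Longrightarrow> subgroup (vertex_subgroup \<Gamma> G v) P"
  unfolding vertex_subgroup_eq by (rule group_hom.img_is_subgroup[OF \<iota>_group_hom])

lemma P_generated: "generate P (\<Union>v\<in>verts \<Gamma>. vertex_subgroup \<Gamma> G v) = carrier P"
proof -
  interpret group_hom F P proj by (rule group_hom_proj)
  let ?S = "\<Union>v\<in>verts \<Gamma>. fp_incl (verts \<Gamma>) G v ` carrier (G v)"
  have "(\<Union>v\<in>verts \<Gamma>. vertex_subgroup \<Gamma> G v) = proj ` ?S"
    by (auto simp: vertex_subgroup_eq \<iota>_def)
  moreover have "generate P (proj ` ?S) = proj ` generate F ?S"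
    by (rule generate_img) (auto simp: fp_incl_in)
  moreover have "proj ` carrier F = carrier P"
    unfolding P_eq carrier_FactGroup proj_def ..
  ultimately show ?thesis using F_generated by simp
qed

lemma \<iota>_commute:
  assumes "{u, v} \<in> edges \<Gamma>" and g: "g \<in> carrier (G u)" "h \<in> carrier (G v)"
  shows "\<iota> u g \<otimes>\<^bsub>P\<^esub> \<iota> v h = \<iota> v h \<otimes>\<^bsub>P\<^esub> \<iota> u g"
proof -
  interpret group_hom F P proj by (rule group_hom_proj)
  have uv: "u \<in> verts \<Gamma>" "v \<in> verts \<Gamma>" using edge_verts assms by auto
  let ?a = "fp_incl (verts \<Gamma>) G u g" and ?b = "fp_incl (verts \<Gamma>) G v h"
  have c: "?a \<in> carrier F" "?b \<in> carrier F" using fp_incl_in uv g by auto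
  let ?c = "?a \<otimes>\<^bsub>F\<^esub> ?b \<otimes>\<^bsub>F\<^esub> inv\<^bsub>F\<^esub> ?a \<otimes>\<^bsub>F\<^esub> inv\<^bsub>F\<^esub> ?b"
  have "?c \<in> edge_commutators \<Gamma> G"
    using assms unfolding edge_commutators_def Let_def by blast
  then have "?c \<in> N" using normal_closure_normal(2)[OF group_F edge_commutators_carrier] by blast
  then have "proj ?c = \<one>\<^bsub>P\<^esub>"
    unfolding proj_def P_eq one_FactGroup
    using G.coset_join2 normal_imp_subgroup[OF N_normal] c by simp
  moreover have "proj ?c = \<iota> u g \<otimes>\<^bsub>P\<^esub> \<iota> v h \<otimes>\<^bsub>P\<^esub> inv\<^bsub>P\<^esub> (\<iota> u g) \<otimes>\<^bsub>P\<^esub> inv\<^bsub>P\<^esub> (\<iota> v h)"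
    using c by (simp add: \<iota>_def)
  ultimately have "\<iota> u g \<otimes>\<^bsub>P\<^esub> \<iota> v h \<otimes>\<^bsub>P\<^esub> inv\<^bsub>P\<^esub> (\<iota> u g) \<otimes>\<^bsub>P\<^esub> inv\<^bsub>P\<^esub> (\<iota> v h) = \<one>\<^bsub>P\<^esub>" by simp
  then have "\<iota> u g \<otimes>\<^bsub>P\<^esub> \<iota> v h \<otimes>\<^bsub>P\<^esub> inv\<^bsub>P\<^esub> (\<iota> u g) = \<iota> v h"
    using \<iota>_in uv g H.inv_equality[of _ "inv\<^bsub>P\<^esub> (\<iota> v h)"] by (simp add: H.inv_solve_right')
  then show ?thesis using \<iota>_in uv g by (metis H.inv_solve_right H.m_closed)
qed

lemma graph_product_universal:
  assumes K: "group K" and \<phi>: "\<And>v. v \<in> verts \<Gamma> \<Longrightarrow> \<phi> v \<in> hom (G v) K"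
    and comm: "\<And>u v g h. {u, v} \<in> edges \<Gamma> \<Longrightarrow> g \<in> carrier (G u) \<Longrightarrow> h \<in> carrier (G v) \<Longrightarrow>
      \<phi> u g \<otimes>\<^bsub>K\<^esub> \<phi> v h = \<phi> v h \<otimes>\<^bsub>K\<^esub> \<phi> u g"
  shows "\<exists>\<Phi>\<in>hom P K. \<forall>v\<in>verts \<Gamma>. \<forall>g\<in>carrier (G v). \<Phi> (\<iota> v g) = \<phi> v g"
proof -
  obtain \<Phi> where \<Phi>: "\<Phi> \<in> hom F K" "\<And>v g. v \<in> verts \<Gamma> \<Longrightarrow> g \<in> carrier (G v) \<Longrightarrow> \<Phi> (fp_incl (verts \<Gamma>) G v g) = \<phi> v g"
    using free_product_universal[OF K \<phi>] by blast
  interpret group_hom F K \<Phi>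
    using \<Phi>(1) group_F K by (simp add: group_hom_def group_hom_axioms_def)
  have \<phi>_in: "\<phi> v g \<in> carrier K" if "v \<in> verts \<Gamma>" "g \<in> carrier (G v)" for v g
    using \<phi>[OF that(1)] that(2) by (auto simp: hom_def)
  have "edge_commutators \<Gamma> G \<subseteq> kernel F K \<Phi>"
  proof
    fix c assume "c \<in> edge_commutators \<Gamma> G"
    then obtain u v g h where c: "{u, v} \<in> edges \<Gamma>" "g \<in> carrier (G u)" "h \<in> carrier (G v)"
      "c = fp_incl (verts \<Gamma>) G u g \<otimes>\<^bsub>F\<^esub> fp_incl (verts \<Gamma>) G v h \<otimes>\<^bsub>F\<^esub>
         inv\<^bsub>F\<^esub> (fp_incl (verts \<Gamma>) G u g) \<otimes>\<^bsub>F\<^esub> inv\<^bsub>F\<^esub> (fp_incl (verts \<Gamma>) G v h)"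
      unfolding edge_commutators_def Let_def by blast
    have uv: "u \<in> verts \<Gamma>" "v \<in> verts \<Gamma>" using edge_verts c by auto
    have cc: "fp_incl (verts \<Gamma>) G u g \<in> carrier F" "fp_incl (verts \<Gamma>) G v h \<in> carrier F"
      using fp_incl_in uv c by auto
    have "\<Phi> c = \<phi> u g \<otimes>\<^bsub>K\<^esub> \<phi> v h \<otimes>\<^bsub>K\<^esub> inv\<^bsub>K\<^esub> (\<phi> u g) \<otimes>\<^bsub>K\<^esub> inv\<^bsub>K\<^esub> (\<phi> v h)"
      using cc c uv \<Phi>(2) by simp
    also have "\<phi> u g \<otimes>\<^bsub>K\<^esub> \<phi> v h = \<phi> v h \<otimes>\<^bsub>K\<^esub> \<phi> u g" by (rule comm[OF c(1-3)])
    finally have "\<Phi> c = \<one>\<^bsub>K\<^esub>" using \<phi>_in uv c by (simp add: H.m_assoc)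
    moreover have "c \<in> carrier F" using cc c(4) by simp
    ultimately show "c \<in> kernel F K \<Phi>" by (simp add: kernel_def)
  qed
  then have "N \<subseteq> kernel F K \<Phi>" by (rule normal_closure_least[OF normal_kernel])
  then obtain \<Psi> where \<Psi>: "\<Psi> \<in> hom (F Mod N) K" "\<And>x. x \<in> carrier F \<Longrightarrow> \<Psi> (N #>\<^bsub>F\<^esub> x) = \<Phi> x"
    using FactGroup_universal_kernel[OF N_normal] by blast
  have "\<Psi> (\<iota> v g) = \<phi> v g" if "v \<in> verts \<Gamma>" "g \<in> carrier (G v)" for v g
    using \<Psi>(2)[OF fp_incl_in[OF that]] \<Phi>(2)[OF that] by (simp add: \<iota>_def proj_def)
  then show ?thesis using \<Psi>(1) unfolding P_eq by blast
qed

end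

section \<open>Leading syllables of a graph product\<close>

text \<open>The group of bijections of \<open>X\<close> consists of functions restricted to \<open>X\<close>, hence the restriction.\<close>

lemma action_hom_BijGroup:
  assumes "group K"
    and closed: "\<And>s x. s \<in> carrier K \<Longrightarrow> x \<in> X \<Longrightarrow> act s x \<in> X"
    and one: "\<And>x. x \<in> X \<Longrightarrow> act \<one>\<^bsub>K\<^esub> x = x"
    and mult: "\<And>s s' x. s \<in> carrier K \<Longrightarrow> s' \<in> carrier K \<Longrightarrow> x \<in> X \<Longrightarrow> act (s \<otimes>\<^bsub>K\<^esub> s') x = act s (act s' x)"
  shows "(\<lambda>s. restrict (act s) X) \<in> hom K (BijGroup X)"
proof -
  interpret group K by fact
  have bij: "restrict (act s) X \<in> Bij X" if s: "s \<in> carrier K" for s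
  proof -
    have "bij_betw (act s) X X"
    proof (rule bij_betw_byWitness[where f' = "act (inv\<^bsub>K\<^esub> s)"])
      show "\<forall>a\<in>X. act (inv\<^bsub>K\<^esub> s) (act s a) = a" using mult[of "inv\<^bsub>K\<^esub> s" s] one s by simp
      show "\<forall>a\<in>X. act s (act (inv\<^bsub>K\<^esub> s) a) = a" using mult[of s "inv\<^bsub>K\<^esub> s"] one s by simp
    qed (use closed s in auto)
    then show ?thesis by (simp add: Bij_def bij_betw_def inj_on_restrict_eq)
  qed
  show ?thesis
  proof (rule homI)
    show "restrict (act s) X \<in> carrier (BijGroup X)" if "s \<in> carrier K" for s
      using bij[OF that] by (simp add: BijGroup_def)
    show "restrict (act (s \<otimes>\<^bsub>K\<^esub> s')) X = restrict (act s) X \<otimes>\<^bsub>BijGroup X\<^esub> restrict (act s') X"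
      if "s \<in> carrier K" "s' \<in> carrier K" for s s'
    proof -
      have "restrict (act (s \<otimes>\<^bsub>K\<^esub> s')) X = compose X (restrict (act s) X) (restrict (act s') X)"
        using mult[OF that] closed[OF that(2)] by (auto simp: compose_def restrict_def)
      then show ?thesis using bij that by (simp add: BijGroup_def)
    qed
  qed
qed

lemma mult_BijGroup_apply:
  assumes "f \<in> carrier (BijGroup X)" "g \<in> carrier (BijGroup X)" "x \<in> X"
  shows "(f \<otimes>\<^bsub>BijGroup X\<^esub> g) x = f (g x)"
  using assms by (simp add: BijGroup_def compose_def)

lemma one_BijGroup_apply: "x \<in> X \<Longrightarrow> \<one>\<^bsub>BijGroup X\<^esub> x = x"
  by (simp add: BijGroup_def)

lemma BijGroup_apply_in: "f \<in> carrier (BijGroup X) \<Longrightarrow> x \<in> X \<Longrightarrow> f x \<in> X"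
  using Bij_imp_funcset by (fastforce simp: BijGroup_def)

context graph_family
begin

abbreviation nb where "nb u v \<equiv> (u, v) \<in> adj \<Gamma>"
abbreviation St where "St \<equiv> star_subgroup P (verts \<Gamma>) nb (vertex_subgroup \<Gamma> G)"

lemma nb_edge: "nb u v \<longleftrightarrow> {u, v} \<in> edges \<Gamma>"
  using edge_verts by (auto simp: adj_def)

lemma vertex_subgroup_carrier: "v \<in> verts \<Gamma> \<Longrightarrow> vertex_subgroup \<Gamma> G v \<subseteq> carrier P"
  using \<iota>_in by (auto simp: vertex_subgroup_eq)

lemma St_subgroup: "subgroup (St v) P"
  unfolding star_subgroup_def
  by (rule group.generate_is_subgroup[OF group_P]) (use vertex_subgroup_carrier in blast)

lemma \<iota>_in_St: "u \<in> verts \<Gamma> \<Longrightarrow> u = v \<or> nb v u \<Longrightarrow> g \<in> carrier (G u) \<Longrightarrow> \<iota> u g \<in> St v"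
  unfolding star_subgroup_def by (rule generate.incl) (auto simp: vertex_subgroup_eq)

lemma St_mult_iff:
  assumes "u \<in> verts \<Gamma>" "u = v \<or> nb v u" "g \<in> carrier (G u)" "p \<in> carrier P"
  shows "p \<otimes>\<^bsub>P\<^esub> \<iota> u g \<in> St v \<longleftrightarrow> p \<in> St v"
proof -
  interpret P: group P by (rule group_P)
  interpret S: subgroup "St v" P by (rule St_subgroup)
  have i: "\<iota> u g \<in> St v" using \<iota>_in_St assms by blast
  show ?thesis
  proof
    assume "p \<otimes>\<^bsub>P\<^esub> \<iota> u g \<in> St v"
    then have "p \<otimes>\<^bsub>P\<^esub> \<iota> u g \<otimes>\<^bsub>P\<^esub> inv\<^bsub>P\<^esub> (\<iota> u g) \<in> St v" using i by auto
    then show "p \<in> St v" using assms i by (simp add: P.m_assoc)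
  qed (use i in auto)
qed

text \<open>Left multiplication on words has to be turned into appending letters, so \<open>s\<close> acts by appending its inverse to the
element \<open>p\<close>. The second component is the accumulated syllable; it is updated exactly when the edge that leaves \<open>p\<close> crosses
the hyperplane of \<open>G\<^sub>v\<close> at the identity.\<close>

definition cocycle_act :: "'v \<Rightarrow> 'v \<Rightarrow> 'g \<Rightarrow> ('v \<times> 'g) list set set \<times> 'g \<Rightarrow> ('v \<times> 'g) list set set \<times> 'g" where
  "cocycle_act v u s = (\<lambda>(p, t). (p \<otimes>\<^bsub>P\<^esub> \<iota> u (inv\<^bsub>G u\<^esub> s),
     if u = v \<and> p \<in> St v then t \<otimes>\<^bsub>G v\<^esub> inv\<^bsub>G u\<^esub> s else t))"

lemma cocycle_act_closed:
  assumes "v \<in> verts \<Gamma>" "u \<in> verts \<Gamma>" "s \<in> carrier (G u)" "x \<in> carrier P \<times> carrier (G v)"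
  shows "cocycle_act v u s x \<in> carrier P \<times> carrier (G v)"
proof -
  interpret P: group P by (rule group_P)
  interpret Gu: group "G u" by (rule group_G[OF assms(2)])
  interpret Gv: group "G v" by (rule group_G[OF assms(1)])
  show ?thesis using assms(3,4) \<iota>_in[OF assms(2)]
    by (auto simp: cocycle_act_def split: prod.splits)
qed

lemma cocycle_act_hom:
  assumes v: "v \<in> verts \<Gamma>" and u: "u \<in> verts \<Gamma>"
  shows "(\<lambda>s. restrict (cocycle_act v u s) (carrier P \<times> carrier (G v)))
    \<in> hom (G u) (BijGroup (carrier P \<times> carrier (G v)))"
proof (rule action_hom_BijGroup)
  interpret P: group P by (rule group_P)
  interpret Gu: group "G u" by (rule group_G[OF u])
  interpret Gv: group "G v" by (rule group_G[OF v])
  show "group (G u)" by (rule group_G[OF u])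
  show "cocycle_act v u s x \<in> carrier P \<times> carrier (G v)"
    if "s \<in> carrier (G u)" "x \<in> carrier P \<times> carrier (G v)" for s x
    using cocycle_act_closed v u that by blast
  show "cocycle_act v u \<one>\<^bsub>G u\<^esub> x = x" if "x \<in> carrier P \<times> carrier (G v)" for x
    using that \<iota>_one[OF u] by (auto simp: cocycle_act_def split: prod.splits)
  show "cocycle_act v u (s \<otimes>\<^bsub>G u\<^esub> s') x = cocycle_act v u s (cocycle_act v u s' x)"
    if s: "s \<in> carrier (G u)" "s' \<in> carrier (G u)" and x: "x \<in> carrier P \<times> carrier (G v)" for s s' x
  proof -
    obtain p t where pt: "x = (p, t)" "p \<in> carrier P" "t \<in> carrier (G v)" using x by blast
    have "p \<otimes>\<^bsub>P\<^esub> \<iota> u (inv\<^bsub>G u\<^esub> s') \<in> St v \<longleftrightarrow> p \<in> St v" if "u = v"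
      using St_mult_iff[OF u _ _ pt(2)] that s by simp
    then show ?thesis
      using pt s \<iota>_in[OF u] \<iota>_mult[OF u]
      by (auto simp: cocycle_act_def Gu.inv_mult_group Gv.inv_mult_group P.m_assoc Gv.m_assoc)
  qed
qed

text \<open>Only the case that one of the two letters has type \<open>v\<close> matters. The other letter then belongs to the star subgroup of
\<open>v\<close>, so it does not affect whether the first one is counted.\<close>

lemma cocycle_act_commute:
  assumes v: "v \<in> verts \<Gamma>" and e: "{u, w} \<in> edges \<Gamma>" and s: "s \<in> carrier (G u)" "t \<in> carrier (G w)"
    and x: "x \<in> carrier P \<times> carrier (G v)"
  shows "cocycle_act v u s (cocycle_act v w t x) = cocycle_act v w t (cocycle_act v u s x)"
proof -
  have uw: "u \<in> verts \<Gamma>" "w \<in> verts \<Gamma>" "u \<noteq> w" using edge_verts e by auto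
  interpret P: group P by (rule group_P)
  interpret Gu: group "G u" by (rule group_G[OF uw(1)])
  interpret Gw: group "G w" by (rule group_G[OF uw(2)])
  obtain p r where pr: "x = (p, r)" "p \<in> carrier P" "r \<in> carrier (G v)" using x by blast
  have i: "\<iota> u (inv\<^bsub>G u\<^esub> s) \<in> carrier P" "\<iota> w (inv\<^bsub>G w\<^esub> t) \<in> carrier P" using \<iota>_in uw s by auto
  have "\<iota> u (inv\<^bsub>G u\<^esub> s) \<otimes>\<^bsub>P\<^esub> \<iota> w (inv\<^bsub>G w\<^esub> t) = \<iota> w (inv\<^bsub>G w\<^esub> t) \<otimes>\<^bsub>P\<^esub> \<iota> u (inv\<^bsub>G u\<^esub> s)"
    using \<iota>_commute[OF e] s by simp
  then have "p \<otimes>\<^bsub>P\<^esub> \<iota> w (inv\<^bsub>G w\<^esub> t) \<otimes>\<^bsub>P\<^esub> \<iota> u (inv\<^bsub>G u\<^esub> s) = p \<otimes>\<^bsub>P\<^esub> \<iota> u (inv\<^bsub>G u\<^esub> s) \<otimes>\<^bsub>P\<^esub> \<iota> w (inv\<^bsub>G w\<^esub> t)"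
    using i pr(2) by (simp add: P.m_assoc)
  moreover have "p \<otimes>\<^bsub>P\<^esub> \<iota> w (inv\<^bsub>G w\<^esub> t) \<in> St v \<longleftrightarrow> p \<in> St v" if "u = v"
    using St_mult_iff[OF uw(2) _ _ pr(2)] that s e nb_edge by simp
  moreover have "p \<otimes>\<^bsub>P\<^esub> \<iota> u (inv\<^bsub>G u\<^esub> s) \<in> St v \<longleftrightarrow> p \<in> St v" if "w = v"
    using St_mult_iff[OF uw(1) _ _ pr(2)] that s e nb_edge by (simp add: insert_commute)
  ultimately show ?thesis using uw(3) pr(1) by (auto simp: cocycle_act_def)
qed

text \<open>The properties that determine the leading syllable of type \<open>v\<close>, with values in the group \<open>G\<^sub>v\<close> itself. That they
hold in \<open>G\<^sub>v\<close> shows at the same time that \<open>G\<^sub>v\<close> embeds into the graph product.\<close>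

definition leading_syllable :: "'v \<Rightarrow> (('v \<times> 'g) list set set \<Rightarrow> 'g) \<Rightarrow> bool" where
  "leading_syllable v \<tau> \<longleftrightarrow> (\<forall>p\<in>carrier P. \<tau> p \<in> carrier (G v)) \<and> \<tau> \<one>\<^bsub>P\<^esub> = \<one>\<^bsub>G v\<^esub> \<and>
    (\<forall>p\<in>carrier P. \<forall>u\<in>verts \<Gamma>. \<forall>s\<in>carrier (G u).
       \<tau> (p \<otimes>\<^bsub>P\<^esub> \<iota> u s) = (if u = v \<and> p \<in> St v then \<tau> p \<otimes>\<^bsub>G v\<^esub> s else \<tau> p))"

text \<open>By the universal property the commuting actions extend to an action of the graph product on pairs. The inverse of \<open>p\<close> moves
the initial pair \<open>(\<one>, \<one>)\<close> to \<open>(p, \<tau> p)\<close>, and this defines \<open>\<tau>\<close>.\<close>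

lemma leading_syllable_exists:
  assumes v: "v \<in> verts \<Gamma>"
  shows "\<exists>\<tau>. leading_syllable v \<tau>"
proof -
  let ?X = "carrier P \<times> carrier (G v)"
  interpret P: group P by (rule group_P)
  interpret Gv: group "G v" by (rule group_G[OF v])
  obtain \<Phi> where \<Phi>: "\<Phi> \<in> hom P (BijGroup ?X)"
    and \<Phi>_\<iota>: "\<And>u s. u \<in> verts \<Gamma> \<Longrightarrow> s \<in> carrier (G u) \<Longrightarrow> \<Phi> (\<iota> u s) = restrict (cocycle_act v u s) ?X"
  proof -
    have "\<exists>\<Phi>\<in>hom P (BijGroup ?X). \<forall>u\<in>verts \<Gamma>. \<forall>s\<in>carrier (G u). \<Phi> (\<iota> u s) = restrict (cocycle_act v u s) ?X"
    proof (rule graph_product_universal[OF group_BijGroup cocycle_act_hom[OF v]])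
      fix u w s t assume e: "{u, w} \<in> edges \<Gamma>" and s: "s \<in> carrier (G u)" "t \<in> carrier (G w)"
      have uw: "u \<in> verts \<Gamma>" "w \<in> verts \<Gamma>" using edge_verts e by auto
      let ?f = "restrict (cocycle_act v u s) ?X" and ?g = "restrict (cocycle_act v w t) ?X"
      have fg: "?f \<in> Bij ?X" "?g \<in> Bij ?X"
        using hom_in_carrier[OF cocycle_act_hom[OF v uw(1)] s(1)] hom_in_carrier[OF cocycle_act_hom[OF v uw(2)] s(2)]
        by (simp_all add: BijGroup_def)
      have "compose ?X ?f ?g = compose ?X ?g ?f"
        using cocycle_act_commute[OF v e s] cocycle_act_closed[OF v uw(1) s(1)] cocycle_act_closed[OF v uw(2) s(2)]
        by (intro ext) (simp add: compose_def)
      then show "?f \<otimes>\<^bsub>BijGroup ?X\<^esub> ?g = ?g \<otimes>\<^bsub>BijGroup ?X\<^esub> ?f" using fg by (simp add: BijGroup_def)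
    qed
    then show ?thesis using that by blast
  qed
  interpret \<Phi>: group_hom P "BijGroup ?X" \<Phi>
    using \<Phi> group_P group_BijGroup by (simp add: group_hom_def group_hom_axioms_def)
  have \<Phi>_mult: "\<Phi> (a \<otimes>\<^bsub>P\<^esub> b) x = \<Phi> a (\<Phi> b x)" if "a \<in> carrier P" "b \<in> carrier P" "x \<in> ?X" for a b x
    using mult_BijGroup_apply[OF \<Phi>.hom_closed[OF that(1)] \<Phi>.hom_closed[OF that(2)] that(3)] that by simp
  note [simp del] = \<Phi>.hom_mult \<Phi>.hom_inv
  have \<Phi>_in: "\<Phi> a x \<in> ?X" if "a \<in> carrier P" "x \<in> ?X" for a x
    using BijGroup_apply_in[OF \<Phi>.hom_closed[OF that(1)] that(2)] .
  have \<Phi>_gen: "\<forall>x\<in>?X. fst (\<Phi> (\<iota> u s) x) = fst x \<otimes>\<^bsub>P\<^esub> inv\<^bsub>P\<^esub> (\<iota> u s)"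
    if "u \<in> verts \<Gamma>" "s \<in> carrier (G u)" for u s
    using that by (auto simp: \<Phi>_\<iota> cocycle_act_def \<iota>_inv)
  have \<Phi>_fst: "\<forall>x\<in>?X. fst (\<Phi> a x) = fst x \<otimes>\<^bsub>P\<^esub> inv\<^bsub>P\<^esub> a"
    if "a \<in> generate P (\<Union>v\<in>verts \<Gamma>. vertex_subgroup \<Gamma> G v)" for a
    using that
  proof (induction rule: generate.induct)
    case one
    then show ?case by (auto simp: one_BijGroup_apply)
  next
    case (incl h)
    then obtain u s where "u \<in> verts \<Gamma>" "s \<in> carrier (G u)" "h = \<iota> u s" by (auto simp: vertex_subgroup_eq)
    then show ?case using \<Phi>_gen by simp
  next
    case (inv h)
    then obtain u s where us: "u \<in> verts \<Gamma>" "s \<in> carrier (G u)" "h = \<iota> u s" by (auto simp: vertex_subgroup_eq)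
    interpret Gu: group "G u" by (rule group_G[OF us(1)])
    have "inv\<^bsub>P\<^esub> h = \<iota> u (inv\<^bsub>G u\<^esub> s)" using us \<iota>_inv by simp
    then show ?case using \<Phi>_gen[OF us(1) Gu.inv_closed[OF us(2)]] by (simp only:)
  next
    case (eng a b)
    then have ab: "a \<in> carrier P" "b \<in> carrier P" using P_generated by auto
    show ?case
    proof
      fix x assume x: "x \<in> ?X"
      then have "fst x \<in> carrier P" by auto
      then show "fst (\<Phi> (a \<otimes>\<^bsub>P\<^esub> b) x) = fst x \<otimes>\<^bsub>P\<^esub> inv\<^bsub>P\<^esub> (a \<otimes>\<^bsub>P\<^esub> b)"
        using \<Phi>_mult[OF ab x] bspec[OF eng.IH(1) \<Phi>_in[OF ab(2) x]] bspec[OF eng.IH(2) x] ab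
        by (simp add: P.m_assoc P.inv_mult_group)
    qed
  qed
  define \<tau> where "\<tau> p = snd (\<Phi> (inv\<^bsub>P\<^esub> p) (\<one>\<^bsub>P\<^esub>, \<one>\<^bsub>G v\<^esub>))" for p
  have \<Phi>_base: "\<Phi> (inv\<^bsub>P\<^esub> p) (\<one>\<^bsub>P\<^esub>, \<one>\<^bsub>G v\<^esub>) = (p, \<tau> p)" if "p \<in> carrier P" for p
    using \<Phi>_fst[of "inv\<^bsub>P\<^esub> p"] that P_generated by (simp add: \<tau>_def prod_eq_iff)
  have \<tau>_in: "\<tau> p \<in> carrier (G v)" if "p \<in> carrier P" for p
    using \<Phi>_in[of "inv\<^bsub>P\<^esub> p" "(\<one>\<^bsub>P\<^esub>, \<one>\<^bsub>G v\<^esub>)"] that by (simp add: \<Phi>_base)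
  moreover have "\<tau> \<one>\<^bsub>P\<^esub> = \<one>\<^bsub>G v\<^esub>"
    using one_BijGroup_apply[of "(\<one>\<^bsub>P\<^esub>, \<one>\<^bsub>G v\<^esub>)" ?X] by (simp add: \<tau>_def)
  moreover have "\<tau> (p \<otimes>\<^bsub>P\<^esub> \<iota> u s) = (if u = v \<and> p \<in> St v then \<tau> p \<otimes>\<^bsub>G v\<^esub> s else \<tau> p)"
    if p: "p \<in> carrier P" "u \<in> verts \<Gamma>" "s \<in> carrier (G u)" for p u s
  proof -
    interpret Gu: group "G u" by (rule group_G[OF p(2)])
    have "inv\<^bsub>P\<^esub> (p \<otimes>\<^bsub>P\<^esub> \<iota> u s) = \<iota> u (inv\<^bsub>G u\<^esub> s) \<otimes>\<^bsub>P\<^esub> inv\<^bsub>P\<^esub> p"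
      using p \<iota>_in \<iota>_inv by (simp add: P.inv_mult_group)
    then have "\<Phi> (inv\<^bsub>P\<^esub> (p \<otimes>\<^bsub>P\<^esub> \<iota> u s)) (\<one>\<^bsub>P\<^esub>, \<one>\<^bsub>G v\<^esub>) = \<Phi> (\<iota> u (inv\<^bsub>G u\<^esub> s)) (p, \<tau> p)"
      using \<Phi>_mult[of "\<iota> u (inv\<^bsub>G u\<^esub> s)" "inv\<^bsub>P\<^esub> p"] p \<iota>_in by (simp add: \<Phi>_base)
    also have "\<dots> = cocycle_act v u (inv\<^bsub>G u\<^esub> s) (p, \<tau> p)"
      using p \<tau>_in by (simp add: \<Phi>_\<iota>)
    finally show ?thesis using p by (auto simp: \<tau>_def[of "p \<otimes>\<^bsub>P\<^esub> \<iota> u s"] cocycle_act_def)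
  qed
  ultimately show ?thesis unfolding leading_syllable_def by (intro exI[of _ \<tau>]) simp
qed

lemma leading_syllables_exist:
  "\<exists>\<sigma>. leading_syllables P (verts \<Gamma>) nb (vertex_subgroup \<Gamma> G) \<sigma>"
proof -
  have "\<forall>v\<in>verts \<Gamma>. \<exists>\<tau>. leading_syllable v \<tau>" using leading_syllable_exists by blast
  then obtain \<tau> where "\<forall>v\<in>verts \<Gamma>. leading_syllable v (\<tau> v)" by (rule bchoice[THEN exE])
  then have lead: "leading_syllable v (\<tau> v)" if "v \<in> verts \<Gamma>" for v using that by blast
  have \<tau>_in: "\<tau> v p \<in> carrier (G v)" if "v \<in> verts \<Gamma>" "p \<in> carrier P" for v p
    using lead[OF that(1)] that(2) unfolding leading_syllable_def by blast
  have \<tau>_one: "\<tau> v \<one>\<^bsub>P\<^esub> = \<one>\<^bsub>G v\<^esub>" if "v \<in> verts \<Gamma>" for v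
    using lead[OF that] unfolding leading_syllable_def by blast
  have \<tau>: "\<tau> v (p \<otimes>\<^bsub>P\<^esub> \<iota> u s) = (if u = v \<and> p \<in> St v then \<tau> v p \<otimes>\<^bsub>G v\<^esub> s else \<tau> v p)"
    if "v \<in> verts \<Gamma>" "p \<in> carrier P" "u \<in> verts \<Gamma>" "s \<in> carrier (G u)" for v p u s
    using lead[OF that(1)] that(2-4) unfolding leading_syllable_def by blast
  interpret P: group P by (rule group_P)
  have "leading_syllables P (verts \<Gamma>) nb (vertex_subgroup \<Gamma> G) (\<lambda>v p. \<iota> v (\<tau> v p))"
  proof (intro leading_syllables.intro leading_syllables_axioms.intro)
    show "group P" by (rule group_P)
    show "nb v u" if "nb u v" for u v using that by (rule adj_sym)
    show "\<not> nb v v" for v using nb_edge edge_verts by blast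
    show "subgroup (vertex_subgroup \<Gamma> G v) P" if "v \<in> verts \<Gamma>" for v
      by (rule vertex_subgroup_subgroup[OF that])
    show "\<exists>s\<in>vertex_subgroup \<Gamma> G v. s \<noteq> \<one>\<^bsub>P\<^esub>" if v: "v \<in> verts \<Gamma>" for v
    proof -
      interpret Gv: group "G v" by (rule group_G[OF v])
      obtain s where s: "s \<in> carrier (G v)" "s \<noteq> \<one>\<^bsub>G v\<^esub>"
        using nontrivial[OF v] Gv.is_group Gv.one_closed unfolding trivial_group_def by blast
      have "\<iota> v s \<noteq> \<one>\<^bsub>P\<^esub>"
      proof
        assume "\<iota> v s = \<one>\<^bsub>P\<^esub>"
        moreover have "\<tau> v (\<one>\<^bsub>P\<^esub> \<otimes>\<^bsub>P\<^esub> \<iota> v s) = \<tau> v \<one>\<^bsub>P\<^esub> \<otimes>\<^bsub>G v\<^esub> s"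
          using \<tau>[OF v P.one_closed v s(1)] subgroup.one_closed[OF St_subgroup] by simp
        ultimately show False using \<tau>_one[OF v] s by simp
      qed
      then show ?thesis using s by (auto simp: vertex_subgroup_eq)
    qed
    show "generate P (\<Union>v\<in>verts \<Gamma>. vertex_subgroup \<Gamma> G v) = carrier P" by (rule P_generated)
    show "a \<otimes>\<^bsub>P\<^esub> b = b \<otimes>\<^bsub>P\<^esub> a"
      if "nb u v" "a \<in> vertex_subgroup \<Gamma> G u" "b \<in> vertex_subgroup \<Gamma> G v" for u v a b
      using that \<iota>_commute[of u v] nb_edge[of u v] unfolding vertex_subgroup_eq by blast
    show "\<iota> v (\<tau> v p) \<in> vertex_subgroup \<Gamma> G v" if "v \<in> verts \<Gamma>" "p \<in> carrier P" for v p
      using \<tau>_in[OF that] by (simp add: vertex_subgroup_eq)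
    show "\<iota> v (\<tau> v \<one>\<^bsub>P\<^esub>) = \<one>\<^bsub>P\<^esub>" if "v \<in> verts \<Gamma>" for v
      using \<tau>_one \<iota>_one that by simp
    show "\<iota> v (\<tau> v (p \<otimes>\<^bsub>P\<^esub> s)) = \<iota> v (\<tau> v p) \<otimes>\<^bsub>P\<^esub> s"
      if v: "v \<in> verts \<Gamma>" and p: "p \<in> St v" and s: "s \<in> vertex_subgroup \<Gamma> G v" for v p s
    proof -
      have pc: "p \<in> carrier P" using p subgroup.mem_carrier[OF St_subgroup] by blast
      obtain t where t: "t \<in> carrier (G v)" "s = \<iota> v t" using s by (auto simp: vertex_subgroup_eq)
      show ?thesis using p \<tau>[OF v pc v t(1)] \<iota>_mult[OF v \<tau>_in[OF v pc] t(1)] t(2) by simp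
    qed
    show "\<iota> v (\<tau> v (p \<otimes>\<^bsub>P\<^esub> s)) = \<iota> v (\<tau> v p)"
      if "v \<in> verts \<Gamma>" "u \<in> verts \<Gamma>" "p \<in> carrier P" "s \<in> vertex_subgroup \<Gamma> G u" "u \<noteq> v \<or> p \<notin> St v" for v u p s
      using that \<tau> by (auto simp: vertex_subgroup_eq)
  qed
  then show ?thesis by blast
qed

end

section \<open>Asymptotic dimension of the extension graph\<close>

theorem theorem1p1:
  fixes \<Gamma> :: "'v graph"
    and G :: "'v \<Rightarrow> ('g, 'b) monoid_scheme"
    and n :: nat
  assumes "simplicial_graph \<Gamma>"
    and "connected_graph \<Gamma>"
    and "girth \<Gamma> > 20"
    and "\<And>v. v \<in> verts \<Gamma> \<Longrightarrow> group (G v)"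
    and "\<And>v. v \<in> verts \<Gamma> \<Longrightarrow> \<not> trivial_group (G v)"
    and "graph_asdim_le \<Gamma> n"
  shows "graph_asdim_le (extension_graph \<Gamma> G) (n + 1)"
proof -
  interpret graph_family \<Gamma> G
    by (intro graph_family.intro group_family.intro graph_family_axioms.intro) (use assms in auto)
  obtain \<sigma> where "leading_syllables P (verts \<Gamma>) nb (vertex_subgroup \<Gamma> G) \<sigma>"
    using leading_syllables_exist by blast
  then interpret leading_syllables P "verts \<Gamma>" nb "vertex_subgroup \<Gamma> G" \<sigma> .
  have hyp_graph_eq: "extension_graph \<Gamma> G = hyp_graph"
    unfolding hyp_graph_def extension_graph_def Let_def hyp_def ..
  have "simplicial_graph hyp_graph"
    unfolding simplicial_graph_def hyp_graph_def by (auto simp: card_2_iff)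
  moreover note dim = hyp_graph_coarse_dim[OF assms(2) HOL.refl HOL.refl
      graph_asdim_imp_coarse_dim[OF assms(1,2,6)]]
  ultimately have "graph_asdim_le hyp_graph (Suc n)"
    by (intro coarse_dim_imp_graph_asdim[OF _ dim])
  then show ?thesis by (simp add: hyp_graph_eq)
qed

end
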